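(* For all integers $n,k\ge 0$, let $$A^{\mathrm{maj},\mathrm{des},\mathrm{exc}}_{n,k}(q,p,t) = \sum_{\sigma \in \mathfrak S_n,\ \mathrm{fix}(\sigma) = k} q^{\mathrm{maj}(\sigma)} p^{\mathrm{des}(\sigma)}t^{\mathrm{exc}(\sigma)}.$$ Then (whenever the polynomial in question is nonzero): (1) $A^{\mathrm{maj},\mathrm{des},\mathrm{exc}}_{n,k}(q,p,q^{-1}t)$ is $t$-symmetric with center of symmetry $\frac{n-k}{2}$; (2) $A^{\mathrm{maj},\mathrm{des},\mathrm{exc}}_{n,0}(q,p,q^{-1}t)$ is $t$-symmetric and $t$-unimodal with center of symmetry $\frac n2$; (3) $A^{\mathrm{maj},\mathrm{des},\mathrm{exc}}_{n,k}(q,1,q^{-1}t)$ is $t$-symmetric and $t$-unimodal with center of symmetry $\frac{n-k}{2}$; (4) for $n\ge 1$, $A^{\mathrm{maj},\mathrm{des},\mathrm{exc}}_{n}(q,1,q^{-1}t)$ is $t$-symmetric and $t$-unimodal with center of symmetry $\frac{n-1}{2}$.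
   Context: For $n\ge 1$ let $\mathfrak S_n$ be the symmetric group on $[n]=\{1,\dots,n\}$, and write $\sigma=\sigma_1\cdots\sigma_n$ with $\sigma_i=\sigma(i)$. Put $\mathrm{DES}(\sigma)=\{i\in[n-1]:\sigma_i>\sigma_{i+1}\}$, $\mathrm{des}(\sigma)=|\mathrm{DES}(\sigma)|$, $\mathrm{maj}(\sigma)=\sum_{i\in \mathrm{DES}(\sigma)} i$, $\mathrm{exc}(\sigma)=|\{i\in[n-1]:\sigma_i>i\}|$, and let $\mathrm{fix}(\sigma)$ be the number of fixed points. $\mathfrak S_0$ consists of the empty word, on which all these statistics are $0$. $A_n^{\mathrm{maj},\mathrm{des},\mathrm{exc}}(q,p,t)=\sum_{\sigma\in\mathfrak S_n}q^{\mathrm{maj}(\sigma)}p^{\mathrm{des}(\sigma)}t^{\mathrm{exc}(\sigma)}$. The polynomials are viewed as polynomials in $t$ with coefficients in the polynomial ring $\mathbb Q[q,p]$ (or $\mathbb Q[q]$), partially ordered by: $f\le g$ iff $g-f$ has nonnegative coefficients. Let $R$ be a partially ordered ring and $f(t)=f_rt^r+f_{r+1}t^{r+1}+\cdots+f_st^s$ a nonzero polynomial with coefficients in $R$. Then $f(t)$ is $t$-symmetric with center of symmetry $\frac{s+r}{2}$ if $f_{r+i}=f_{s-i}$ for all $i=0,\dots,s-r$; it is also $t$-unimodal if $f_r\le_R f_{r+1}\le_R\cdots\le_R f_{\lfloor (s+r)/2\rfloor}=f_{\lfloor (s+r+1)/2\rfloor}\ge_R\cdots\ge_R f_{s-1}\ge_R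 f_s$. *)

theory Defs
  imports
    "HOL-Combinatorics.Permutations"
    "HOL-Computational_Algebra.Polynomial"
    "HOL-Library.Poly_Mapping"
    "HOL-Library.Product_Plus"
begin

section \<open>Permutation statistics\<close>

text \<open>The symmetric group on \<open>[n]\<close> is \<open>{\<sigma>. \<sigma> permutes {1..n}}\<close>; for \<open>n = 0\<close> it consists of
  \<open>id\<close> alone, which plays the role of the empty word.\<close>

definition DES :: "nat \<Rightarrow> (nat \<Rightarrow> nat) \<Rightarrow> nat set" where
  "DES n \<sigma> = {i \<in> {1..<n}. \<sigma> i > \<sigma> (i + 1)}"

definition des :: "nat \<Rightarrow> (nat \<Rightarrow> nat) \<Rightarrow> nat" where
  "des n \<sigma> = card (DES n \<sigma>)"

definition maj :: "nat \<Rightarrow> (nat \<Rightarrow> nat) \<Rightarrow> nat" where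
  "maj n \<sigma> = (\<Sum>i\<in>DES n \<sigma>. i)"

definition exc :: "nat \<Rightarrow> (nat \<Rightarrow> nat) \<Rightarrow> nat" where
  "exc n \<sigma> = card {i \<in> {1..<n}. \<sigma> i > i}"

definition num_fix :: "nat \<Rightarrow> (nat \<Rightarrow> nat) \<Rightarrow> nat" where
  "num_fix n \<sigma> = card {i \<in> {1..n}. \<sigma> i = i}"

definition A :: "nat \<Rightarrow> 'a::comm_semiring_1 \<Rightarrow> 'a \<Rightarrow> 'a \<Rightarrow> 'a" where
  "A n q p t = (\<Sum>\<sigma> | \<sigma> permutes {1..n}. q ^ maj n \<sigma> * p ^ des n \<sigma> * t ^ exc n \<sigma>)"

definition A_fix :: "nat \<Rightarrow> nat \<Rightarrow> 'a::comm_semiring_1 \<Rightarrow> 'a \<Rightarrow> 'a \<Rightarrow> 'a" where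
  "A_fix n k q p t =
     (\<Sum>\<sigma> | \<sigma> permutes {1..n} \<and> num_fix n \<sigma> = k. q ^ maj n \<sigma> * p ^ des n \<sigma> * t ^ exc n \<sigma>)"

section \<open>The coefficient ring\<close>

text \<open>The substitution \<open>t \<mapsto> q\<inverse> t\<close> is carried out in the ring \<open>\<rat>[q, q\<inverse>, p][t]\<close>. An element of
  \<open>\<rat>[q, q\<inverse>, p]\<close> maps the exponent pair of each monomial \<open>q\<^sup>a p\<^sup>b\<close> to its coefficient. The subring
  \<open>\<rat>[q, p]\<close> is singled out by \<open>QQ_qp\<close>; the lemmas at the end of this theory show that the
  polynomials of interest have their coefficients there.\<close>

type_synonym laurent_qp = "(int \<times> nat) \<Rightarrow>\<^sub>0 rat"

definition var_q :: "laurent_qp poly" where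
  "var_q = [:Poly_Mapping.single (1, 0) 1:]"

definition inv_q :: "laurent_qp poly" where
  "inv_q = [:Poly_Mapping.single (-1, 0) 1:]"

definition var_p :: "laurent_qp poly" where
  "var_p = [:Poly_Mapping.single (0, 1) 1:]"

definition var_t :: "laurent_qp poly" where
  "var_t = [:0, 1:]"

lemma var_q_mult_inv_q: "var_q * inv_q = 1"
  by (simp add: var_q_def inv_q_def mult_single one_pCons single_one flip: zero_prod_def)

definition QQ_qp :: "laurent_qp set" where
  "QQ_qp = {c. \<forall>a b. Poly_Mapping.lookup c (a, b) \<noteq> 0 \<longrightarrow> 0 \<le> a}"

text \<open>The coefficientwise partial order. It is unrelated to the (linear, lexicographic) order that
  the library puts on the type of finitely supported functions.\<close>

definition coeff_le :: "laurent_qp \<Rightarrow> laurent_qp \<Rightarrow> bool" where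
  "coeff_le f g \<longleftrightarrow> (\<forall>e. 0 \<le> Poly_Mapping.lookup (g - f) e)"

section \<open>Symmetry and unimodality\<close>

text \<open>A nonzero polynomial is written as \<open>f\<^sub>r t\<^sup>r + \<dots> + f\<^sub>s t\<^sup>s\<close> with \<open>f\<^sub>r\<close> and \<open>f\<^sub>s\<close> nonzero, that is,
  \<open>r = low_degree f\<close> and \<open>s = degree f\<close>.\<close>

definition low_degree :: "'a::zero poly \<Rightarrow> nat" where
  "low_degree f = (LEAST i. coeff f i \<noteq> 0)"

definition t_symmetric :: "'a::zero poly \<Rightarrow> rat \<Rightarrow> bool" where
  "t_symmetric f c \<longleftrightarrow> f \<noteq> 0 \<and>
     (let r = low_degree f; s = degree f in
       c = (of_nat s + of_nat r) / 2 \<and>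
       (\<forall>i\<in>{0..s - r}. coeff f (r + i) = coeff f (s - i)))"

definition t_unimodal :: "('a::zero \<Rightarrow> 'a \<Rightarrow> bool) \<Rightarrow> 'a poly \<Rightarrow> bool" where
  "t_unimodal le f \<longleftrightarrow> f \<noteq> 0 \<and>
     (let r = low_degree f; s = degree f in
       (\<forall>i. r \<le> i \<and> i < (s + r) div 2 \<longrightarrow> le (coeff f i) (coeff f (i + 1))) \<and>
       coeff f ((s + r) div 2) = coeff f ((s + r + 1) div 2) \<and>
       (\<forall>i. (s + r + 1) div 2 \<le> i \<and> i < s \<longrightarrow> le (coeff f (i + 1)) (coeff f i)))"

section \<open>The coefficients lie in \<open>\<rat>[q, p]\<close>\<close>

lemma exc_le_maj:
  assumes "\<sigma> permutes {1..n}"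
  shows "exc n \<sigma> \<le> maj n \<sigma>"
proof -
  have fin: "finite (DES n \<sigma>)" by (simp add: DES_def)
  have "i \<le> maj n \<sigma>" if i: "1 \<le> i" "i < n" "\<sigma> i > i" for i
  proof -
    have "\<exists>d\<in>DES n \<sigma>. i \<le> d"
    proof (rule ccontr)
      assume "\<not> ?thesis"
      then have asc: "\<sigma> d \<le> \<sigma> (Suc d)" if "i \<le> d" "d < n" for d
        using that i by (force simp: DES_def)
      have inj: "\<sigma> d \<noteq> \<sigma> (Suc d)" for d
        using permutes_inj[OF assms] by (simp add: inj_eq)
      have "j < \<sigma> j" if "i \<le> j" "j \<le> n" for j
        using that
      proof (induction j rule: dec_induct)
        case base
        then show ?case using i by simp
      next
        case (step m)
        then show ?case using asc[of m] inj[of m] by simp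
      qed
      from this[of n] i have "n < \<sigma> n" by simp
      moreover have "\<sigma> n \<in> {1..n}" using permutes_in_image[OF assms, of n] i by simp
      ultimately show False by simp
    qed
    then obtain d where d: "d \<in> DES n \<sigma>" "i \<le> d" by blast
    have "d \<le> maj n \<sigma>" unfolding maj_def using member_le_sum[OF d(1), of "\<lambda>i. i"] fin by simp
    with d show ?thesis by simp
  qed
  then have "{i \<in> {1..<n}. \<sigma> i > i} \<subseteq> {1..maj n \<sigma>}" by auto
  from card_mono[OF _ this] show ?thesis by (simp add: exc_def)
qed

lemma single_power: "Poly_Mapping.single (a::int, b::nat) (1::rat) ^ m =
    Poly_Mapping.single (int m * a, m * b) 1"
  by (induction m) (simp_all add: mult_single algebra_simps flip: zero_prod_def)

lemma pCons_power: "[:c:] ^ m = [:c ^ m:]" for c :: "'a::comm_semiring_1"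
  by (induction m) (simp_all add: one_pCons mult.commute)

lemma monomial_subst:
  "var_q ^ m * var_p ^ d * (inv_q * var_t) ^ e =
     monom (Poly_Mapping.single (int m - int e, d) 1) e"
proof -
  have "var_t ^ e = monom 1 e"
    by (simp add: var_t_def monom_altdef)
  moreover have "(inv_q * var_t) ^ e = inv_q ^ e * var_t ^ e"
    by (rule power_mult_distrib)
  ultimately show ?thesis
    by (simp add: var_q_def var_p_def inv_q_def pCons_power single_power mult_single smult_monom)
qed

lemma QQ_qp_sum: "(\<And>x. x \<in> S \<Longrightarrow> g x \<in> QQ_qp) \<Longrightarrow> sum g S \<in> QQ_qp"
  unfolding QQ_qp_def mem_Collect_eq lookup_sum by (meson sum.neutral)

lemma coeff_term_in_QQ_qp:
  assumes "\<sigma> permutes {1..n}"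
  shows "coeff (var_q ^ maj n \<sigma> * var_p ^ d * (inv_q * var_t) ^ exc n \<sigma>) j \<in> QQ_qp"
  using exc_le_maj[OF assms]
  by (simp add: monomial_subst QQ_qp_def lookup_single when_def)

lemma coeff_A_fix_in_QQ_qp:
  "coeff (A_fix n k var_q var_p (inv_q * var_t)) j \<in> QQ_qp"
  unfolding A_fix_def coeff_sum by (intro QQ_qp_sum coeff_term_in_QQ_qp) simp

lemma coeff_A_fix_1_in_QQ_qp:
  "coeff (A_fix n k var_q 1 (inv_q * var_t)) j \<in> QQ_qp"
  unfolding A_fix_def coeff_sum using coeff_term_in_QQ_qp[where d = 0]
  by (intro QQ_qp_sum) simp

lemma coeff_A_1_in_QQ_qp:
  "coeff (A n var_q 1 (inv_q * var_t)) j \<in> QQ_qp"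
  unfolding A_def coeff_sum using coeff_term_in_QQ_qp[where d = 0]
  by (intro QQ_qp_sum) simp

end

theory Submission
  imports Defs
    "HOL-Computational_Algebra.Formal_Power_Series"
    "HOL-Library.Multiset"
    "HOL-Library.Product_Lexorder"
begin

text \<open>Bar the value \<open>\<sigma> i\<close> when \<open>\<sigma> i > i\<close>, and let every barred value be smaller than every unbarred one. The
descent set \<open>S\<close> of the barred word, read with the unbarred value \<open>\<sigma> 0 = 0\<close> in front, satisfies
\<open>card S = des \<sigma>\<close> and \<open>\<Sum>S = maj \<sigma> - exc \<sigma>\<close> (\<open>exc_descents_stats\<close>). The substitution of
\<open>q\<inverse> t\<close> for \<open>t\<close> therefore turns the summand of \<open>\<sigma>\<close> into \<open>t\<^sup>e q\<^sup>a p\<^sup>d\<close> with \<open>e = exc \<sigma>\<close>,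
\<open>a = \<Sum>S\<close> and \<open>d = card S\<close>. The monomial \<open>q\<^sup>a p\<^sup>d\<close> is, up to a factor that depends on \<open>n\<close> only, the
generating function over all \<open>M\<close> of the weakly increasing sequences \<open>b\<close> with values in \<open>{0..M}\<close> that
increase strictly at \<open>S\<close>, a value \<open>v\<close> having weight \<open>q ^ (M - v)\<close> (\<open>compat_sum_qweight\<close>). An identity
between sums of such monomials can thus be checked by summing over pairs \<open>(\<sigma>, b)\<close> for every \<open>M\<close>
(\<open>weighted_major_index_eqI\<close>). With arbitrary weights \<open>x\<^sub>v\<close> and positive values of \<open>b\<close>, such sums are
the Eulerian quasisymmetric functions of Shareshian and Wachs in finitely many variables.

They are symmetric functions that can be computed. Let \<open>h\<^sub>a\<close> be the complete homogeneous symmetric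
functions and \<open>[a] = 1 + t + \<dots> + t ^ (a - 1)\<close>. If \<open>Y\<^sub>n\<close> is the sum for the derangements of \<open>n\<close>, then
permutations with \<open>k\<close> fixed points give \<open>h\<^sub>k\<close> times \<open>Y\<close> of index \<open>n - k\<close> (\<open>sum_compat\<close>), and \<open>\<Sum>\<^sub>n Y\<^sub>n z\<^sup>n\<close> is
the inverse of \<open>1 - \<Sum>\<^sub>a t [a - 1] h\<^sub>a z\<^sup>a\<close>, where \<open>a \<ge> 2\<close> (\<open>reduced_gf_eq\<close>). The proof records a pair
\<open>(\<sigma>, b)\<close> as an array: row \<open>v\<close> lists, for the positions \<open>i\<close> with \<open>b i = v\<close>, the letter \<open>b j\<close> with
\<open>\<sigma> j = i\<close>, barred when \<open>j\<close> is an excedance. Sorting the letters stably recovers \<open>\<sigma>\<close>, so that only one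
global condition remains: row \<open>v\<close> is as long as the number of letters \<open>v\<close> in the array. Bars are
determined except for the letters \<open>v\<close> in row \<open>v\<close>, the loops; an initial loop is unbarred, and the fixed
points are the unbarred loops that end a row. Loops at both ends of the rows can be split off, which
leaves the sum over all balanced arrays. It is found by walking through such an array, where every
visit to \<open>v\<close> consumes the first letter of row \<open>v\<close> and moves to that letter: this gives a linear system
(\<open>trail_gf_step\<close>) whose solution is \<open>balanced_gf_eq\<close>.

Expanding the inverse writes \<open>Y\<^sub>n\<close> as a sum over compositions of \<open>n\<close> of products of factors
\<open>t [a - 1] h\<^sub>a\<close>. A product of functions \<open>h\<^sub>a\<close> is itself a sum over pairs \<open>(u, b)\<close>, where \<open>u\<close> is a word
with prescribed letter multiplicities and \<open>b\<close> is strict at the descents of \<open>u\<close> (\<open>sum_words\<close>). Comparing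
the two descriptions, the polynomials of the theorem become sums over words of monomials in \<open>q\<close> and
\<open>p\<close> times products of polynomials \<open>t [a - 1]\<close> (and one factor \<open>[a]\<close> for the sum over all
permutations, one factor \<open>1\<close> otherwise). Each factor \<open>t [a - 1]\<close> is symmetric and unimodal with center
\<open>a / 2\<close>, and such polynomials are closed under products, with centers adding (\<open>sym_unimodal_mult\<close>).

For \<open>k > 0\<close> the exponent of \<open>p\<close> is sensitive to whether \<open>\<sigma> 1 = 1\<close>, and the function attached to
\<open>des\<close> is \<open>h\<^sub>k(x\<^sub>0, \<dots>, x\<^sub>M) Y(x\<^sub>1, \<dots>, x\<^sub>M)\<close>, with one more variable in the first factor. Its symmetry in
\<open>t\<close> passes through the inversion over \<open>M\<close>, which involves subtraction, and this yields the symmetry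
claim (\<open>centered_A_fix\<close>).\<close>

section \<open>Arrays of rows, balanced arrays and trails\<close>

definition letter_wt :: "'a::comm_ring_1 \<Rightarrow> nat \<times> bool \<Rightarrow> 'a" where
  "letter_wt t l = (if snd l then 1 else t)"

type_synonym array = "nat \<Rightarrow> (nat \<times> bool) list"

text \<open>The letter \<open>(u, c)\<close> in row \<open>v\<close> stands for an arc from \<open>v\<close> to \<open>u\<close>, barred when \<open>c\<close> is false. The bar is
forced unless the arc is a loop.\<close>

definition letters :: "nat set \<Rightarrow> nat \<Rightarrow> (nat \<times> bool) set" where
  "letters V v = {l. fst l \<in> V \<and> (fst l < v \<longrightarrow> \<not> snd l) \<and> (v < fst l \<longrightarrow> snd l)}"

definition arrays :: "nat set \<Rightarrow> nat \<Rightarrow> array set" where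
  "arrays V n = {f. (\<forall>v. f v \<in> lists (if v \<in> V then letters V v else {})) \<and>
     (\<Sum>v\<in>V. length (f v)) = n}"

definition inflow :: "nat set \<Rightarrow> array \<Rightarrow> nat \<Rightarrow> nat" where
  "inflow V f u = (\<Sum>v\<in>V. length (filter (\<lambda>l. fst l = u) (f v)))"

text \<open>Every vertex is left as often as it is entered: as a multigraph, the array is Eulerian.\<close>

definition balanced :: "nat set \<Rightarrow> nat \<Rightarrow> array set" where
  "balanced V n = {f \<in> arrays V n. \<forall>u\<in>V. length (f u) = inflow V f u}"

text \<open>The degree condition of an Eulerian trail from \<open>v\<close> to \<open>e\<close>: one more arc leaves than enters \<open>v\<close>, and one
more enters than leaves \<open>e\<close>; for \<open>v = e\<close> the array is balanced.\<close>

definition trails :: "nat set \<Rightarrow> nat \<Rightarrow> nat \<Rightarrow> nat \<Rightarrow> array set" where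
  "trails V e v n = {f \<in> arrays V n.
     \<forall>u\<in>V. length (f u) + of_bool (u = e) = inflow V f u + of_bool (u = v)}"

definition array_wt :: "(nat \<Rightarrow> 'a::comm_ring_1) \<Rightarrow> 'a \<Rightarrow> nat set \<Rightarrow>
    array \<Rightarrow> 'a" where
  "array_wt x t V f = (\<Prod>v\<in>V. \<Prod>l\<leftarrow>f v. x v * letter_wt t l)"

lemma finite_letters: "finite V \<Longrightarrow> finite (letters V v)"
  by (rule finite_subset[of _ "V \<times> UNIV"]) (auto simp: letters_def)

lemma finite_arrays:
  assumes "finite V"
  shows "finite (arrays V n)"
proof -
  have "length (f v) \<le> n" if "f \<in> arrays V n" "v \<in> V" for f v
    using that assms member_le_sum[of v V "\<lambda>v. length (f v)"] by (auto simp: arrays_def)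
  then have "arrays V n \<subseteq> {f. \<forall>v. (v \<in> V \<longrightarrow>
      f v \<in> {l. set l \<subseteq> (\<Union>v\<in>V. letters V v) \<and> length l \<le> n}) \<and> (v \<notin> V \<longrightarrow> f v = [])}"
    by (fastforce simp: arrays_def lists_eq_set split: if_splits)
  then show ?thesis
    by (rule finite_subset)
      (intro finite_set_of_finite_funs finite_lists_length_le finite_UN_I assms finite_letters)
qed

lemma finite_balanced: "finite V \<Longrightarrow> finite (balanced V n)"
  by (rule finite_subset[OF _ finite_arrays]) (auto simp: balanced_def)

lemma finite_trails: "finite V \<Longrightarrow> finite (trails V e v n)"
  by (rule finite_subset[OF _ finite_arrays]) (auto simp: trails_def)

lemma arrays_total: "f \<in> arrays V n \<Longrightarrow> (\<Sum>v\<in>V. length (f v)) = n"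
  by (simp add: arrays_def)

lemma arrays_lists: "f \<in> arrays V n \<Longrightarrow> f v \<in> lists (if v \<in> V then letters V v else {})"
  by (simp add: arrays_def)

lemma arrays_outside: "f \<in> arrays V n \<Longrightarrow> v \<notin> V \<Longrightarrow> f v = []"
  using arrays_lists[of f V n v] by simp

lemma arrays_letters: "f \<in> arrays V n \<Longrightarrow> v \<in> V \<Longrightarrow> l \<in> set (f v) \<Longrightarrow> l \<in> letters V v"
  using arrays_lists[of f V n v] by auto

lemma balanced_arrays: "f \<in> balanced V n \<Longrightarrow> f \<in> arrays V n"
  by (simp add: balanced_def)

lemma balanced_length: "f \<in> balanced V n \<Longrightarrow> u \<in> V \<Longrightarrow> length (f u) = inflow V f u"
  by (simp add: balanced_def)

lemma trails_closed: "trails V v v n = balanced V n"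
  by (auto simp: trails_def balanced_def)

lemma sum_fun_upd_point:
  fixes F :: "'b \<Rightarrow> nat"
  assumes "finite V" "v \<in> V"
  shows "(\<Sum>u\<in>V. F ((f(v := y)) u)) + F (f v) = (\<Sum>u\<in>V. F (f u)) + F y"
proof -
  have "(\<Sum>u\<in>V. F ((f(v := y)) u)) = F y + (\<Sum>u\<in>V - {v}. F (f u))"
    using assms by (simp add: sum.remove[of V v])
  moreover have "(\<Sum>u\<in>V. F (f u)) = F (f v) + (\<Sum>u\<in>V - {v}. F (f u))"
    using assms by (simp add: sum.remove[of V v])
  ultimately show ?thesis by simp
qed

lemma inflow_push:
  assumes "finite V" "v \<in> V"
  shows "inflow V (f(v := l # f v)) u = inflow V f u + of_bool (fst l = u)"
  using sum_fun_upd_point[OF assms, of "\<lambda>y. length (filter (\<lambda>l. fst l = u) y)" f "l # f v"]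
  unfolding inflow_def by (auto split: if_splits)

lemma total_push:
  assumes "finite V" "v \<in> V"
  shows "(\<Sum>u\<in>V. length ((f(v := l # f v)) u)) = Suc (\<Sum>u\<in>V. length (f u))"
  using sum_fun_upd_point[OF assms, of length f "l # f v"] by simp

lemma array_wt_push:
  assumes "finite V" "v \<in> V"
  shows "array_wt x t V (f(v := l # f v)) = x v * letter_wt t l * array_wt x t V f"
  using assms by (simp add: array_wt_def prod.remove[of V v] mult_ac)

lemma push_in_arrays_iff:
  assumes "finite V" "v \<in> V"
  shows "f(v := l # f v) \<in> arrays V (Suc n) \<longleftrightarrow> l \<in> letters V v \<and> f \<in> arrays V n"
  using assms by (auto simp: arrays_def total_push simp del: fun_upd_apply)
    (auto simp: fun_upd_apply split: if_splits)

lemma push_in_trails_iff: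
  assumes "finite V" "v \<in> V"
  shows "f(v := l # f v) \<in> trails V e v (Suc n) \<longleftrightarrow> l \<in> letters V v \<and> f \<in> trails V e (fst l) n"
proof -
  have "(length ((f(v := l # f v)) u) + of_bool (u = e)
          = inflow V (f(v := l # f v)) u + of_bool (u = v)) \<longleftrightarrow>
        (length (f u) + of_bool (u = e) = inflow V f u + of_bool (u = fst l))" for u
    by (auto simp: inflow_push[OF assms])
  then show ?thesis
    unfolding trails_def mem_Collect_eq push_in_arrays_iff[OF assms] by blast
qed

text \<open>The walk can only stop at a vertex with an empty row, and by the balance equations that vertex is its
end point \<open>e\<close>. All arcs at \<open>e\<close> have been consumed then, so \<open>e\<close> does not occur in what remains.\<close>

lemma trails_stuck:
  assumes "finite V" "v \<in> V"
  shows "{f \<in> trails V e v n. f v = []} = (if v = e then balanced (V - {v}) n else {})"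
proof (cases "v = e")
  case False
  then have "length (f v) \<noteq> 0" if "f \<in> trails V e v n" for f
    using that assms by (force simp: trails_def)
  with False show ?thesis by auto
next
  case True
  have rem: "(\<Sum>u\<in>V. F (f u)) = (\<Sum>u\<in>V - {v}. F (f u))" if "f v = []" "F [] = 0"
    for f :: array and F :: "_ \<Rightarrow> nat"
    using that assms by (simp add: sum.remove[of V v])
  have inf: "inflow V f u = inflow (V - {v}) f u" if "f v = []" for f u
    unfolding inflow_def
    by (rule rem[where F = "\<lambda>y. length (filter (\<lambda>l. fst l = u) y)"]) (use that in auto)
  have A: "f \<in> balanced (V - {v}) n" if f: "f \<in> balanced V n" "f v = []" for f
  proof -
    from f assms have "inflow V f v = 0" by (auto simp: balanced_def)
    \<comment> \<open>Row \<open>v\<close> is empty, so by balance no arc leads to \<open>v\<close>.\<close>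
    then have nov: "fst l \<noteq> v" if "u \<in> V" "l \<in> set (f u)" for u l
      using that assms by (auto simp: inflow_def filter_empty_conv)
    have "f u \<in> lists (if u \<in> V - {v} then letters (V - {v}) u else {})" for u
    proof (cases "u \<in> V - {v}")
      case True
      then have "f u \<in> lists (letters V u)" using f by (auto simp: balanced_def arrays_def dest!: spec[of _ u])
      then show ?thesis using True nov[of u] by (auto simp: letters_def)
    next
      case False
      then show ?thesis using f(2) f(1)
        by (cases "u = v") (auto simp: balanced_def arrays_def dest!: spec[of _ u] split: if_splits)
    qed
    moreover have "(\<Sum>u\<in>V - {v}. length (f u)) = n"
    proof -
      have "(\<Sum>u\<in>V. length (f u)) = n" using f(1) by (intro arrays_total balanced_arrays)
      with rem[of f length, OF f(2)] show ?thesis by simp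
    qed
    moreover have "\<forall>u\<in>V - {v}. length (f u) = inflow (V - {v}) f u"
      using f(1) inf[of f] f(2) unfolding balanced_def by simp
    ultimately show ?thesis unfolding balanced_def arrays_def by blast
  qed
  have B: "f \<in> balanced V n \<and> f v = []" if f: "f \<in> balanced (V - {v}) n" for f
  proof -
    have fv: "f v = []" using arrays_outside[OF balanced_arrays[OF f]] by simp
    have "f u \<in> lists (if u \<in> V - {v} then letters (V - {v}) u else {})" for u
      using f by (auto simp: balanced_def arrays_def)
    moreover have "letters (V - {v}) u \<subseteq> letters V u" for u by (auto simp: letters_def)
    ultimately have mem: "f u \<in> lists (if u \<in> V then letters V u else {})" for u
      using fv assms(2) by (fastforce split: if_splits)
    have "fst l \<noteq> v" if "u \<in> V" "l \<in> set (f u)" for u l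
    proof -
      have "u \<noteq> v" using that fv by auto
      moreover have "f u \<in> lists (if u \<in> V - {v} then letters (V - {v}) u else {})"
        using f by (auto simp: balanced_def arrays_def)
      ultimately show ?thesis using that by (auto simp: letters_def)
    qed
    then have "inflow V f v = 0" using fv by (auto simp: inflow_def filter_empty_conv)
    moreover have "length (f u) = inflow V f u" if "u \<in> V - {v}" for u
      using balanced_length[OF f that] inf[of f u, OF fv] by simp
    ultimately have "\<forall>u\<in>V. length (f u) = inflow V f u"
      using fv by (metis DiffI empty_iff insert_iff list.size(3))
    moreover have "(\<Sum>u\<in>V. length (f u)) = n"
      using rem[of f length, OF fv] arrays_total[OF balanced_arrays[OF f]] by simp
    ultimately show ?thesis using mem fv by (simp only: balanced_def arrays_def mem_Collect_eq) blast
  qed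
  show ?thesis using True A B by (auto simp: trails_closed)
qed

text \<open>Taking the first letter \<open>l\<close> off row \<open>v\<close> moves the starting point of the trail from \<open>v\<close> to \<open>fst l\<close>. Since
letters are taken off the front, putting one back determines the array, and no choice is involved.\<close>

lemma sum_trails_Suc:
  assumes "finite V" "v \<in> V"
  shows "(\<Sum>f\<in>trails V e v (Suc n). array_wt x t V f) =
     (\<Sum>l\<in>letters V v. x v * letter_wt t l * (\<Sum>f\<in>trails V e (fst l) n. array_wt x t V f)) +
     (\<Sum>f | f \<in> trails V e v (Suc n) \<and> f v = []. array_wt x t V f)"
proof -
  let ?push = "\<lambda>l f. f(v := l # f v)"
  let ?P = "{f \<in> trails V e v (Suc n). f v \<noteq> []}"
  have P: "?P = (\<lambda>(l, f). ?push l f) ` (SIGMA l:letters V v. trails V e (fst l) n)"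
  proof (intro equalityI subsetI)
    fix f assume f: "f \<in> ?P"
    let ?g = "f(v := tl (f v))"
    have g: "f = ?push (hd (f v)) ?g" using f by (auto simp: fun_eq_iff)
    then have "hd (f v) \<in> letters V v \<and> ?g \<in> trails V e (fst (hd (f v))) n"
      using f push_in_trails_iff[OF assms, of ?g "hd (f v)" e n] by simp
    then show "f \<in> (\<lambda>(l, f). ?push l f) ` (SIGMA l:letters V v. trails V e (fst l) n)"
      using g by (intro image_eqI[of _ _ "(hd (f v), ?g)"]) auto
  next
    fix f assume "f \<in> (\<lambda>(l, f). ?push l f) ` (SIGMA l:letters V v. trails V e (fst l) n)"
    then show "f \<in> ?P" using push_in_trails_iff[OF assms] by (auto simp del: fun_upd_apply) (simp)
  qed
  have inj: "inj_on (\<lambda>(l, f). ?push l f) (SIGMA l:letters V v. trails V e (fst l) n)"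
  proof (rule inj_onI, unfold case_prod_unfold)
    fix p p' :: "(nat \<times> bool) \<times> array"
    assume eq: "(snd p)(v := fst p # snd p v) = (snd p')(v := fst p' # snd p' v)"
    have "snd p u = snd p' u" for u using fun_cong[OF eq, of u] by (auto split: if_splits)
    with fun_cong[OF eq, of v] show "p = p'" by (auto intro: prod_eqI)
  qed
  have "(\<Sum>f\<in>trails V e v (Suc n). array_wt x t V f) =
      (\<Sum>f\<in>?P. array_wt x t V f) + (\<Sum>f | f \<in> trails V e v (Suc n) \<and> f v = []. array_wt x t V f)"
    using finite_trails[OF assms(1)]
    by (subst sum.union_disjoint[symmetric]) (auto intro!: sum.cong)
  also have "(\<Sum>f\<in>?P. array_wt x t V f) =
     (\<Sum>l\<in>letters V v. x v * letter_wt t l * (\<Sum>f\<in>trails V e (fst l) n. array_wt x t V f))"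
    unfolding P sum.reindex[OF inj] sum_distrib_left
    by (subst sum.Sigma)
      (simp_all add: case_prod_unfold array_wt_push[OF assms]
        finite_letters[OF assms(1)] finite_trails[OF assms(1)])
  finally show ?thesis .
qed

definition balanced_gf :: "(nat \<Rightarrow> 'a::comm_ring_1) \<Rightarrow> 'a \<Rightarrow> nat set \<Rightarrow> 'a fps" where
  "balanced_gf x t V = Abs_fps (\<lambda>n. \<Sum>f\<in>balanced V n. array_wt x t V f)"

definition trail_gf :: "(nat \<Rightarrow> 'a::comm_ring_1) \<Rightarrow> 'a \<Rightarrow> nat set \<Rightarrow> nat \<Rightarrow> nat \<Rightarrow> 'a fps" where
  "trail_gf x t V e v = Abs_fps (\<lambda>n. \<Sum>f\<in>trails V e v n. array_wt x t V f)"

lemma trails_0: "v \<in> V \<Longrightarrow> finite V \<Longrightarrow> f \<in> trails V e v 0 \<Longrightarrow> f v = []"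
  by (simp add: trails_def arrays_def)

lemma array_wt_remove:
  "finite V \<Longrightarrow> v \<in> V \<Longrightarrow> f v = [] \<Longrightarrow> array_wt x t V f = array_wt x t (V - {v}) f"
  by (simp add: array_wt_def prod.remove[of V v])

text \<open>This linear system replaces the determinant in MacMahon's master theorem: for fixed \<open>e\<close> it has one
equation for each starting point \<open>v\<close>, and the case \<open>v = e\<close> brings in the balanced arrays on the smaller
vertex set.\<close>

lemma trail_gf_step:
  assumes "finite V" "v \<in> V"
  shows "trail_gf x t V e v =
    fps_X * fps_const (x v) * (\<Sum>l\<in>letters V v. fps_const (letter_wt t l) * trail_gf x t V e (fst l)) +
    (if v = e then balanced_gf x t (V - {v}) else 0)"
proof (rule fps_ext)
  fix n
  have stuck: "(\<Sum>f | f \<in> trails V e v n \<and> f v = []. array_wt x t V f) =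
      fps_nth (if v = e then balanced_gf x t (V - {v}) else 0) n" for n
  proof -
    have "(\<Sum>f | f \<in> trails V e v n \<and> f v = []. array_wt x t V f) =
        (\<Sum>f | f \<in> trails V e v n \<and> f v = []. array_wt x t (V - {v}) f)"
      by (intro sum.cong refl array_wt_remove[OF assms]) simp
    then show ?thesis by (simp only: trails_stuck[OF assms]) (simp add: balanced_gf_def)
  qed
  show "fps_nth (trail_gf x t V e v) n = fps_nth (fps_X * fps_const (x v) *
     (\<Sum>l\<in>letters V v. fps_const (letter_wt t l) * trail_gf x t V e (fst l)) +
     (if v = e then balanced_gf x t (V - {v}) else 0)) n"
  proof (cases n)
    case 0
    have "(\<Sum>f\<in>trails V e v 0. array_wt x t V f) =
        (\<Sum>f | f \<in> trails V e v 0 \<and> f v = []. array_wt x t V f)"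
      using trails_0[OF assms(2,1)] by (intro sum.cong) blast+
    then show ?thesis using stuck[of 0] 0 by (simp add: trail_gf_def)
  next
    case (Suc m)
    then show ?thesis
      using sum_trails_Suc[OF assms, of x t e m] stuck[of n]
      by (simp add: trail_gf_def mult.assoc sum_distrib_left fps_sum_nth)
  qed
qed

text \<open>The coefficients of the system depend only on whether \<open>u\<close> is below or above \<open>v\<close>, which is what makes
it solvable by partial sums.\<close>

lemma sum_letters:
  assumes "finite V" "v \<in> V"
  shows "(\<Sum>l\<in>letters V v. fps_const (letter_wt t l) * g (fst l)) =
     fps_const t * (\<Sum>u | u \<in> V \<and> u \<le> v. g u) + (\<Sum>u | u \<in> V \<and> v \<le> u. g u)"
proof -
  have "letters V v = (\<lambda>u. (u, False)) ` {u. u \<in> V \<and> u \<le> v} \<union> (\<lambda>u. (u, True)) ` {u. u \<in> V \<and> v \<le> u}"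
    by (auto simp: letters_def image_iff)
  then show ?thesis
    using assms by (simp add: sum.union_disjoint image_iff disjoint_iff sum.reindex inj_on_def
        letter_wt_def sum_distrib_left)
qed

section \<open>The generating function of balanced arrays\<close>

definition complete_hom :: "(nat \<Rightarrow> 'a::comm_ring_1) \<Rightarrow> nat set \<Rightarrow> nat \<Rightarrow> 'a" where
  "complete_hom x V k = (\<Sum>N | size N = k \<and> set_mset N \<subseteq> V. \<Prod>v\<in>#N. x v)"

lemma finite_msets_of_size:
  assumes "finite V"
  shows "finite {N. size N = k \<and> set_mset N \<subseteq> V}"
proof (rule finite_subset)
  show "{N. size N = k \<and> set_mset N \<subseteq> V} \<subseteq> mset ` {l. set l \<subseteq> V \<and> length l = k}"
  proof
    fix N assume "N \<in> {N. size N = k \<and> set_mset N \<subseteq> V}"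
    moreover obtain l where "mset l = N" using ex_mset by blast
    ultimately show "N \<in> mset ` {l. set l \<subseteq> V \<and> length l = k}" by auto
  qed
qed (use assms in \<open>simp add: finite_lists_length_eq\<close>)

lemma complete_hom_0: "complete_hom x V 0 = 1"
proof -
  have "{N :: nat multiset. size N = 0 \<and> set_mset N \<subseteq> V} = {{#}}" by auto
  then show ?thesis by (simp add: complete_hom_def)
qed

lemma complete_hom_empty: "complete_hom x {} (Suc k) = 0"
proof -
  have "{N :: nat multiset. size N = Suc k \<and> set_mset N \<subseteq> {}} = {}" by auto
  then show ?thesis unfolding complete_hom_def by (simp only: sum.empty)
qed

lemma complete_hom_insert:
  assumes "finite V" "v \<notin> V"
  shows "complete_hom x (insert v V) (Suc k) =
    complete_hom x V (Suc k) + x v * complete_hom x (insert v V) k"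
proof -
  let ?A = "\<lambda>V k. {N. size N = k \<and> set_mset N \<subseteq> V}"
  have eq: "?A (insert v V) (Suc k) = ?A V (Suc k) \<union> add_mset v ` ?A (insert v V) k" (is "?l = ?r")
  proof (intro equalityI subsetI)
    fix N assume N: "N \<in> ?l"
    show "N \<in> ?r"
    proof (cases "v \<in># N")
      case True
      then have "N = add_mset v (N - {#v#})" by simp
      moreover have "N - {#v#} \<in> ?A (insert v V) k"
        using N True by (auto simp: size_Diff_singleton dest: in_diffD)
      ultimately show ?thesis by blast
    qed (use N in auto)
  qed auto
  have "(\<Sum>N\<in>?A (insert v V) (Suc k). \<Prod>v\<in>#N. x v) = (\<Sum>N\<in>?A V (Suc k). \<Prod>v\<in>#N. x v) +
      (\<Sum>N\<in>add_mset v ` ?A (insert v V) k. \<Prod>v\<in>#N. x v)"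
    unfolding eq using assms
    by (intro sum.union_disjoint finite_imageI finite_msets_of_size) auto
  also have "(\<Sum>N\<in>add_mset v ` ?A (insert v V) k. \<Prod>v\<in>#N. x v) =
      x v * (\<Sum>N\<in>?A (insert v V) k. \<Prod>v\<in>#N. x v)"
    by (subst sum.reindex) (auto simp: inj_on_def sum_distrib_left)
  finally show ?thesis unfolding complete_hom_def .
qed

lemma complete_hom_scale: "complete_hom (\<lambda>v. t * x v) V k = t ^ k * complete_hom x V k"
  unfolding complete_hom_def sum_distrib_left
  by (intro sum.cong refl) (auto simp: prod_mset.distrib)

definition hom_gf :: "(nat \<Rightarrow> 'a::comm_ring_1) \<Rightarrow> nat set \<Rightarrow> 'a fps" where
  "hom_gf x V = Abs_fps (complete_hom x V)"

text \<open>The \<open>t\<close>-analogue \<open>1 + t + \<dots> + t ^ (a - 1)\<close> of the number \<open>a\<close>.\<close>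

definition qint :: "'a::comm_ring_1 \<Rightarrow> nat \<Rightarrow> 'a" where
  "qint t a = (\<Sum>i<a. t ^ i)"

lemma qint_0 [simp]: "qint t 0 = 0"
  by (simp add: qint_def)

lemma qint_Suc: "qint t (Suc a) = 1 + t * qint t a"
  unfolding qint_def sum.lessThan_Suc_shift by (simp add: sum_distrib_left)

definition weighted_hom_gf :: "(nat \<Rightarrow> 'a::comm_ring_1) \<Rightarrow> 'a \<Rightarrow> nat set \<Rightarrow> 'a fps" where
  "weighted_hom_gf x t V = Abs_fps (\<lambda>a. qint t a * complete_hom x V a)"

abbreviation lin :: "'a::comm_ring_1 \<Rightarrow> 'a fps" where
  "lin c \<equiv> 1 - fps_const c * fps_X"

lemma lin_nth: "fps_nth (a * lin c) n = fps_nth a n - (case n of 0 \<Rightarrow> 0 | Suc m \<Rightarrow> c * fps_nth a m)"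
proof -
  have "a * lin c = a - fps_const c * (fps_X * a)" by (simp add: algebra_simps)
  then show ?thesis by (simp split: nat.split)
qed

text \<open>The constant coefficient of \<open>lin c\<close> is \<open>1\<close>, so it can be cancelled over every commutative ring.\<close>

lemma lin_cancel:
  assumes "a * lin c = b * lin c"
  shows "a = b"
proof (rule fps_ext)
  fix n show "fps_nth a n = fps_nth b n"
  proof (induction n)
    case (Suc n)
    then show ?case using arg_cong[OF assms, of "\<lambda>f. fps_nth f (Suc n)"] by (simp add: lin_nth)
  qed (use arg_cong[OF assms, of "\<lambda>f. fps_nth f 0"] in \<open>simp add: lin_nth\<close>)
qed

text \<open>The factorization \<open>H(z) = \<Prod>\<^sub>v 1 / (1 - x\<^sub>v z)\<close>, one factor at a time.\<close>

lemma hom_gf_insert: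
  "finite V \<Longrightarrow> v \<notin> V \<Longrightarrow> hom_gf x (insert v V) * lin (x v) = hom_gf x V"
  by (rule fps_ext) (simp add: lin_nth hom_gf_def complete_hom_0 complete_hom_insert split: nat.split)

lemma weighted_hom_gf_insert:
  assumes "finite V" "v \<notin> V"
  shows "weighted_hom_gf x t (insert v V) * lin (t * x v) =
    weighted_hom_gf x t V + fps_const (x v) * fps_X * hom_gf x (insert v V)"
proof (rule fps_ext)
  fix n
  show "fps_nth (weighted_hom_gf x t (insert v V) * lin (t * x v)) n =
    fps_nth (weighted_hom_gf x t V + fps_const (x v) * fps_X * hom_gf x (insert v V)) n"
    by (cases n) (simp_all add: lin_nth weighted_hom_gf_def hom_gf_def complete_hom_insert[OF assms]
        qint_Suc algebra_simps mult.assoc[of "fps_const (x v)"])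
qed

lemma hom_gf_empty: "hom_gf x {} = 1"
proof (rule fps_ext)
  fix n show "fps_nth (hom_gf x {}) n = fps_nth 1 n"
    by (cases n) (simp_all add: hom_gf_def complete_hom_0 complete_hom_empty)
qed

lemma hom_gf_cancel:
  assumes "finite V" "a * hom_gf x V = b * hom_gf x V"
  shows "a = b"
  using assms
proof (induction V rule: finite_induct)
  case empty
  then show ?case by (simp add: hom_gf_empty)
next
  case (insert v V)
  have "a * hom_gf x V = (a * hom_gf x (insert v V)) * lin (x v)"
    using hom_gf_insert[OF insert(1,2), of x] by (simp add: mult.assoc)
  also have "\<dots> = b * hom_gf x V"
    using hom_gf_insert[OF insert(1,2), of x] insert.prems by (simp add: mult.assoc)
  finally show ?case by (rule insert.IH)
qed

text \<open>The difference of consecutive partial sums is one unknown of the system, so the equation for that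
unknown becomes a first-order recurrence for the partial sums.\<close>

lemma trail_gf_interval:
  fixes M :: nat and x :: "nat \<Rightarrow> 'a::comm_ring_1" and t :: 'a
  defines "Tr \<equiv> trail_gf x t {1..M} M"
  assumes "Suc v \<le> M"
  shows "(\<Sum>u\<in>{1..Suc v}. Tr u) * lin (t * x (Suc v)) =
    (\<Sum>u\<in>{1..v}. Tr u) * lin (x (Suc v)) + fps_const (x (Suc v)) * fps_X * (\<Sum>u\<in>{1..M}. Tr u) +
    (if Suc v = M then balanced_gf x t {1..v} else 0)"
proof -
  let ?P = "\<lambda>v. \<Sum>u\<in>{1..v}. Tr u"
  have ge: "(\<Sum>u | u \<in> {1..M} \<and> Suc v \<le> u. Tr u) = ?P M - ?P v"
  proof -
    have "{1..M} = {1..v} \<union> {u. u \<in> {1..M} \<and> Suc v \<le> u}" using assms by auto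
    then have "?P M = ?P v + (\<Sum>u | u \<in> {1..M} \<and> Suc v \<le> u. Tr u)"
      by (metis (no_types, lifting) sum.union_disjoint finite_atLeastAtMost finite_Un
          disjoint_iff mem_Collect_eq atLeastAtMost_iff not_less_eq_eq)
    then show ?thesis by simp
  qed
  have le: "{u. u \<in> {1..M} \<and> u \<le> Suc v} = {1..Suc v}" using assms by auto
  have "Tr (Suc v) = fps_X * fps_const (x (Suc v)) * (fps_const t * ?P (Suc v) + (?P M - ?P v)) +
    (if Suc v = M then balanced_gf x t ({1..M} - {Suc v}) else 0)"
  proof -
    have v: "Suc v \<in> {1..M}" using assms by simp
    show ?thesis
      using trail_gf_step[OF finite_atLeastAtMost v, of x t M]
      unfolding sum_letters[OF finite_atLeastAtMost v] le ge[unfolded Tr_def] Tr_def .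
  qed
  moreover have "{1..M} - {Suc v} = {1..v}" if "Suc v = M" using that by auto
  moreover have "?P (Suc v) = ?P v + Tr (Suc v)" by simp
  ultimately show ?thesis
    by (simp add: algebra_simps flip: fps_const_mult)
qed

lemma gf_empty:
  "weighted_hom_gf x t {} = 0" "balanced_gf x t {} = 1"
proof -
  show "weighted_hom_gf x t {} = 0"
  proof (rule fps_ext)
    fix n show "fps_nth (weighted_hom_gf x t {}) n = fps_nth 0 n"
      by (cases n) (simp_all add: weighted_hom_gf_def qint_def complete_hom_empty)
  qed
  have "balanced {} n = (if n = 0 then {\<lambda>_. []} else {})" for n
    by (auto simp: balanced_def arrays_def)
  then show "balanced_gf x t {} = 1"
    by (intro fps_ext) (simp add: balanced_gf_def array_wt_def)
qed

lemma trail_gf_closed: "trail_gf x t V v v = balanced_gf x t V"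
  by (simp add: trail_gf_def balanced_gf_def trails_closed)

text \<open>The recurrence of the partial sums is the one that \<open>weighted_hom_gf_insert\<close> and \<open>hom_gf_insert\<close>
provide for the quotient of \<open>weighted_hom_gf\<close> by \<open>hom_gf\<close>, multiplied by the full sum.\<close>

lemma trail_prefix:
  fixes M :: nat and x :: "nat \<Rightarrow> 'a::comm_ring_1" and t :: 'a
  defines "Tr \<equiv> trail_gf x t {1..M} M"
  assumes "v < M"
  shows "hom_gf x {1..v} * (\<Sum>u\<in>{1..v}. Tr u) = weighted_hom_gf x t {1..v} * (\<Sum>u\<in>{1..M}. Tr u)"
  using assms(2)
proof (induction v)
  case 0
  then show ?case by (simp add: gf_empty hom_gf_empty)
next
  case (Suc v)
  let ?c = "x (Suc v)" and ?S = "\<Sum>u\<in>{1..M}. Tr u"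
  have ins: "{1..Suc v} = insert (Suc v) {1..v}" by auto
  have H: "hom_gf x {1..Suc v} * lin ?c = hom_gf x {1..v}"
    unfolding ins by (rule hom_gf_insert) auto
  have T: "weighted_hom_gf x t {1..Suc v} * lin (t * ?c) =
      weighted_hom_gf x t {1..v} + fps_const ?c * fps_X * hom_gf x {1..Suc v}"
    unfolding ins by (rule weighted_hom_gf_insert) auto
  have P: "(\<Sum>u\<in>{1..Suc v}. Tr u) * lin (t * ?c) =
      (\<Sum>u\<in>{1..v}. Tr u) * lin ?c + fps_const ?c * fps_X * ?S"
    unfolding Tr_def using Suc.prems by (subst trail_gf_interval) auto
  have "hom_gf x {1..Suc v} * (\<Sum>u\<in>{1..Suc v}. Tr u) * lin (t * ?c) =
      hom_gf x {1..Suc v} * lin ?c * (\<Sum>u\<in>{1..v}. Tr u) + fps_const ?c * fps_X * hom_gf x {1..Suc v} * ?S"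
    unfolding mult.assoc P by (simp add: ring_distribs mult_ac)
  also have "\<dots> = (weighted_hom_gf x t {1..v} + fps_const ?c * fps_X * hom_gf x {1..Suc v}) * ?S"
    unfolding H using Suc by (simp add: ring_distribs)
  also have "\<dots> = weighted_hom_gf x t {1..Suc v} * ?S * lin (t * ?c)"
    unfolding T[symmetric] by (simp only: mult_ac)
  finally show ?case by (rule lin_cancel)
qed

text \<open>Induction on the number of vertices. The system with end point \<open>M + 1\<close> expresses the balanced arrays
on \<open>M + 1\<close> vertices (the trails from \<open>M + 1\<close> to itself) through those on \<open>M\<close> vertices; the full sum of
the unknowns serves as an intermediary and is cancelled.\<close>

lemma balanced_gf_eq:
  "(hom_gf x {1..M} - weighted_hom_gf x t {1..M}) * balanced_gf x t {1..M} =
    hom_gf x {1..M} * hom_gf (\<lambda>v. t * x v) {1..M}"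
proof (induction M)
  case 0
  then show ?case by (simp add: gf_empty hom_gf_empty)
next
  case (Suc M)
  let ?c = "x (Suc M)" and ?Tr = "trail_gf x t {1..Suc M} (Suc M)"
  let ?S = "\<Sum>u\<in>{1..Suc M}. ?Tr u"
  let ?H = "hom_gf x {1..M}" and ?H' = "hom_gf x {1..Suc M}"
  let ?K = "hom_gf (\<lambda>v. t * x v) {1..M}" and ?K' = "hom_gf (\<lambda>v. t * x v) {1..Suc M}"
  let ?T = "weighted_hom_gf x t {1..M}" and ?T' = "weighted_hom_gf x t {1..Suc M}"
  let ?W = "balanced_gf x t {1..M}" and ?W' = "balanced_gf x t {1..Suc M}"
  have ins: "{1..Suc M} = insert (Suc M) {1..M}" by auto
  have H: "?H' * lin ?c = ?H"
    unfolding ins by (rule hom_gf_insert) auto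
  have K: "?K' * lin (t * ?c) = ?K"
    unfolding ins by (rule hom_gf_insert) auto
  have T: "?T' * lin (t * ?c) = ?T + fps_const ?c * fps_X * ?H'"
    unfolding ins by (rule weighted_hom_gf_insert) auto
  have P: "?S * lin (t * ?c) =
      (\<Sum>u\<in>{1..M}. ?Tr u) * lin ?c + fps_const ?c * fps_X * ?S + ?W"
    by (subst trail_gf_interval) auto
  have HP: "?H * (\<Sum>u\<in>{1..M}. ?Tr u) = ?T * ?S" by (rule trail_prefix) simp
  have S: "?S = (\<Sum>u\<in>{1..M}. ?Tr u) + ?W'" by (simp add: trail_gf_closed)
  \<comment> \<open>\<open>?W'\<close> is the last unknown of the system, the difference between the full sum and the sum of the
    others.\<close>
  have HW: "?H * ?W' = (?H - ?T) * ?S"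
    unfolding left_diff_distrib HP[symmetric] by (subst S) (simp add: ring_distribs)
  have "?H' * (?S * lin (t * ?c)) =
      ?H' * lin ?c * (\<Sum>u\<in>{1..M}. ?Tr u) + fps_const ?c * fps_X * ?H' * ?S + ?H' * ?W"
    unfolding P by (simp only: ring_distribs mult_ac)
  also have "\<dots> = (?T + fps_const ?c * fps_X * ?H') * ?S + ?H' * ?W"
    unfolding H HP by (simp only: ring_distribs)
  also have "\<dots> = ?T' * (?S * lin (t * ?c)) + ?H' * ?W"
    unfolding T[symmetric] by (simp only: mult_ac)
  finally have Q: "(?H' - ?T') * (?S * lin (t * ?c)) = ?H' * ?W"
    by (simp only: left_diff_distrib) simp
  have "((?H' - ?T') * ?W') * lin (t * ?c) * ?H = (?H' - ?T') * lin (t * ?c) * (?H * ?W')"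
    by (simp only: mult_ac)
  also have "\<dots> = (?H - ?T) * ((?H' - ?T') * (?S * lin (t * ?c)))"
    unfolding HW by (simp only: mult_ac)
  also have "\<dots> = ?H' * ((?H - ?T) * ?W)"
    unfolding Q by (simp only: mult_ac)
  also have "\<dots> = (?H' * ?K') * lin (t * ?c) * ?H"
    unfolding Suc.IH K[symmetric] by (simp only: mult_ac)
  finally have "((?H' - ?T') * ?W') * lin (t * ?c) = (?H' * ?K') * lin (t * ?c)"
    by (rule hom_gf_cancel[rotated]) simp
  then show ?case by (rule lin_cancel)
qed

section \<open>Removing loops at the ends of rows\<close>

definition trailing :: "'b \<Rightarrow> 'b list \<Rightarrow> nat" where
  "trailing a l = length (takeWhile (\<lambda>z. z = a) (rev l))"

definition strip :: "'b \<Rightarrow> 'b list \<Rightarrow> 'b list" where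
  "strip a l = rev (dropWhile (\<lambda>z. z = a) (rev l))"

abbreviation end_loops :: "nat \<Rightarrow> array \<Rightarrow> nat" where
  "end_loops M f \<equiv> (\<Sum>v\<in>{0..M}. trailing (v, True) (f v))"

lemma strip_append: "strip a l @ replicate (trailing a l) a = l"
proof -
  have "takeWhile (\<lambda>z. z = a) (rev l) = replicate (trailing a l) a"
    unfolding trailing_def by (rule replicate_length_same[symmetric]) (auto dest: set_takeWhileD)
  then have "rev (takeWhile (\<lambda>z. z = a) (rev l) @ dropWhile (\<lambda>z. z = a) (rev l)) =
      strip a l @ replicate (trailing a l) a"
    by (simp add: strip_def)
  then show ?thesis by simp
qed

lemma last_strip: "strip a l \<noteq> [] \<Longrightarrow> last (strip a l) \<noteq> a"
  using hd_dropWhile[of "\<lambda>z. z = a" "rev l"] by (simp add: strip_def last_rev)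

lemma strip_eq_Nil: "set l \<subseteq> {a} \<Longrightarrow> strip a l = []"
  by (auto simp: strip_def)

lemma trailing_replicate:
  assumes "d \<noteq> [] \<Longrightarrow> last d \<noteq> a"
  shows "trailing a (d @ replicate k a) = k" "strip a (d @ replicate k a) = d"
proof -
  have "takeWhile (\<lambda>z. z = a) (rev d) = [] \<and> dropWhile (\<lambda>z. z = a) (rev d) = rev d"
    using assms by (cases d rule: rev_cases) auto
  then show "trailing a (d @ replicate k a) = k" "strip a (d @ replicate k a) = d"
    by (simp_all add: trailing_def strip_def takeWhile_append dropWhile_append)
qed

definition pad :: "bool \<Rightarrow> nat multiset \<Rightarrow> array \<Rightarrow> nat \<Rightarrow> (nat \<times> bool) list" where
  "pad c N d = (\<lambda>v. d v @ replicate (count N v) (v, c))"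

lemma sum_count:
  "finite V \<Longrightarrow> set_mset N \<subseteq> V \<Longrightarrow> (\<Sum>v\<in>V. count N v) = size N"
  unfolding size_multiset_overloaded_eq
  by (rule sum.mono_neutral_right) (auto simp: not_in_iff)

lemma inflow_pad:
  assumes "finite V" "set_mset N \<subseteq> V"
  shows "inflow V (pad c N d) u = inflow V d u + count N u"
proof -
  have "inflow V (pad c N d) u = (\<Sum>v\<in>V. length (filter (\<lambda>l. fst l = u) (d v)) +
      (if v = u then count N v else 0))"
    unfolding inflow_def pad_def by (intro sum.cong) auto
  also have "\<dots> = inflow V d u + (if u \<in> V then count N u else 0)"
    using assms(1) by (simp add: sum.distrib inflow_def)
  finally show ?thesis using assms(2) by (auto simp: not_in_iff subset_iff)
qed

lemma inflow_mono_neutral: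
  assumes "finite V'" "V \<subseteq> V'" "\<And>v. v \<in> V' - V \<Longrightarrow> d v = []"
  shows "inflow V' d u = inflow V d u"
  unfolding inflow_def by (rule sum.mono_neutral_right) (use assms in auto)

text \<open>The letters of an array on \<open>V\<close> are themselves elements of \<open>V\<close>.\<close>

lemma inflow_eq_0:
  assumes "finite V" "d \<in> arrays V n" "u \<notin> V"
  shows "inflow V d u = 0"
  using arrays_letters[OF assms(2)] assms(1,3)
  by (auto simp: inflow_def filter_empty_conv letters_def)

lemma array_wt_pad:
  assumes "finite V'" "V \<subseteq> V'" "set_mset N \<subseteq> V'" "\<And>v. v \<notin> V \<Longrightarrow> d v = []"
  shows "array_wt x t V' (pad c N d) =
    (if c then 1 else t) ^ size N * (\<Prod>v\<in>#N. x v) * array_wt x t V d"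
proof -
  let ?\<tau> = "if c then 1 else t"
  have "array_wt x t V' (pad c N d) = (\<Prod>v\<in>V'. (\<Prod>l\<leftarrow>d v. x v * letter_wt t l) * (x v * ?\<tau>) ^ count N v)"
    unfolding array_wt_def pad_def by (intro prod.cong) (auto simp: letter_wt_def)
  also have "\<dots> = array_wt x t V' d * (\<Prod>v\<in>V'. (x v * ?\<tau>) ^ count N v)"
    by (simp add: prod.distrib array_wt_def)
  also have "array_wt x t V' d = array_wt x t V d"
    unfolding array_wt_def by (rule prod.mono_neutral_right) (use assms in auto)
  also have "(\<Prod>v\<in>V'. (x v * ?\<tau>) ^ count N v) = (\<Prod>v\<in>#N. x v * ?\<tau>)"
    unfolding image_prod_mset_multiplicity
    by (rule prod.mono_neutral_right) (use assms in \<open>auto simp: not_in_iff\<close>)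
  also have "\<dots> = ?\<tau> ^ size N * (\<Prod>v\<in>#N. x v)"
    by (simp add: prod_mset.distrib)
  finally show ?thesis by (simp only: mult_ac)
qed

text \<open>A loop adds one to both sides of the balance equation of its vertex, so removing the maximal run of
loops with bar \<open>c\<close> at the end of each row keeps the array balanced. On the extra vertices in \<open>V' - V\<close>
only such loops are allowed, and these vertices disappear altogether. The predicate \<open>Q\<close> transports
a condition on the beginnings of rows, which appended loops do not affect.\<close>

lemma pad_bij:
  fixes c :: bool and Q :: "nat \<Rightarrow> (nat \<times> bool) list \<Rightarrow> bool"
  assumes fin: "finite V'" and sub: "V \<subseteq> V'" and k: "k \<le> n"
    and Q0: "\<And>v. Q v []" and Qs: "\<And>v l. Q v (l @ [(v, c)]) \<longleftrightarrow> Q v l"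
  shows "bij_betw (\<lambda>(N, d). pad c N d)
    ({N. size N = k \<and> set_mset N \<subseteq> V'} \<times>
      {d \<in> balanced V (n - k). \<forall>v\<in>V. Q v (d v) \<and> (d v \<noteq> [] \<longrightarrow> last (d v) \<noteq> (v, c))})
    {f \<in> balanced V' n. (\<forall>v\<in>V'. Q v (f v)) \<and> (\<forall>v\<in>V' - V. set (f v) \<subseteq> {(v, c)}) \<and>
      (\<Sum>v\<in>V'. trailing (v, c) (f v)) = k}"
    (is "bij_betw ?\<phi> (?N \<times> ?D) ?F")
proof (rule bij_betw_byWitness)
  let ?\<psi> = "\<lambda>f. (\<Sum>v\<in>V'. replicate_mset (trailing (v, c) (f v)) v, \<lambda>v. strip (v, c) (f v))"
  have Qr: "Q v (l @ replicate m (v, c)) \<longleftrightarrow> Q v l" for v l m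
  proof (induction m)
    case (Suc m)
    then show ?case using Qs[of v "l @ replicate m (v, c)"] by (simp add: replicate_append_same)
  qed simp
  have countN: "count (\<Sum>v\<in>V'. replicate_mset (g v) v) u = (if u \<in> V' then g u else 0)" for g u
    using fin by (simp add: count_sum)
  have D: "d v = []" if "d \<in> ?D" "v \<notin> V" for d v
    using that by (auto intro: arrays_outside balanced_arrays)
  have lastD: "d v \<noteq> [] \<Longrightarrow> last (d v) \<noteq> (v, c)" if "d \<in> ?D" for d v
    using that D[OF that] by (cases "v \<in> V") auto
  have outside: "f v = []" if "f \<in> ?F" "v \<notin> V'" for f v
    using that by (auto intro: arrays_outside balanced_arrays)
  have padstrip: "?\<phi> (?\<psi> f) = f" if "f \<in> ?F" for f
  proof
    fix v
    show "?\<phi> (?\<psi> f) v = f v"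
      using strip_append[of "(v, c)" "f v"] outside[OF that, of v]
      by (cases "v \<in> V'") (simp_all add: pad_def countN strip_eq_Nil)
  qed
  show "\<forall>p\<in>?N \<times> ?D. ?\<psi> (?\<phi> p) = p"
  proof
    fix p assume "p \<in> ?N \<times> ?D"
    then obtain N d where p: "p = (N, d)" and N: "N \<in> ?N" and d: "d \<in> ?D" by blast
    have tr: "trailing (v, c) (pad c N d v) = count N v" "strip (v, c) (pad c N d v) = d v" for v
      unfolding pad_def using trailing_replicate[OF lastD[OF d, of v]] by auto
    have "(\<Sum>v\<in>V'. replicate_mset (count N v) v) = N"
      using N by (intro multiset_eqI) (auto simp: countN not_in_iff subset_iff)
    then show "?\<psi> (?\<phi> p) = p" by (simp add: p tr)
  qed
  show "\<forall>f\<in>?F. ?\<phi> (?\<psi> f) = f" using padstrip by blast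
  show "?\<phi> ` (?N \<times> ?D) \<subseteq> ?F"
  proof
    fix f assume "f \<in> ?\<phi> ` (?N \<times> ?D)"
    then obtain N d where f: "f = pad c N d" and N: "N \<in> ?N" and d: "d \<in> ?D" by auto
    have dbal: "d \<in> balanced V (n - k)" using d by simp
    have tr: "trailing (v, c) (f v) = count N v" for v
      unfolding f pad_def using trailing_replicate[OF lastD[OF d, of v]] by auto
    have len: "length (f v) = length (d v) + count N v" for v by (simp add: f pad_def)
    have infl: "inflow V' d u = inflow V d u" for u
      by (rule inflow_mono_neutral[OF fin sub]) (use D[OF d] in auto)
    have "f v \<in> lists (if v \<in> V' then letters V' v else {})" for v
    proof (cases "v \<in> V'")
      case True
      have "set (d v) \<subseteq> letters V' v"
        using arrays_letters[OF balanced_arrays[OF dbal], of v] D[OF d, of v] sub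
        by (cases "v \<in> V") (auto simp: letters_def)
      moreover have "(v, c) \<in> letters V' v" using True by (simp add: letters_def)
      ultimately show ?thesis using True by (auto simp: f pad_def)
    next
      case False
      then show ?thesis using D[OF d, of v] N sub by (auto simp: f pad_def not_in_iff subset_iff)
    qed
    moreover have "(\<Sum>v\<in>V'. length (f v)) = n"
    proof -
      have "(\<Sum>v\<in>V'. length (d v)) = (\<Sum>v\<in>V. length (d v))"
        by (rule sum.mono_neutral_right[OF fin sub]) (use D[OF d] in auto)
      then show ?thesis
        using N k arrays_total[OF balanced_arrays[OF dbal]] sum_count[OF fin, of N]
        by (simp add: len sum.distrib)
    qed
    moreover have "length (f u) = inflow V' f u" if "u \<in> V'" for u
    proof -
      have "length (d u) = inflow V d u"
        using balanced_length[OF dbal] D[OF d] inflow_eq_0[OF finite_subset[OF sub fin] balanced_arrays[OF dbal]]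
        by (cases "u \<in> V") auto
      moreover have "inflow V' f u = inflow V d u + count N u"
        using N by (simp add: f inflow_pad[OF fin] infl)
      ultimately show ?thesis by (simp only: len)
    qed
    ultimately have "f \<in> balanced V' n" by (simp only: balanced_def arrays_def mem_Collect_eq) blast
    moreover have "(\<Sum>v\<in>V'. trailing (v, c) (f v)) = k"
      using N sum_count[OF fin, of N] by (simp add: tr)
    moreover have "Q v (f v)" for v
      using d D[OF d, of v] Q0 by (cases "v \<in> V") (auto simp: f pad_def Qr Qr[of _ "[]", simplified])
    moreover have "set (f v) \<subseteq> {(v, c)}" if "v \<notin> V" for v
      using D[OF d that] by (auto simp: f pad_def)
    ultimately show "f \<in> ?F" by blast
  qed
  show "?\<psi> ` ?F \<subseteq> ?N \<times> ?D"
  proof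
    fix p assume "p \<in> ?\<psi> ` ?F"
    then obtain f where p: "p = ?\<psi> f" and f: "f \<in> ?F" by blast
    define N d where "N = fst p" and "d = snd p"
    have d_eq: "d v = strip (v, c) (f v)" for v by (simp add: d_def p)
    have "count N u = (if u \<in> V' then trailing (u, c) (f u) else 0)" for u
      unfolding N_def p by (simp add: countN)
    then have cN: "count N u = trailing (u, c) (f u)" if "u \<in> V'" for u using that by simp
    have "set_mset N \<subseteq> V'"
      using \<open>\<And>u. count N u = _\<close> by (auto simp flip: count_greater_zero_iff split: if_splits)
    then have N: "N \<in> ?N" "set_mset N \<subseteq> V'"
      using f sum_count[OF fin, of N] by (auto simp: cN)
    have fpad: "f = pad c N d" using padstrip[OF f] unfolding N_def d_def p by simp
    have fbal: "f \<in> balanced V' n" using f by simp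
    have len: "length (f v) = length (d v) + count N v" for v by (simp add: fpad pad_def)
    have dV: "d v = []" if "v \<notin> V" for v
      using f that outside[OF f, of v] by (cases "v \<in> V'") (auto simp: d_eq intro!: strip_eq_Nil)
    have infl: "inflow V' d u = inflow V d u" for u
      by (rule inflow_mono_neutral[OF fin sub]) (use dV in auto)
    have bal: "length (d u) = inflow V d u" if "u \<in> V'" for u
    proof -
      have "inflow V' f u = inflow V d u + count N u"
        using N by (simp add: fpad inflow_pad[OF fin] infl)
      then show ?thesis using balanced_length[OF fbal that] by (simp add: len)
    qed
    \<comment> \<open>After the loops have been removed, the rows of the extra vertices are empty; by balance these
      vertices no longer occur as letters.\<close>
    have "l \<in> letters V v" if v: "v \<in> V" and l: "l \<in> set (d v)" for v l
    proof -
      have "l \<in> letters V' v"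
        using arrays_letters[OF balanced_arrays[OF fbal], of v l] v l sub by (auto simp: fpad pad_def)
      moreover have "inflow V d (fst l) \<noteq> 0"
        using v l finite_subset[OF sub fin] by (auto simp: inflow_def filter_empty_conv)
      then have "fst l \<in> V" using bal[of "fst l"] dV[of "fst l"] \<open>l \<in> letters V' v\<close>
        by (cases "fst l \<in> V") (auto simp: letters_def)
      ultimately show ?thesis by (simp add: letters_def)
    qed
    then have "d v \<in> lists (if v \<in> V then letters V v else {})" for v using dV[of v] by auto
    moreover have "(\<Sum>v\<in>V. length (d v)) = n - k"
    proof -
      have "(\<Sum>v\<in>V'. length (d v)) = (\<Sum>v\<in>V. length (d v))"
        by (rule sum.mono_neutral_right[OF fin sub]) (use dV in auto)
      then show ?thesis
        using N arrays_total[OF balanced_arrays[OF fbal]] sum_count[OF fin, of N]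
        by (simp add: len sum.distrib)
    qed
    ultimately have "d \<in> balanced V (n - k)"
      using bal sub by (simp only: balanced_def arrays_def mem_Collect_eq) blast
    moreover have "Q v (d v)" if "v \<in> V" for v
      using f sub that Qr[of v "d v" "count N v"] by (auto simp: fpad pad_def)
    moreover have "d v \<noteq> [] \<Longrightarrow> last (d v) \<noteq> (v, c)" for v
      unfolding d_eq by (rule last_strip)
    ultimately have "d \<in> ?D" by blast
    with N(1) have "(N, d) \<in> ?N \<times> ?D" by (rule SigmaI)
    then show "p \<in> ?N \<times> ?D" by (simp only: N_def d_def prod.collapse)
  qed
qed

lemma sum_pad:
  fixes x :: "nat \<Rightarrow> 'a::comm_ring_1" and Q :: "nat \<Rightarrow> (nat \<times> bool) list \<Rightarrow> bool"
  assumes fin: "finite V'" and sub: "V \<subseteq> V'" and k: "k \<le> n"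
    and Q0: "\<And>v. Q v []" and Qs: "\<And>v l. Q v (l @ [(v, c)]) \<longleftrightarrow> Q v l"
  shows "(\<Sum>f | f \<in> balanced V' n \<and> (\<forall>v\<in>V'. Q v (f v)) \<and>
      (\<forall>v\<in>V' - V. set (f v) \<subseteq> {(v, c)}) \<and> (\<Sum>v\<in>V'. trailing (v, c) (f v)) = k. array_wt x t V' f) =
    (if c then 1 else t) ^ k * complete_hom x V' k *
    (\<Sum>d | d \<in> balanced V (n - k) \<and> (\<forall>v\<in>V. Q v (d v) \<and> (d v \<noteq> [] \<longrightarrow> last (d v) \<noteq> (v, c))).
      array_wt x t V d)"
proof -
  let ?N = "{N. size N = k \<and> set_mset N \<subseteq> V'}"
  let ?D = "{d. d \<in> balanced V (n - k) \<and> (\<forall>v\<in>V. Q v (d v) \<and> (d v \<noteq> [] \<longrightarrow> last (d v) \<noteq> (v, c)))}"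
  have "(\<Sum>(N, d)\<in>?N \<times> ?D. array_wt x t V' (pad c N d)) =
      (\<Sum>(N, d)\<in>?N \<times> ?D. (if c then 1 else t) ^ k * (\<Prod>v\<in>#N. x v) * array_wt x t V d)"
    using arrays_outside[OF balanced_arrays, of _ V]
    by (intro sum.cong) (auto simp: array_wt_pad[OF fin sub])
  also have "\<dots> = (\<Sum>N\<in>?N. (if c then 1 else t) ^ k * (\<Prod>v\<in>#N. x v) * (\<Sum>d\<in>?D. array_wt x t V d))"
    unfolding sum.cartesian_product[symmetric] sum_distrib_left ..
  also have "\<dots> = (if c then 1 else t) ^ k * complete_hom x V' k * (\<Sum>d\<in>?D. array_wt x t V d)"
    unfolding complete_hom_def by (simp add: sum_distrib_left[where r = "_ ^ k"] sum_distrib_right[symmetric])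
  finally show ?thesis
    using sum.reindex_bij_betw[OF pad_bij[OF fin sub k Q0 Qs], of "array_wt x t V'"]
    by (simp add: case_prod_unfold)
qed

lemma sum_by_trailing:
  fixes F :: "array \<Rightarrow> 'a::comm_ring_1"
  assumes "finite V"
  shows "(\<Sum>f | f \<in> balanced V n \<and> P f. F f) =
    (\<Sum>k\<le>n. \<Sum>f | f \<in> balanced V n \<and> P f \<and> (\<Sum>v\<in>V. trailing (v, c) (f v)) = k. F f)"
proof -
  have "(\<Sum>v\<in>V. trailing (v, c) (f v)) \<le> n" if "f \<in> balanced V n" for f
  proof -
    have "trailing (v, c) (f v) \<le> length (f v)" for v
      unfolding trailing_def by (metis length_rev length_takeWhile_le)
    then show ?thesis
      using arrays_total[OF balanced_arrays[OF that]] sum_mono[of V] by (metis (no_types, lifting))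
  qed
  then have "(\<Sum>f | f \<in> balanced V n \<and> P f. F f) =
     (\<Sum>k\<le>n. \<Sum>f | f \<in> {f. f \<in> balanced V n \<and> P f} \<and> (\<Sum>v\<in>V. trailing (v, c) (f v)) = k. F f)"
    by (intro sum.group[symmetric]) (auto simp: finite_balanced[OF assms])
  then show ?thesis by simp
qed

text \<open>The arrays of derangements: a row neither starts with a barred loop nor ends with an unbarred one.\<close>

definition reduced :: "nat set \<Rightarrow> nat \<Rightarrow> array set" where
  "reduced V n = {d. d \<in> balanced V n \<and>
     (\<forall>v\<in>V. (d v \<noteq> [] \<longrightarrow> hd (d v) \<noteq> (v, False)) \<and> (d v \<noteq> [] \<longrightarrow> last (d v) \<noteq> (v, True)))}"

definition reduced_gf :: "(nat \<Rightarrow> 'a::comm_ring_1) \<Rightarrow> 'a \<Rightarrow> nat set \<Rightarrow> 'a fps" where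
  "reduced_gf x t V = Abs_fps (\<lambda>n. \<Sum>d\<in>reduced V n. array_wt x t V d)"

abbreviation reduced_coeff :: "(nat \<Rightarrow> 'a::comm_ring_1) \<Rightarrow> 'a \<Rightarrow> nat \<Rightarrow> nat \<Rightarrow> 'a" where
  "reduced_coeff x t M \<equiv> fps_nth (reduced_gf x t {1..M})"

lemma hd_snoc: "(l @ [a] \<noteq> [] \<longrightarrow> hd (l @ [a]) \<noteq> b) \<longleftrightarrow> (l \<noteq> [] \<longrightarrow> hd l \<noteq> b)" if "a \<noteq> b"
  using that by (cases l) auto

text \<open>For arrays coming from permutations, \<open>k\<close> will be the number of fixed points. The flexibility
\<open>V \<subseteq> V'\<close> is for a vertex whose row may consist of fixed points only.\<close>

lemma sum_fixed_loops:
  assumes "finite V'" "V \<subseteq> V'" "k \<le> n"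
  shows "(\<Sum>f | f \<in> balanced V' n \<and> (\<forall>v\<in>V'. f v \<noteq> [] \<longrightarrow> hd (f v) \<noteq> (v, False)) \<and>
      (\<forall>v\<in>V' - V. set (f v) \<subseteq> {(v, True)}) \<and> (\<Sum>v\<in>V'. trailing (v, True) (f v)) = k. array_wt x t V' f) =
    complete_hom x V' k * fps_nth (reduced_gf x t V) (n - k)"
proof -
  have "(l @ [(v, True)] \<noteq> [] \<longrightarrow> hd (l @ [(v, True)]) \<noteq> (v, False)) \<longleftrightarrow> (l \<noteq> [] \<longrightarrow> hd l \<noteq> (v, False))"
    for v :: nat and l by (rule hd_snoc) simp
  then show ?thesis
    using sum_pad[OF assms, of "\<lambda>v l. l \<noteq> [] \<longrightarrow> hd l \<noteq> (v, False)" True x t]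
    unfolding reduced_gf_def reduced_def fps_nth_Abs_fps by simp
qed

lemma balanced_rev: "f \<in> balanced V n \<Longrightarrow> (\<lambda>v. rev (f v)) \<in> balanced V n"
  unfolding balanced_def arrays_def inflow_def mem_Collect_eq
  by (simp only: length_rev rev_filter[symmetric] lists_eq_set mem_Collect_eq set_rev) blast

text \<open>Initial barred loops are removed by reversing the rows. They carry a factor \<open>t\<close> each, which is why the
first factor is evaluated at \<open>t * x v\<close>.\<close>

lemma balanced_gf_reduced:
  assumes "finite V"
  shows "balanced_gf x t V = hom_gf (\<lambda>v. t * x v) V * (hom_gf x V * reduced_gf x t V)"
proof -
  let ?hd = "\<lambda>f. \<forall>v\<in>V. f v \<noteq> [] \<longrightarrow> hd (f v) \<noteq> (v, False)"
  let ?last = "\<lambda>f. \<forall>v\<in>V. f v \<noteq> [] \<longrightarrow> last (f v) \<noteq> (v, False)"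
  define B where "B = Abs_fps (\<lambda>n. \<Sum>f | f \<in> balanced V n \<and> ?hd f. array_wt x t V f)"
  have rev: "(\<Sum>f | f \<in> balanced V n \<and> ?last f. array_wt x t V f) = fps_nth B n" for n
    unfolding B_def fps_nth_Abs_fps
    by (rule sum.reindex_bij_witness[of _ "\<lambda>f v. rev (f v)" "\<lambda>f v. rev (f v)"])
      (auto simp: balanced_rev hd_rev last_rev array_wt_def rev_map[symmetric] prod_list.rev)
  have "balanced_gf x t V = hom_gf (\<lambda>v. t * x v) V * B"
  proof (rule fps_ext)
    fix n
    have "fps_nth (balanced_gf x t V) n = (\<Sum>k\<le>n. t ^ k * complete_hom x V k * fps_nth B (n - k))"
      using sum_by_trailing[OF assms, where n = n and P = "\<lambda>_. True" and F = "array_wt x t V" and c = False]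
        sum_pad[OF assms order_refl, of _ n "\<lambda>_ _. True" False x t]
      by (simp add: balanced_gf_def rev)
    then show "fps_nth (balanced_gf x t V) n = fps_nth (hom_gf (\<lambda>v. t * x v) V * B) n"
      by (simp add: fps_mult_nth hom_gf_def complete_hom_scale atMost_atLeast0)
  qed
  moreover have "B = hom_gf x V * reduced_gf x t V"
  proof (rule fps_ext)
    fix n
    have "fps_nth B n = (\<Sum>k\<le>n. complete_hom x V k * fps_nth (reduced_gf x t V) (n - k))"
      using sum_by_trailing[OF assms, where n = n and P = ?hd and F = "array_wt x t V" and c = True]
        sum_fixed_loops[OF assms order_refl, of _ n x t]
      by (simp add: B_def)
    then show "fps_nth B n = fps_nth (hom_gf x V * reduced_gf x t V) n"
      by (simp add: fps_mult_nth hom_gf_def atMost_atLeast0)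
  qed
  ultimately show ?thesis by simp
qed

lemma reduced_gf_eq:
  "(hom_gf x {1..M} - weighted_hom_gf x t {1..M}) * reduced_gf x t {1..M} = 1"
proof -
  let ?H = "hom_gf x {1..M}" and ?K = "hom_gf (\<lambda>v. t * x v) {1..M}"
  let ?\<Delta> = "?H - weighted_hom_gf x t {1..M}" and ?Y = "reduced_gf x t {1..M}"
  have "?\<Delta> * (?K * (?H * ?Y)) = ?H * ?K"
    using balanced_gf_eq[of x M t] unfolding balanced_gf_reduced[OF finite_atLeastAtMost] .
  then have "?\<Delta> * ?Y * ?K * ?H = 1 * ?K * ?H" by (simp only: mult.assoc mult.commute[of ?H] mult_1_left) (simp add: mult_ac)
  then have "?\<Delta> * ?Y * ?K = 1 * ?K" by (rule hom_gf_cancel[rotated]) simp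
  then show ?thesis by (rule hom_gf_cancel[rotated]) simp
qed

section \<open>Permutations with compatible sequences as words\<close>

text \<open>Descents of the barred word. The Boolean component is true for unbarred values, and false is smaller
than true, so barred values come first. Position \<open>0\<close> takes part with \<open>\<sigma> 0 = 0\<close>; it is a descent exactly
when \<open>\<sigma> 1\<close> is barred.\<close>

definition exc_descents :: "nat \<Rightarrow> (nat \<Rightarrow> nat) \<Rightarrow> nat set" where
  "exc_descents n \<sigma> = {i. i < n \<and> (\<sigma> (Suc i) \<le> Suc i, \<sigma> (Suc i)) < (\<sigma> i \<le> i, \<sigma> i)}"

text \<open>The P-partitions of a chain: sequences \<open>b 1 \<le> \<dots> \<le> b n\<close> bounded by \<open>M\<close> that increase strictly at the positions in \<open>S\<close>. Since
\<open>b 0 = 0\<close>, membership of \<open>0\<close> in \<open>S\<close> makes all values positive. The values beyond position \<open>n\<close> are fixed so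
that functions represent sequences uniquely.\<close>

definition pparts :: "nat \<Rightarrow> nat set \<Rightarrow> nat \<Rightarrow> (nat \<Rightarrow> nat) set" where
  "pparts n S M = {b. b 0 = 0 \<and> (\<forall>i<n. b i + of_bool (i \<in> S) \<le> b (Suc i)) \<and> b n \<le> M \<and>
     (\<forall>i>n. b i = 0)}"

lemma pparts_mono:
  assumes "b \<in> pparts n S M" "i \<le> j" "j \<le> n"
  shows "b i \<le> b j"
  using assms(2,3)
proof (induction j rule: dec_induct)
  case (step m)
  then have "b m + of_bool (m \<in> S) \<le> b (Suc m)" using assms(1) by (auto simp: pparts_def)
  with step show ?case by simp
qed simp

lemma pparts_le: "b \<in> pparts n S M \<Longrightarrow> b i \<le> M"
  using pparts_mono[of b n S M i n] by (cases "i \<le> n") (auto simp: pparts_def)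

definition compat_pairs :: "nat \<Rightarrow> nat \<Rightarrow> ((nat \<Rightarrow> nat) \<times> (nat \<Rightarrow> nat)) set" where
  "compat_pairs n M = {(\<sigma>, b). \<sigma> permutes {1..n} \<and> b \<in> pparts n (exc_descents n \<sigma>) M}"

text \<open>Compatibility of \<open>b\<close> with \<open>\<sigma>\<close> amounts to a single lexicographic condition, which is why \<open>\<sigma>\<close> can be
recovered by sorting.\<close>

lemma compat_key_less:
  assumes \<sigma>: "\<sigma> permutes {1..n}" and b: "b \<in> pparts n (exc_descents n \<sigma>) M"
    and "i < j" "j \<le> n"
  shows "(b i, \<sigma> i \<le> i, \<sigma> i) < (b j, \<sigma> j \<le> j, \<sigma> j)"
  using assms(3,4)
proof (induction j rule: less_Suc_induct)
  case (1 i)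
  have "\<sigma> i \<noteq> \<sigma> (Suc i)" using permutes_inj[OF \<sigma>] by (simp add: inj_eq)
  moreover have "b i + of_bool (i \<in> exc_descents n \<sigma>) \<le> b (Suc i)"
    using b 1 by (simp add: pparts_def)
  ultimately show ?case using 1
    by (cases "i \<in> exc_descents n \<sigma>") (auto simp: exc_descents_def less_prod_def)
next
  case (2 i j k)
  then have "(b i, \<sigma> i \<le> i, \<sigma> i) < (b j, \<sigma> j \<le> j, \<sigma> j)" by simp
  also have "\<dots> < (b k, \<sigma> k \<le> k, \<sigma> k)" using 2 by simp
  finally show ?case .
qed

text \<open>The words \<open>F\<close> that arise as labels of permutations, together with \<open>b\<close>, which is the sorted sequence of
the underlying letters of \<open>F\<close> (the last condition). The bar of a letter other than \<open>b i\<close> is forced; the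
letter \<open>b i\<close> may be barred only if position \<open>i\<close> does not begin a block of equal values of \<open>b\<close>; the
block of the value \<open>0\<close> consists of unbarred letters \<open>0\<close>.\<close>

definition sorted_words :: "nat \<Rightarrow> nat \<Rightarrow> ((nat \<Rightarrow> nat \<times> bool) \<times> (nat \<Rightarrow> nat)) set" where
  "sorted_words n M = {(F, b). b \<in> pparts n {} M \<and> (\<forall>i. i \<notin> {1..n} \<longrightarrow> F i = (0, True)) \<and>
     (\<forall>i\<in>{1..n}. (fst (F i) < b i \<longrightarrow> \<not> snd (F i)) \<and> (b i < fst (F i) \<longrightarrow> snd (F i)) \<and>
        (F i = (b i, False) \<longrightarrow> b (i - 1) = b i) \<and> (b i = 0 \<longrightarrow> F i = (0, True))) \<and>
     (\<forall>v. card {i\<in>{1..n}. b i = v} = card {i\<in>{1..n}. fst (F i) = v})}"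

text \<open>The letter at position \<open>i = \<sigma> j\<close> records the value \<open>b j\<close> of the source \<open>j\<close> and whether \<open>j\<close> fails to be an
excedance.\<close>

definition label :: "(nat \<Rightarrow> nat) \<Rightarrow> (nat \<Rightarrow> nat) \<Rightarrow> nat \<Rightarrow> nat \<times> bool" where
  "label \<sigma> b i = (b (inv \<sigma> i), i \<le> inv \<sigma> i)"

lemma label_perm: "\<sigma> permutes S \<Longrightarrow> label \<sigma> b (\<sigma> j) = (b j, \<sigma> j \<le> j)"
  by (simp add: label_def permutes_inverses)

lemma pparts_weaken: "b \<in> pparts n S M \<Longrightarrow> b \<in> pparts n {} M"
  by (fastforce simp: pparts_def)

lemma label_sorted_words:
  assumes "(\<sigma>, b) \<in> compat_pairs n M"
  shows "(label \<sigma> b, b) \<in> sorted_words n M"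
proof -
  from assms have \<sigma>: "\<sigma> permutes {1..n}" and b: "b \<in> pparts n (exc_descents n \<sigma>) M"
    by (auto simp: compat_pairs_def)
  note mono = pparts_mono[OF b]
  have inv: "\<sigma> (inv \<sigma> i) = i" for i using permutes_inverses[OF \<sigma>] by simp
  have inv_in: "inv \<sigma> i \<in> {1..n} \<longleftrightarrow> i \<in> {1..n}" for i
    using permutes_in_image[OF permutes_inv[OF \<sigma>]] .
  have "label \<sigma> b i = (0, True)" if "i \<notin> {1..n}" for i
  proof -
    have "inv \<sigma> i = i" using permutes_not_in[OF permutes_inv[OF \<sigma>] that] .
    then show ?thesis using that b by (cases "i = 0") (auto simp: label_def pparts_def)
  qed
  moreover have "(fst (label \<sigma> b i) < b i \<longrightarrow> \<not> snd (label \<sigma> b i)) \<and>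
      (b i < fst (label \<sigma> b i) \<longrightarrow> snd (label \<sigma> b i)) \<and>
      (label \<sigma> b i = (b i, False) \<longrightarrow> b (i - 1) = b i) \<and> (b i = 0 \<longrightarrow> label \<sigma> b i = (0, True))"
    if i: "i \<in> {1..n}" for i
  proof (intro conjI impI)
    let ?j = "inv \<sigma> i"
    have j: "?j \<in> {1..n}" using inv_in i by blast
    show "\<not> snd (label \<sigma> b i)" if "fst (label \<sigma> b i) < b i"
      using that mono[of i ?j] j by (auto simp: label_def)
    show "snd (label \<sigma> b i)" if "b i < fst (label \<sigma> b i)"
    proof -
      have "\<not> ?j \<le> i" using that mono[of ?j i] i by (auto simp: label_def)
      then show ?thesis by (simp add: label_def)
    qed
    show "b (i - 1) = b i" if "label \<sigma> b i = (b i, False)"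
      using that mono[of ?j "i - 1"] mono[of "i - 1" i] i by (auto simp: label_def)
    show "label \<sigma> b i = (0, True)" if "b i = 0"
    proof -
      \<comment> \<open>The key of position \<open>0\<close> has the largest bar, so there are no excedances among the positions with
        value \<open>0\<close>, and \<open>\<sigma>\<close> permutes every initial segment of them.\<close>
      have low: "\<sigma> m \<le> m \<and> b m = 0" if "m \<in> {1..i}" for m
      proof -
        have "b m = 0" using mono[of m i] that i \<open>b i = 0\<close> by simp
        moreover have "(b 0, \<sigma> 0 \<le> 0, \<sigma> 0) < (b m, \<sigma> m \<le> m, \<sigma> m)"
          using that i by (intro compat_key_less[OF \<sigma> b]) auto
        moreover have "\<sigma> 0 = 0" using permutes_not_in[OF \<sigma>, of 0] by simp
        ultimately show ?thesis by (auto simp: less_prod_def)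
      qed
      have "\<sigma> ` {1..i} \<subseteq> {1..i}"
      proof
        fix y assume "y \<in> \<sigma> ` {1..i}"
        then obtain m where m: "m \<in> {1..i}" "y = \<sigma> m" by blast
        then have "y \<in> {1..n}" using permutes_in_image[OF \<sigma>, of m] i by auto
        then show "y \<in> {1..i}" using low[of m] m by auto
      qed
      then have "\<sigma> ` {1..i} = {1..i}"
        using permutes_inj_on[OF \<sigma>, of "{1..i}"] by (intro endo_inj_surj) auto
      then obtain j where "j \<in> {1..i}" "\<sigma> j = i" using i by (metis atLeastAtMost_iff imageE order_refl)
      then show ?thesis using label_perm[OF \<sigma>, of b j] low[of j] by auto
    qed
  qed
  moreover have "card {i \<in> {1..n}. b i = v} = card {i \<in> {1..n}. fst (label \<sigma> b i) = v}" for v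
  proof -
    have "{i \<in> {1..n}. fst (label \<sigma> b i) = v} = \<sigma> ` {i \<in> {1..n}. b i = v}"
    proof (intro equalityI subsetI)
      fix i assume "i \<in> {i \<in> {1..n}. fst (label \<sigma> b i) = v}"
      then show "i \<in> \<sigma> ` {i \<in> {1..n}. b i = v}"
        using inv[of i] inv_in[of i] by (intro image_eqI[of _ _ "inv \<sigma> i"]) (auto simp: label_def)
    next
      fix i assume "i \<in> \<sigma> ` {i \<in> {1..n}. b i = v}"
      then obtain j where j: "j \<in> {1..n}" "b j = v" "i = \<sigma> j" by blast
      have "\<sigma> j \<in> {1..n}" using permutes_in_image[OF \<sigma>, of j] j by blast
      then show "i \<in> {i \<in> {1..n}. fst (label \<sigma> b i) = v}"
        using j label_perm[OF \<sigma>, of b j] by simp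
    qed
    then show ?thesis using permutes_inj_on[OF \<sigma>] by (simp add: card_image)
  qed
  ultimately show ?thesis using pparts_weaken[OF b] by (simp add: sorted_words_def)
qed

lemma ex_sorting_permutation:
  fixes key :: "nat \<Rightarrow> 'k::linorder"
  assumes "inj_on key {1..n}"
  obtains \<sigma> where "\<sigma> permutes {1..n}" "\<And>i j. 1 \<le> i \<Longrightarrow> i < j \<Longrightarrow> j \<le> n \<Longrightarrow> key (\<sigma> i) < key (\<sigma> j)"
proof -
  define l where "l = sort_key key [1..<Suc n]"
  have set: "set l = {1..n}" and len: "length l = n" and dist: "distinct l"
    and sorted: "sorted (map key l)"
    by (auto simp: l_def)
  define \<sigma> where "\<sigma> j = (if j \<in> {1..n} then l ! (j - 1) else j)" for j
  have "bij_betw ((!) l) {..<n} {1..n}"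
    using dist set len by (intro bij_betw_nth) auto
  moreover have "bij_betw (\<lambda>j. j - 1) {1..n} {..<n}"
    by (rule bij_betwI[of _ _ _ Suc]) auto
  ultimately have "bij_betw ((!) l \<circ> (\<lambda>j. j - 1)) {1..n} {1..n}" by (rule bij_betw_trans[rotated])
  then have "bij_betw \<sigma> {1..n} {1..n}"
    by (rule bij_betw_cong[THEN iffD1, rotated]) (simp add: \<sigma>_def)
  then have "\<sigma> permutes {1..n}" by (rule bij_imp_permutes) (auto simp: \<sigma>_def)
  moreover have "key (\<sigma> i) < key (\<sigma> j)" if "1 \<le> i" "i < j" "j \<le> n" for i j
  proof -
    have ij: "i - 1 < j - 1" "j - 1 < length l" using that len by auto
    then have "key (l ! (i - 1)) \<le> key (l ! (j - 1))"
      using sorted by (auto simp: sorted_iff_nth_mono)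
    moreover have "l ! (i - 1) \<noteq> l ! (j - 1)" using ij dist by (simp add: nth_eq_iff_index_eq)
    then have "key (l ! (i - 1)) \<noteq> key (l ! (j - 1))"
      using assms ij set nth_mem[of "i - 1" l] nth_mem[of "j - 1" l] by (auto simp: inj_on_eq_iff)
    ultimately show ?thesis using that by (simp add: \<sigma>_def)
  qed
  ultimately show ?thesis by (rule that)
qed

lemma sorting_permutation_unique:
  fixes key :: "nat \<Rightarrow> 'k::linorder"
  assumes "inj_on key {1..n}"
    and \<sigma>: "\<sigma> permutes {1..n}" "\<And>i j. 1 \<le> i \<Longrightarrow> i < j \<Longrightarrow> j \<le> n \<Longrightarrow> key (\<sigma> i) < key (\<sigma> j)"
    and \<tau>: "\<tau> permutes {1..n}" "\<And>i j. 1 \<le> i \<Longrightarrow> i < j \<Longrightarrow> j \<le> n \<Longrightarrow> key (\<tau> i) < key (\<tau> j)"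
  shows "\<sigma> = \<tau>"
proof -
  have list: "sorted_wrt (<) (map (\<lambda>i. key (\<pi> i)) [1..<Suc n]) \<and>
      set (map (\<lambda>i. key (\<pi> i)) [1..<Suc n]) = key ` {1..n}"
    if "\<pi> permutes {1..n}" "\<And>i j. 1 \<le> i \<Longrightarrow> i < j \<Longrightarrow> j \<le> n \<Longrightarrow> key (\<pi> i) < key (\<pi> j)" for \<pi>
  proof
    show "sorted_wrt (<) (map (\<lambda>i. key (\<pi> i)) [1..<Suc n])"
      using that(2) by (auto simp: sorted_wrt_iff_nth_less nth_append simp del: upt_Suc)
    have "set (map (\<lambda>i. key (\<pi> i)) [1..<Suc n]) = key ` \<pi> ` {1..n}"
      by (auto simp del: upt_Suc)
    then show "set (map (\<lambda>i. key (\<pi> i)) [1..<Suc n]) = key ` {1..n}"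
      by (simp only: permutes_image[OF that(1)])
  qed
  have "map (\<lambda>i. key (\<sigma> i)) [1..<Suc n] = map (\<lambda>i. key (\<tau> i)) [1..<Suc n]"
    using list[OF \<sigma>] list[OF \<tau>]
    by (intro sorted_distinct_set_unique) (auto simp: strict_sorted_iff simp del: upt_Suc)
  then have eq: "key (\<sigma> i) = key (\<tau> i)" if "i \<in> {1..n}" for i
    using that by (auto simp del: upt_Suc)
  show ?thesis
  proof
    fix i show "\<sigma> i = \<tau> i"
      using eq[of i] assms(1) permutes_in_image[OF \<sigma>(1), of i] permutes_in_image[OF \<tau>(1), of i]
        permutes_not_in[OF \<sigma>(1), of i] permutes_not_in[OF \<tau>(1), of i]
      by (cases "i \<in> {1..n}") (auto simp: inj_on_eq_iff)
  qed
qed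

text \<open>The labels together with the positions increase along \<open>\<sigma>\<close>, hence \<open>\<sigma>\<close> is the permutation that sorts the
word \<open>label \<sigma> b\<close> stably.\<close>

lemma label_inj:
  assumes "(\<sigma>, b) \<in> compat_pairs n M" "(\<tau>, b) \<in> compat_pairs n M" "label \<sigma> b = label \<tau> b"
  shows "\<sigma> = \<tau>"
proof (rule sorting_permutation_unique)
  let ?key = "\<lambda>i. (fst (label \<sigma> b i), snd (label \<sigma> b i), i)"
  show "inj_on ?key {1..n}" by (auto simp: inj_on_def)
  from assms have \<sigma>: "\<sigma> permutes {1..n}" "b \<in> pparts n (exc_descents n \<sigma>) M"
    and \<tau>: "\<tau> permutes {1..n}" "b \<in> pparts n (exc_descents n \<tau>) M"
    by (auto simp: compat_pairs_def)
  show "\<sigma> permutes {1..n}" "\<tau> permutes {1..n}" by fact+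
  show "?key (\<sigma> i) < ?key (\<sigma> j)" if "1 \<le> i" "i < j" "j \<le> n" for i j
    using compat_key_less[OF \<sigma> that(2,3)] by (simp add: label_perm[OF \<sigma>(1)])
  show "?key (\<tau> i) < ?key (\<tau> j)" if "1 \<le> i" "i < j" "j \<le> n" for i j
    using compat_key_less[OF \<tau> that(2,3)] unfolding assms(3) by (simp add: label_perm[OF \<tau>(1)])
qed

lemma sorted_words_D:
  assumes "(F, b) \<in> sorted_words n M"
  shows "b \<in> pparts n {} M" "i \<notin> {1..n} \<Longrightarrow> F i = (0, True)"
    "i \<in> {1..n} \<Longrightarrow> fst (F i) < b i \<Longrightarrow> \<not> snd (F i)"
    "i \<in> {1..n} \<Longrightarrow> b i < fst (F i) \<Longrightarrow> snd (F i)"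
    "i \<in> {1..n} \<Longrightarrow> F i = (b i, False) \<Longrightarrow> b (i - 1) = b i"
    "i \<in> {1..n} \<Longrightarrow> b i = 0 \<Longrightarrow> F i = (0, True)"
    "card {i\<in>{1..n}. b i = v} = card {i\<in>{1..n}. fst (F i) = v}"
  using assms by (auto simp: sorted_words_def)

text \<open>The block of the value \<open>0\<close> already uses up all letters \<open>0\<close>.\<close>

lemma sorted_words_letter_0:
  assumes "(F, b) \<in> sorted_words n M" "i \<in> {1..n}" "fst (F i) = 0"
  shows "b i = 0"
proof -
  have "{i\<in>{1..n}. b i = 0} \<subseteq> {i\<in>{1..n}. fst (F i) = 0}"
    using sorted_words_D(6)[OF assms(1)] by auto
  then have "{i\<in>{1..n}. b i = 0} = {i\<in>{1..n}. fst (F i) = 0}"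
    using sorted_words_D(7)[OF assms(1), of 0] by (intro card_subset_eq) auto
  then show ?thesis using assms by blast
qed

lemma sorting_sorts_letters:
  assumes W: "(F, b) \<in> sorted_words n M" and \<sigma>: "\<sigma> permutes {1..n}"
    and key: "\<And>i j. 1 \<le> i \<Longrightarrow> i < j \<Longrightarrow> j \<le> n \<Longrightarrow>
      (fst (F (\<sigma> i)), snd (F (\<sigma> i)), \<sigma> i) < (fst (F (\<sigma> j)), snd (F (\<sigma> j)), \<sigma> j)"
    and j: "j \<in> {1..n}"
  shows "fst (F (\<sigma> j)) = b j"
proof -
  let ?g = "\<lambda>j. fst (F (\<sigma> j))"
  have sorted1: "sorted (map b [1..<Suc n])"
    using pparts_mono[OF sorted_words_D(1)[OF W]]
    by (auto simp: sorted_iff_nth_mono simp del: upt_Suc)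
  have sorted2: "sorted (map ?g [1..<Suc n])"
  proof -
    have "?g i \<le> ?g j" if "1 \<le> i" "i \<le> j" "j \<le> n" for i j
      using key[of i j] that by (cases "i = j") (auto simp: less_prod_def)
    then show ?thesis by (auto simp: sorted_iff_nth_mono simp del: upt_Suc)
  qed
  have "image_mset ?g (mset_set {1..n}) = image_mset (\<lambda>i. fst (F i)) (image_mset \<sigma> (mset_set {1..n}))"
    by (simp add: image_mset.compositionality o_def)
  also have "image_mset \<sigma> (mset_set {1..n}) = mset_set {1..n}"
    using image_mset_mset_set[OF permutes_inj_on[OF \<sigma>]] permutes_image[OF \<sigma>] by simp
  also have "image_mset (\<lambda>i. fst (F i)) (mset_set {1..n}) = image_mset b (mset_set {1..n})"
    by (rule multiset_eqI)
      (simp only: count_image_mset_eq_card_vimage finite_atLeastAtMost sorted_words_D(7)[OF W])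
  finally have "mset (map ?g [1..<Suc n]) = mset (map b [1..<Suc n])"
    by (simp add: mset_upt atLeastLessThanSuc_atLeastAtMost del: upt_Suc)
  then have "map ?g [1..<Suc n] = map b [1..<Suc n]"
    using sorted1 sorted2 by (metis properties_for_sort)
  then show ?thesis using j by (auto simp del: upt_Suc)
qed

text \<open>The stable sorting permutation \<open>\<sigma>\<close> of \<open>F\<close> is the only candidate. What has to be shown is that the bars
of \<open>F\<close> mark the excedances of \<open>\<sigma>\<close>. Inside a block of equal values of \<open>b\<close> the barred letters form an
initial part on which \<open>\<sigma>\<close> increases, so it suffices to look at the first position of the block;
dually, for unbarred letters it suffices to look at the last one.\<close>

lemma sorted_word_is_label:
  assumes W: "(F, b) \<in> sorted_words n M"
  obtains \<sigma> where "(\<sigma>, b) \<in> compat_pairs n M" "label \<sigma> b = F"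
proof -
  let ?key = "\<lambda>i. (fst (F i), snd (F i), i)"
  have "inj_on ?key {1..n}" by (auto simp: inj_on_def)
  then obtain \<sigma> where \<sigma>: "\<sigma> permutes {1..n}"
    and key: "\<And>i j. 1 \<le> i \<Longrightarrow> i < j \<Longrightarrow> j \<le> n \<Longrightarrow> ?key (\<sigma> i) < ?key (\<sigma> j)"
    by (rule ex_sorting_permutation) blast
  note D = sorted_words_D[OF W]
  note mono = pparts_mono[OF D(1)]
  have in_n: "\<sigma> i \<in> {1..n} \<longleftrightarrow> i \<in> {1..n}" for i using permutes_in_image[OF \<sigma>] .
  have fstF: "fst (F (\<sigma> j)) = b j" if "j \<in> {1..n}" for j
    by (rule sorting_sorts_letters[OF W \<sigma> key that])
  have key': "\<not> snd (F (\<sigma> i)) \<and> snd (F (\<sigma> j)) \<or> snd (F (\<sigma> i)) = snd (F (\<sigma> j)) \<and> \<sigma> i < \<sigma> j"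
    if "1 \<le> i" "i < j" "j \<le> n" "b i = b j" for i j
    using key[OF that(1-3)] fstF[of i] fstF[of j] that by (auto simp: less_prod_def)
  have barred: "j < \<sigma> j" if j: "j \<in> {1..n}" "\<not> snd (F (\<sigma> j))" for j
  proof -
    \<comment> \<open>The target \<open>\<sigma> p\<close> of the first position \<open>p\<close> of the block is not in an earlier block, since barred
      letters do not point there, and it is not \<open>p\<close>, since the block does not begin with a barred loop.\<close>
    define p where "p = (LEAST p. p \<in> {1..n} \<and> b p = b j)"
    have p: "p \<in> {1..n}" "b p = b j" "p \<le> j"
      using LeastI[of "\<lambda>p. p \<in> {1..n} \<and> b p = b j" j] Least_le[of "\<lambda>p. p \<in> {1..n} \<and> b p = b j" j] j
      by (auto simp: p_def)
    have least: "b m \<noteq> b j" if "m \<in> {1..n}" "m < p" for m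
      using not_less_Least[of m "\<lambda>p. p \<in> {1..n} \<and> b p = b j"] that by (auto simp: p_def)
    have block: "b m = b j" if "p \<le> m" "m \<le> j" for m
      using mono[of p m] mono[of m j] that p j by auto
    have notsnd: "\<not> snd (F (\<sigma> m))" if "p \<le> m" "m \<le> j" for m
      using key'[of m j] block[OF that] that p j by (cases "m = j") auto
    have Fp: "F (\<sigma> p) = (b j, False)"
      using fstF[of p] p notsnd[of p] by (simp add: prod_eq_iff)
    have sp: "\<sigma> p \<in> {1..n}" using in_n p by blast
    have "b j \<le> b (\<sigma> p)" using D(4)[OF sp] Fp by force
    then have "p \<le> \<sigma> p" using mono[of "\<sigma> p" p] p sp least[of "\<sigma> p"] by (cases "\<sigma> p < p") auto
    moreover have "\<sigma> p \<noteq> p"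
    proof
      assume "\<sigma> p = p"
      then have "b (p - 1) = b j" using D(5)[OF sp] Fp p by simp
      then have "p - 1 \<notin> {1..n}" using least[of "p - 1"] p by auto
      then have "p - 1 = 0" using p by auto
      then have "b p = 0" using \<open>b (p - 1) = b j\<close> D(1) p by (simp add: pparts_def)
      then show False using D(6)[OF p(1)] Fp \<open>\<sigma> p = p\<close> by simp
    qed
    ultimately have "p < \<sigma> p" by simp
    have "m < \<sigma> m" if "p \<le> m" "m \<le> j" for m
      using that
    proof (induction m rule: dec_induct)
      case base
      show ?case by (rule \<open>p < \<sigma> p\<close>)
    next
      case (step m)
      then have "\<sigma> m < \<sigma> (Suc m)"
        using key'[of m "Suc m"] block[of m] block[of "Suc m"] notsnd[of m] notsnd[of "Suc m"] p j by auto
      then show ?case using step by simp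
    qed
    then show ?thesis using p by simp
  qed
  have unbarred: "\<sigma> j \<le> j" if j: "j \<in> {1..n}" "snd (F (\<sigma> j))" for j
  proof -
    \<comment> \<open>The target of the last position \<open>e\<close> of the block is not in a later block, since unbarred letters
      do not point there.\<close>
    define e where "e = (GREATEST e. e \<le> n \<and> b e = b j)"
    have ge: "e \<le> n" "b e = b j" "j \<le> e"
      using GreatestI_nat[of "\<lambda>e. e \<le> n \<and> b e = b j" j n] Greatest_le_nat[of "\<lambda>e. e \<le> n \<and> b e = b j" j n] j
      by (auto simp: e_def)
    have greatest: "b m \<noteq> b j" if "m \<le> n" "e < m" for m
      using Greatest_le_nat[of "\<lambda>e. e \<le> n \<and> b e = b j" m n] that by (auto simp: e_def)
    have block: "b m = b j" if "j \<le> m" "m \<le> e" for m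
      using mono[of j m] mono[of m e] that ge j by auto
    have sndF: "snd (F (\<sigma> m))" if "j \<le> m" "m \<le> e" for m
      using key'[of j m] block[OF that] that ge j by (cases "m = j") auto
    have Fe: "F (\<sigma> e) = (b j, True)"
      using fstF[of e] ge j sndF[of e] by (simp add: prod_eq_iff)
    have se: "\<sigma> e \<in> {1..n}" using in_n[of e] ge j by auto
    have "b (\<sigma> e) \<le> b j" using D(3)[OF se] Fe by force
    then have "\<sigma> e \<le> e" using mono[of e "\<sigma> e"] ge se greatest[of "\<sigma> e"] by (cases "e < \<sigma> e") auto
    have "\<sigma> m \<le> m" if "j \<le> m" "m \<le> e" for m
      using that(2,1)
    proof (induction m rule: inc_induct)
      case base
      show ?case by (rule \<open>\<sigma> e \<le> e\<close>)
    next
      case (step m)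
      then have "\<sigma> m < \<sigma> (Suc m)"
        using key'[of m "Suc m"] block[of m] block[of "Suc m"] sndF[of m] sndF[of "Suc m"] ge j by auto
      then show ?case using step by simp
    qed
    then show ?thesis using ge by simp
  qed
  have fixed: "\<sigma> i = i" if "i \<notin> {1..n}" for i using permutes_not_in[OF \<sigma> that] .
  have F\<sigma>: "F (\<sigma> j) = (b j, \<sigma> j \<le> j)" for j
  proof (cases "j \<in> {1..n}")
    case True
    then have "snd (F (\<sigma> j)) \<longleftrightarrow> \<sigma> j \<le> j"
      using barred[of j] unbarred[of j] by (cases "snd (F (\<sigma> j))") auto
    then show ?thesis using fstF[OF True] by (simp add: prod_eq_iff)
  next
    case False
    then show ?thesis using D(1) D(2)[OF False] fixed[OF False]
      by (cases "j = 0") (auto simp: pparts_def)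
  qed
  have "b i + of_bool (i \<in> exc_descents n \<sigma>) \<le> b (Suc i)" if "i < n" for i
  proof -
    have le: "b i \<le> b (Suc i)" using mono[of i "Suc i"] that by simp
    have "b i \<noteq> b (Suc i)" if S: "i \<in> exc_descents n \<sigma>"
    proof
      assume eq: "b i = b (Suc i)"
      show False
      proof (cases "i = 0")
        case True
        have s1: "\<sigma> (Suc 0) \<in> {1..n}" using in_n[of "Suc 0"] \<open>i < n\<close> by auto
        have "b (Suc 0) = 0" using eq True D(1) by (simp add: pparts_def)
        then have "b (\<sigma> (Suc 0)) = 0"
          using F\<sigma>[of "Suc 0"] by (intro sorted_words_letter_0[OF W s1]) simp
        then have "F (\<sigma> (Suc 0)) = (0, True)" using D(6)[OF s1] by simp
        then have "\<sigma> (Suc 0) \<le> Suc 0" using F\<sigma>[of "Suc 0"] by simp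
        then show False using S True fixed[of 0] by (auto simp: exc_descents_def less_prod_def)
      next
        case False
        then have "(b i, \<sigma> i \<le> i, \<sigma> i) < (b (Suc i), \<sigma> (Suc i) \<le> Suc i, \<sigma> (Suc i))"
          using key[of i "Suc i"] \<open>i < n\<close> by (simp add: F\<sigma>)
        then have "(\<sigma> i \<le> i, \<sigma> i) < (\<sigma> (Suc i) \<le> Suc i, \<sigma> (Suc i))" using eq by (auto simp: less_prod_def)
        then show False using S unfolding exc_descents_def mem_Collect_eq using less_asym by blast
      qed
    qed
    with le show ?thesis by (cases "i \<in> exc_descents n \<sigma>") auto
  qed
  then have "(\<sigma>, b) \<in> compat_pairs n M"
    using \<sigma> D(1) by (simp add: compat_pairs_def pparts_def)
  moreover have "label \<sigma> b = F"
  proof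
    fix i show "label \<sigma> b i = F i"
      using F\<sigma>[of "inv \<sigma> i"] permutes_inverses(1)[OF \<sigma>] by (simp add: label_def)
  qed
  ultimately show ?thesis by (rule that)
qed

lemma label_bij:
  "bij_betw (\<lambda>(\<sigma>, b). (label \<sigma> b, b)) (compat_pairs n M) (sorted_words n M)"
proof (rule bij_betwI')
  fix p p' assume "p \<in> compat_pairs n M" "p' \<in> compat_pairs n M"
  then show "((case p of (\<sigma>, b) \<Rightarrow> (label \<sigma> b, b)) = (case p' of (\<sigma>, b) \<Rightarrow> (label \<sigma> b, b))) = (p = p')"
    using label_inj by (cases p; cases p') auto
next
  fix p assume "p \<in> compat_pairs n M"
  then show "(case p of (\<sigma>, b) \<Rightarrow> (label \<sigma> b, b)) \<in> sorted_words n M"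
    using label_sorted_words by (cases p) auto
next
  fix w assume w: "w \<in> sorted_words n M"
  obtain F b where Fb: "w = (F, b)" by (cases w)
  with w obtain \<sigma> where "(\<sigma>, b) \<in> compat_pairs n M" "label \<sigma> b = F"
    using sorted_word_is_label by blast
  then show "\<exists>p\<in>compat_pairs n M. w = (case p of (\<sigma>, b) \<Rightarrow> (label \<sigma> b, b))"
    using Fb by (intro bexI[of _ "(\<sigma>, b)"]) auto
qed

lemma exc_label:
  assumes \<sigma>: "\<sigma> permutes {1..n}"
  shows "exc n \<sigma> = card {i \<in> {1..n}. \<not> snd (label \<sigma> b i)}"
proof -
  have "{i \<in> {1..<n}. \<sigma> i > i} = {j \<in> {1..n}. j < \<sigma> j}"
    using permutes_in_image[OF \<sigma>, of n] by (auto simp: le_less)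
  moreover have "{i \<in> {1..n}. \<not> snd (label \<sigma> b i)} = \<sigma> ` {j \<in> {1..n}. j < \<sigma> j}"
  proof (intro equalityI subsetI)
    fix i assume "i \<in> {i \<in> {1..n}. \<not> snd (label \<sigma> b i)}"
    then show "i \<in> \<sigma> ` {j \<in> {1..n}. j < \<sigma> j}"
      using permutes_inverses(1)[OF \<sigma>, of i] permutes_in_image[OF permutes_inv[OF \<sigma>], of i]
      by (intro image_eqI[of _ _ "inv \<sigma> i"]) (auto simp: label_def)
  next
    fix i assume "i \<in> \<sigma> ` {j \<in> {1..n}. j < \<sigma> j}"
    then obtain j where j: "j \<in> {1..n}" "j < \<sigma> j" "i = \<sigma> j" by blast
    have "\<sigma> j \<in> {1..n}" using permutes_in_image[OF \<sigma>, of j] j by blast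
    then show "i \<in> {i \<in> {1..n}. \<not> snd (label \<sigma> b i)}"
      using j label_perm[OF \<sigma>, of b j] by simp
  qed
  ultimately show ?thesis unfolding exc_def using permutes_inj_on[OF \<sigma>] by (simp add: card_image)
qed

text \<open>On the unbarred part of a block \<open>\<sigma>\<close> is increasing and satisfies \<open>\<sigma> m \<le> m\<close>. A fixed point therefore
forces all later positions of its block to be fixed, and conversely an uninterrupted run of unbarred
loops up to the end of the block consists of fixed points, by descending induction.\<close>

lemma fixed_iff_label:
  assumes "(\<sigma>, b) \<in> compat_pairs n M" and i: "i \<in> {1..n}"
  shows "\<sigma> i = i \<longleftrightarrow> (\<forall>m\<in>{i..n}. b m = b i \<longrightarrow> label \<sigma> b m = (b i, True))"
proof -
  from assms have \<sigma>: "\<sigma> permutes {1..n}" and b: "b \<in> pparts n (exc_descents n \<sigma>) M"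
    by (auto simp: compat_pairs_def)
  note mono = pparts_mono[OF b]
  show ?thesis
  proof (intro iffI ballI impI)
    fix m assume fix_i: "\<sigma> i = i" and m: "m \<in> {i..n}" "b m = b i"
    have "\<sigma> m = m" if "i \<le> m" "m \<le> n" "b m = b i" for m
      using that
    proof (induction m rule: dec_induct)
      case (step m)
      have "b m = b i" using mono[of i m] mono[of m "Suc m"] step by auto
      then have "\<sigma> m = m" using step by simp
      moreover have "(b m, \<sigma> m \<le> m, \<sigma> m) < (b (Suc m), \<sigma> (Suc m) \<le> Suc m, \<sigma> (Suc m))"
        using step by (intro compat_key_less[OF \<sigma> b]) auto
      ultimately show ?case using step \<open>b m = b i\<close> by (auto simp: less_prod_def)
    qed (use fix_i in simp)
    then have "\<sigma> m = m" using m by simp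
    then show "label \<sigma> b m = (b i, True)"
      using label_perm[OF \<sigma>, of b m] m by simp
  next
    assume lab: "\<forall>m\<in>{i..n}. b m = b i \<longrightarrow> label \<sigma> b m = (b i, True)"
    have "b m = b i \<longrightarrow> \<sigma> m = m" if "i \<le> m" "m \<le> n" for m
      using that
    proof (induction "n - m" arbitrary: m rule: less_induct)
      case less
      show ?case
      proof
        assume bm: "b m = b i"
        let ?j = "inv \<sigma> m"
        have "label \<sigma> b m = (b i, True)" using lab less bm by auto
        then have j: "b ?j = b i" "m \<le> ?j" by (auto simp: label_def)
        have "?j \<in> {1..n}" using permutes_in_image[OF permutes_inv[OF \<sigma>], of m] less i by auto
        have "\<sigma> ?j = m" using permutes_inverses[OF \<sigma>] by simp
        show "\<sigma> m = m"
        proof (cases "?j = m")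
          case False
          then have "\<sigma> ?j = ?j" using less j \<open>?j \<in> {1..n}\<close> by auto
          with \<open>\<sigma> ?j = m\<close> show ?thesis by simp
        qed (use \<open>\<sigma> ?j = m\<close> in simp)
      qed
    qed
    then show "\<sigma> i = i" using i by simp
  qed
qed

section \<open>Words as balanced arrays\<close>

definition rows :: "nat \<Rightarrow> (nat \<Rightarrow> nat \<times> bool) \<Rightarrow> (nat \<Rightarrow> nat) \<Rightarrow> nat \<Rightarrow> (nat \<times> bool) list" where
  "rows n F b v = map F (filter (\<lambda>i. b i = v) [1..<Suc n])"

definition row_arrays :: "nat \<Rightarrow> nat \<Rightarrow> array set" where
  "row_arrays n M = {f. f \<in> balanced {0..M} n \<and>
     (\<forall>v\<in>{0..M}. f v \<noteq> [] \<longrightarrow> hd (f v) \<noteq> (v, False)) \<and> set (f 0) \<subseteq> {(0, True)}}"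

lemma length_filter_rows:
  "length (filter P (rows n F b v)) = card {i \<in> {1..n}. b i = v \<and> P (F i)}"
proof -
  have "length (filter P (rows n F b v)) = card (set (filter (\<lambda>i. b i = v \<and> P (F i)) [1..<Suc n]))"
    by (subst distinct_card) (simp_all add: rows_def filter_map o_def conj_commute del: upt_Suc)
  also have "set (filter (\<lambda>i. b i = v \<and> P (F i)) [1..<Suc n]) = {i \<in> {1..n}. b i = v \<and> P (F i)}"
    by auto
  finally show ?thesis .
qed

lemma length_rows: "length (rows n F b v) = card {i \<in> {1..n}. b i = v}"
  using length_filter_rows[of "\<lambda>_. True" n F b v] by simp

lemma set_rows: "set (rows n F b v) = F ` {i \<in> {1..n}. b i = v}"
  by (auto simp: rows_def image_iff simp del: upt_Suc)

lemma rows_eq_Nil: "(\<And>i. i \<in> {1..n} \<Longrightarrow> b i \<noteq> v) \<Longrightarrow> rows n F b v = []"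
  by (subst set_empty[symmetric], subst set_rows) blast

lemma trailing_rows:
  "trailing a (rows n F b v) = card {i \<in> {1..n}. b i = v \<and> (\<forall>m\<in>{i..n}. b m = v \<longrightarrow> F m = a)}"
proof (induction n)
  case 0
  then show ?case by (simp add: rows_def trailing_def)
next
  case (Suc n)
  let ?T = "\<lambda>n. {i \<in> {1..n}. b i = v \<and> (\<forall>m\<in>{i..n}. b m = v \<longrightarrow> F m = a)}"
  have rows: "rows (Suc n) F b v = rows n F b v @ (if b (Suc n) = v then [F (Suc n)] else [])"
    by (simp add: rows_def)
  have Suc_iff: "i \<in> ?T (Suc n) \<longleftrightarrow>
      (b (Suc n) = v \<longrightarrow> F (Suc n) = a) \<and> (i \<in> ?T n \<or> i = Suc n \<and> b (Suc n) = v)" for i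
    by (auto simp: le_Suc_eq)
  consider "b (Suc n) \<noteq> v" | "b (Suc n) = v" "F (Suc n) = a" | "b (Suc n) = v" "F (Suc n) \<noteq> a" by blast
  then show ?case
  proof cases
    case 1
    then have "?T (Suc n) = ?T n" using Suc_iff by blast
    then show ?thesis using 1 Suc rows by simp
  next
    case 2
    then have "?T (Suc n) = insert (Suc n) (?T n)" using Suc_iff by blast
    moreover have "Suc n \<notin> ?T n" by simp
    ultimately have "card (?T (Suc n)) = Suc (card (?T n))" by simp
    then show ?thesis using 2 Suc rows by (simp add: trailing_def)
  next
    case 3
    then have "?T (Suc n) = {}" using Suc_iff by blast
    then show ?thesis using 3 rows by (simp only: trailing_def) simp
  qed
qed

lemma sum_card_fibres:
  assumes "finite S" "finite T" "g ` S \<subseteq> T"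
  shows "(\<Sum>v\<in>T. card {i \<in> S. g i = v}) = card S"
  using sum.group[OF assms, of "\<lambda>_. 1::nat"] by simp

lemma inflow_rows:
  assumes "\<And>i. b i \<le> M"
  shows "inflow {0..M} (rows n F b) u = card {i \<in> {1..n}. fst (F i) = u}"
proof -
  have "inflow {0..M} (rows n F b) u = (\<Sum>v\<in>{0..M}. card {i \<in> {i \<in> {1..n}. fst (F i) = u}. b i = v})"
    unfolding inflow_def length_filter_rows by (intro sum.cong arg_cong[of _ _ card]) auto
  also have "\<dots> = card {i \<in> {1..n}. fst (F i) = u}"
    using assms by (intro sum_card_fibres) auto
  finally show ?thesis .
qed

lemma sorted_hd_le: "sorted l \<Longrightarrow> m \<in> set l \<Longrightarrow> hd l \<le> m"
  by (cases l) auto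

lemma hd_filter_upt:
  assumes "filter P [1..<Suc n] \<noteq> []"
  shows "hd (filter P [1..<Suc n]) \<in> {1..n}" "P (hd (filter P [1..<Suc n]))"
    "\<And>m. m \<in> {1..n} \<Longrightarrow> P m \<Longrightarrow> hd (filter P [1..<Suc n]) \<le> m"
proof -
  let ?l = "filter P [1..<Suc n]"
  have "hd ?l \<in> set ?l" using assms by (rule hd_in_set)
  then show "hd ?l \<in> {1..n}" "P (hd ?l)" by (auto simp del: upt_Suc)
  fix m assume "m \<in> {1..n}" "P m"
  then have "m \<in> set ?l" by (auto simp del: upt_Suc)
  moreover have "sorted ?l" by (rule sorted_wrt_filter) (rule sorted_upt)
  ultimately show "hd ?l \<le> m" by (metis sorted_hd_le)
qed

lemma hd_rows:
  assumes "rows n F b v \<noteq> []"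
  obtains i where "i \<in> {1..n}" "b i = v" "hd (rows n F b v) = F i"
    "\<And>m. m \<in> {1..n} \<Longrightarrow> b m = v \<Longrightarrow> i \<le> m"
proof -
  have ne: "filter (\<lambda>i. b i = v) [1..<Suc n] \<noteq> []" using assms by (simp add: rows_def del: upt_Suc)
  note h = hd_filter_upt[OF ne]
  moreover have "hd (rows n F b v) = F (hd (filter (\<lambda>i. b i = v) [1..<Suc n]))"
    unfolding rows_def using ne by (rule hd_map)
  ultimately show ?thesis by (intro that)
qed

lemma rows_in_row_arrays:
  assumes W: "(F, b) \<in> sorted_words n M"
  shows "rows n F b \<in> row_arrays n M"
proof -
  note D = sorted_words_D[OF W]
  have bM: "b i \<le> M" for i by (rule pparts_le[OF D(1)])
  have infl: "inflow {0..M} (rows n F b) u = card {i \<in> {1..n}. fst (F i) = u}" for u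
    by (rule inflow_rows[OF bM])
  have bal: "length (rows n F b u) = inflow {0..M} (rows n F b) u" for u
    unfolding infl length_rows by (rule D(7))
  have mem: "rows n F b v \<in> lists (if v \<in> {0..M} then letters {0..M} v else {})" for v
  proof -
    have "F i \<in> letters {0..M} v \<and> v \<in> {0..M}" if i: "i \<in> {1..n}" "b i = v" for i
    proof -
      have "{j \<in> {1..n}. b j = fst (F i)} \<noteq> {}"
      proof -
        have "i \<in> {j \<in> {1..n}. fst (F j) = fst (F i)}" using i by simp
        then have "card {j \<in> {1..n}. fst (F j) = fst (F i)} \<noteq> 0" by (auto simp: card_eq_0_iff)
        then have "card {j \<in> {1..n}. b j = fst (F i)} \<noteq> 0" using D(7)[of "fst (F i)"] by simp
        then show ?thesis by (metis card.empty)
      qed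
      then obtain j where "b j = fst (F i)" by blast
      then have "fst (F i) \<le> M" using bM[of j] by simp
      then show ?thesis using D(3)[of i] D(4)[of i] i bM[of i] by (auto simp: letters_def)
    qed
    then show ?thesis using rows_eq_Nil[of n b v F] set_rows[of n F b v]
      by (cases "v \<in> {0..M}") auto
  qed
  have total: "(\<Sum>v\<in>{0..M}. length (rows n F b v)) = n"
  proof -
    have "b ` {1..n} \<subseteq> {0..M}" using bM by auto
    from sum_card_fibres[OF _ _ this] show ?thesis unfolding length_rows by simp
  qed
  have hd: "hd (rows n F b v) \<noteq> (v, False)" if ne: "rows n F b v \<noteq> []" for v
  proof
    assume eq: "hd (rows n F b v) = (v, False)"
    obtain i where i: "i \<in> {1..n}" "b i = v" "hd (rows n F b v) = F i"
      "\<And>m. m \<in> {1..n} \<Longrightarrow> b m = v \<Longrightarrow> i \<le> m"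
      using hd_rows[OF ne] by blast
    then have Fi: "F i = (v, False)" using eq by simp
    then have bi: "b (i - 1) = v" using D(5)[OF i(1)] i(2) by simp
    then have "i - 1 \<notin> {1..n}" using i(4)[of "i - 1"] i(1) by auto
    then have "i - 1 = 0" using i(1) by auto
    then have "v = 0" using bi D(1) by (simp add: pparts_def)
    then show False using D(6)[OF i(1)] i(2) Fi by simp
  qed
  have zero: "set (rows n F b 0) \<subseteq> {(0, True)}"
    using D(6) by (auto simp: set_rows)
  have "rows n F b \<in> balanced {0..M} n"
    unfolding balanced_def arrays_def using bal mem total by blast
  then show ?thesis unfolding row_arrays_def using hd zero by blast
qed

text \<open>The inverse of \<open>rows\<close>: the letters in the order of their positions, each with its row.\<close>

definition row_list :: "nat \<Rightarrow> array \<Rightarrow> ((nat \<times> bool) \<times> nat) list" where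
  "row_list M f = concat (map (\<lambda>v. map (\<lambda>l. (l, v)) (f v)) [0..<Suc M])"

lemma filter_row_list:
  assumes "\<And>v. v > M \<Longrightarrow> f v = []"
  shows "filter (\<lambda>p. snd p = v) (row_list M f) = map (\<lambda>l. (l, v)) (f v)"
proof -
  have "filter (\<lambda>p. snd p = v) (concat (map (\<lambda>v. map (\<lambda>l. (l, v)) (f v)) [0..<m])) =
      (if v < m then map (\<lambda>l. (l, v)) (f v) else [])" for m
    by (induction m) (auto simp: filter_empty_conv filter_id_conv less_Suc_eq)
  from this[of "Suc M"] show ?thesis
    using assms[of v] by (auto simp: row_list_def simp del: upt_Suc)
qed

lemma sorted_row_list: "sorted (map snd (row_list M f))"
proof -
  have "sorted (map snd (concat (map (\<lambda>v. map (\<lambda>l. (l, v)) (f v)) [0..<m])))" for m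
    by (induction m) (auto simp: sorted_append o_def map_replicate_const)
  then show ?thesis by (simp only: row_list_def)
qed

text \<open>Both lists are stable sortings of each other.\<close>

lemma sorted_by_snd_unique:
  fixes xs ys :: "('a \<times> nat) list"
  assumes "sorted (map snd xs)" "sorted (map snd ys)"
    and eq: "\<And>v. filter (\<lambda>p. snd p = v) xs = filter (\<lambda>p. snd p = v) ys"
  shows "xs = ys"
proof -
  have "count (mset zs) p = count (mset (filter (\<lambda>q. snd q = snd p) zs)) p" for zs :: "('a \<times> nat) list" and p
    by (induction zs) auto
  then have "mset xs = mset ys" using eq by (metis multiset_eqI)
  moreover have "(\<lambda>p::'a \<times> nat. snd p = v) = (\<lambda>p. v = snd p)" for v by auto
  then have eq': "filter (\<lambda>p. v = snd p) xs = filter (\<lambda>p. v = snd p) ys" for v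
    using eq[of v] by (simp only:)
  ultimately have "sort_key snd ys = xs"
    using assms(1) by (intro properties_for_sort_key) (simp_all only: eq')
  moreover have "sort_key snd ys = ys"
    using assms(2) by (intro properties_for_sort_key) simp_all
  ultimately show ?thesis by simp
qed

lemma row_list_rows:
  assumes W: "(F, b) \<in> sorted_words n M"
  shows "row_list M (rows n F b) = map (\<lambda>i. (F i, b i)) [1..<Suc n]"
proof (rule sorted_by_snd_unique)
  note b = sorted_words_D(1)[OF W]
  show "sorted (map snd (row_list M (rows n F b)))" by (rule sorted_row_list)
  show "sorted (map snd (map (\<lambda>i. (F i, b i)) [1..<Suc n]))"
    using pparts_mono[OF b] by (auto simp: sorted_iff_nth_mono simp del: upt_Suc)
  fix v
  have "rows n F b u = []" if "u > M" for u
    using pparts_le[OF b] that by (intro rows_eq_Nil) (auto simp: not_le[symmetric])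
  then show "filter (\<lambda>p. snd p = v) (row_list M (rows n F b)) =
      filter (\<lambda>p. snd p = v) (map (\<lambda>i. (F i, b i)) [1..<Suc n])"
    by (subst filter_row_list) (auto simp: rows_def filter_map o_def simp del: upt_Suc)
qed

lemma row_array_is_rows:
  assumes f: "f \<in> row_arrays n M"
  obtains F b where "(F, b) \<in> sorted_words n M" "rows n F b = f"
proof -
  have bal: "f \<in> balanced {0..M} n" and hd: "\<And>v. f v \<noteq> [] \<Longrightarrow> v \<le> M \<Longrightarrow> hd (f v) \<noteq> (v, False)"
    and zero: "set (f 0) \<subseteq> {(0, True)}"
    using f by (auto simp: row_arrays_def)
  have out: "f v = []" if "v > M" for v
    using arrays_outside[OF balanced_arrays[OF bal]] that by simp
  define pl where "pl = row_list M f"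
  have len: "length pl = n"
    using arrays_total[OF balanced_arrays[OF bal]]
    by (simp add: pl_def row_list_def length_concat o_def interv_sum_list_conv_sum_set_nat
        atLeastLessThanSuc_atLeastAtMost del: upt_Suc)
  define F where "F i = (if i \<in> {1..n} then fst (pl ! (i - 1)) else (0, True))" for i
  define b where "b i = (if i \<in> {1..n} then snd (pl ! (i - 1)) else 0)" for i
  have pl: "map (\<lambda>i. (F i, b i)) [1..<Suc n] = pl"
    by (rule nth_equalityI) (simp_all add: len F_def b_def del: upt_Suc)
  have rows: "rows n F b v = f v" for v
  proof -
    have "map (\<lambda>l. (l, v)) (rows n F b v) = filter (\<lambda>p. snd p = v) pl"
      unfolding pl[symmetric] rows_def by (simp add: filter_map o_def del: upt_Suc)
    also have "\<dots> = map (\<lambda>l. (l, v)) (f v)" unfolding pl_def by (rule filter_row_list[OF out])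
    finally show ?thesis by (simp add: inj_map_eq_map inj_on_def)
  qed
  have Fb: "F i \<in> set (f (b i))" if "i \<in> {1..n}" for i
    unfolding rows[symmetric] using that by (auto simp: rows_def simp del: upt_Suc)
  have sorted: "sorted (map snd pl)" unfolding pl_def by (rule sorted_row_list)
  have mono: "b i \<le> b (Suc i)" if "i < n" for i
    using that sorted len by (auto simp: b_def sorted_iff_nth_mono)
  have bM: "b i \<le> M" for i
    using Fb[of i] out[of "b i"] by (cases "i \<in> {1..n}") (force simp: b_def)+
  have "b 0 = 0" "\<And>i. n < i \<Longrightarrow> b i = 0" by (simp_all add: b_def)
  then have pp: "b \<in> pparts n {} M" using mono bM by (simp add: pparts_def)
  have "F i = (b i, False) \<longrightarrow> b (i - 1) = b i" if i: "i \<in> {1..n}" for i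
  proof
    assume Fi: "F i = (b i, False)"
    have "rows n F b (b i) \<noteq> []" using Fb[OF i] by (auto simp: rows)
    then obtain h where h: "h \<in> {1..n}" "b h = b i" "hd (rows n F b (b i)) = F h"
      "\<And>m. m \<in> {1..n} \<Longrightarrow> b m = b i \<Longrightarrow> h \<le> m"
      using hd_rows by blast
    have "F h \<noteq> (b i, False)" using h(3) hd[of "b i"] Fb[OF i] bM[of i] by (force simp: rows)
    then have "h \<noteq> i" using Fi by auto
    then have "h \<le> i - 1" using h(4)[of i] i by auto
    then have "b i \<le> b (i - 1)" using pparts_mono[OF pp, of h "i - 1"] h(2) i by auto
    moreover have "b (i - 1) \<le> b i" using pparts_mono[OF pp, of "i - 1" i] i by auto
    ultimately show "b (i - 1) = b i" by simp
  qed
  moreover have "F i \<in> letters {0..M} (b i)" if "i \<in> {1..n}" for i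
    using arrays_letters[OF balanced_arrays[OF bal] _ Fb[OF that]] bM[of i] by simp
  moreover have "b i = 0 \<longrightarrow> F i = (0, True)" if "i \<in> {1..n}" for i
    using Fb[OF that] zero by auto
  moreover have "card {i \<in> {1..n}. b i = v} = card {i \<in> {1..n}. fst (F i) = v}" for v
  proof (cases "v \<le> M")
    case True
    have "rows n F b = f" using rows by blast
    then show ?thesis
      using balanced_length[OF bal, of v] inflow_rows[of b M n F v, OF bM] length_rows[of n F b v] True
      by simp
  next
    case False
    have "{i \<in> {1..n}. b i = v} = {}" using False bM by blast
    moreover have "{i \<in> {1..n}. fst (F i) = v} = {}"
      using False \<open>\<And>i. i \<in> {1..n} \<Longrightarrow> F i \<in> letters {0..M} (b i)\<close> by (auto simp: letters_def)
    ultimately show ?thesis by (simp only:)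
  qed
  ultimately have "(F, b) \<in> sorted_words n M"
    using pp by (auto simp: sorted_words_def letters_def F_def)
  then show ?thesis using rows by (intro that) auto
qed

lemma rows_bij:
  "bij_betw (\<lambda>(F, b). rows n F b) (sorted_words n M) (row_arrays n M)"
proof (rule bij_betwI')
  fix p p' assume p: "p \<in> sorted_words n M" and p': "p' \<in> sorted_words n M"
  obtain F b G c where eqs: "p = (F, b)" "p' = (G, c)" by (cases p; cases p')
  have "p = p'" if "rows n F b = rows n G c"
  proof -
    have "map (\<lambda>i. (F i, b i)) [1..<Suc n] = map (\<lambda>i. (G i, c i)) [1..<Suc n]"
      using that row_list_rows[of F b n M] row_list_rows[of G c n M] p p' eqs by metis
    then have in_n: "F i = G i \<and> b i = c i" if "i \<in> {1..n}" for i
      using that by (auto simp del: upt_Suc)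
    have out_n: "F i = G i \<and> b i = c i" if "i \<notin> {1..n}" for i
      using that sorted_words_D(1,2)[of F b n M] sorted_words_D(1,2)[of G c n M] p p' eqs
      by (cases "i = 0") (auto simp: pparts_def)
    show ?thesis using in_n out_n eqs by (metis ext)
  qed
  then show "((case p of (F, b) \<Rightarrow> rows n F b) = (case p' of (F, b) \<Rightarrow> rows n F b)) = (p = p')"
    using eqs by auto
next
  fix p assume "p \<in> sorted_words n M"
  then show "(case p of (F, b) \<Rightarrow> rows n F b) \<in> row_arrays n M"
    using rows_in_row_arrays by (cases p) auto
next
  fix f assume "f \<in> row_arrays n M"
  then obtain F b where "(F, b) \<in> sorted_words n M" "rows n F b = f" by (rule row_array_is_rows)
  then show "\<exists>p\<in>sorted_words n M. f = (case p of (F, b) \<Rightarrow> rows n F b)"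
    by (intro bexI[of _ "(F, b)"]) auto
qed

lemma array_wt_rows:
  assumes "\<And>i. b i \<le> M"
  shows "array_wt x t {0..M} (rows n F b) =
    (\<Prod>i\<in>{1..n}. x (b i)) * t ^ card {i \<in> {1..n}. \<not> snd (F i)}"
proof -
  have "array_wt x t {0..M} (rows n F b) =
      (\<Prod>v\<in>{0..M}. \<Prod>i\<in>{i \<in> {1..n}. b i = v}. x (b i) * letter_wt t (F i))"
    unfolding array_wt_def
  proof (intro prod.cong refl)
    fix v
    have "(\<Prod>l\<leftarrow>rows n F b v. x v * letter_wt t l) =
        (\<Prod>i\<in>set (filter (\<lambda>i. b i = v) [1..<Suc n]). x v * letter_wt t (F i))"
      by (subst prod.distinct_set_conv_list) (simp_all add: rows_def o_def del: upt_Suc)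
    also have "set (filter (\<lambda>i. b i = v) [1..<Suc n]) = {i \<in> {1..n}. b i = v}" by auto
    also have "(\<Prod>i\<in>{i \<in> {1..n}. b i = v}. x v * letter_wt t (F i)) =
        (\<Prod>i\<in>{i \<in> {1..n}. b i = v}. x (b i) * letter_wt t (F i))"
      by (rule prod.cong) auto
    finally show "(\<Prod>l\<leftarrow>rows n F b v. x v * letter_wt t l) =
        (\<Prod>i\<in>{i \<in> {1..n}. b i = v}. x (b i) * letter_wt t (F i))" .
  qed
  also have "\<dots> = (\<Prod>i\<in>{1..n}. x (b i) * letter_wt t (F i))"
    using assms by (intro prod.group) auto
  also have "\<dots> = (\<Prod>i\<in>{1..n}. x (b i)) * (\<Prod>i\<in>{1..n}. letter_wt t (F i))"
    by (rule prod.distrib)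
  also have "(\<Prod>i\<in>{1..n}. letter_wt t (F i)) = (\<Prod>i\<in>{i \<in> {1..n}. \<not> snd (F i)}. t)"
    by (rule prod.mono_neutral_cong_right) (auto simp: letter_wt_def)
  finally show ?thesis by simp
qed

definition compat_sum :: "(nat \<Rightarrow> 'a::comm_ring_1) \<Rightarrow> nat \<Rightarrow> nat set \<Rightarrow> nat \<Rightarrow> 'a" where
  "compat_sum x n S M = (\<Sum>b\<in>pparts n S M. \<Prod>i\<in>{1..n}. x (b i))"

lemma finite_pparts: "finite (pparts n S M)"
proof (rule finite_subset)
  show "pparts n S M \<subseteq> {b. \<forall>i. (i \<in> {..n} \<longrightarrow> b i \<in> {..M}) \<and> (i \<notin> {..n} \<longrightarrow> b i = 0)}"
  proof
    fix b assume b: "b \<in> pparts n S M"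
    then have "\<forall>i>n. b i = 0" by (simp add: pparts_def)
    then show "b \<in> {b. \<forall>i. (i \<in> {..n} \<longrightarrow> b i \<in> {..M}) \<and> (i \<notin> {..n} \<longrightarrow> b i = 0)}"
      using pparts_le[OF b] by auto
  qed
qed (intro finite_set_of_finite_funs; simp)

definition pair_rows :: "nat \<Rightarrow> (nat \<Rightarrow> nat) \<times> (nat \<Rightarrow> nat) \<Rightarrow> nat \<Rightarrow> (nat \<times> bool) list" where
  "pair_rows n = (\<lambda>(\<sigma>, b). rows n (label \<sigma> b) b)"

lemma pair_rows_bij: "bij_betw (pair_rows n) (compat_pairs n M) (row_arrays n M)"
proof -
  have "bij_betw ((\<lambda>(F, b). rows n F b) \<circ> (\<lambda>(\<sigma>, b). (label \<sigma> b, b))) (compat_pairs n M) (row_arrays n M)"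
    by (rule bij_betw_trans[OF label_bij rows_bij])
  then show ?thesis by (simp add: o_def case_prod_unfold pair_rows_def)
qed

lemma finite_row_arrays: "finite (row_arrays n M)"
  by (rule finite_subset[OF _ finite_balanced[of "{0..M}" n]]) (auto simp: row_arrays_def)

lemma finite_compat_pairs: "finite (compat_pairs n M)"
  using bij_betw_finite[OF pair_rows_bij] finite_row_arrays by blast

lemma num_fix_pair_rows:
  assumes p: "(\<sigma>, b) \<in> compat_pairs n M"
  shows "(\<Sum>v\<in>{0..M}. trailing (v, True) (pair_rows n (\<sigma>, b) v)) = num_fix n \<sigma>"
proof -
  have "b \<in> pparts n (exc_descents n \<sigma>) M" using p by (simp add: compat_pairs_def)
  then have im: "b ` {i \<in> {1..n}. \<sigma> i = i} \<subseteq> {0..M}" using pparts_le by auto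
  have "{i \<in> {1..n}. b i = v \<and> (\<forall>m\<in>{i..n}. b m = v \<longrightarrow> label \<sigma> b m = (v, True))} =
      {i \<in> {i \<in> {1..n}. \<sigma> i = i}. b i = v}" for v
  proof (rule set_eqI)
    fix i
    show "i \<in> {i \<in> {1..n}. b i = v \<and> (\<forall>m\<in>{i..n}. b m = v \<longrightarrow> label \<sigma> b m = (v, True))} \<longleftrightarrow>
        i \<in> {i \<in> {i \<in> {1..n}. \<sigma> i = i}. b i = v}"
    proof (cases "i \<in> {1..n} \<and> b i = v")
      case True
      then show ?thesis using fixed_iff_label[OF p, of i] by simp
    qed blast
  qed
  then show ?thesis
    unfolding pair_rows_def prod.case trailing_rows num_fix_def using sum_card_fibres[OF _ _ im] by simp
qed

lemma array_wt_pair_rows: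
  assumes p: "(\<sigma>, b) \<in> compat_pairs n M"
  shows "array_wt x t {0..M} (pair_rows n (\<sigma>, b)) = t ^ exc n \<sigma> * (\<Prod>i\<in>{1..n}. x (b i))"
proof -
  have "\<sigma> permutes {1..n}" and b: "b \<in> pparts n (exc_descents n \<sigma>) M"
    using p by (auto simp: compat_pairs_def)
  then show ?thesis
    by (simp only: pair_rows_def prod.case array_wt_rows[of b, OF pparts_le[OF b]] exc_label[of \<sigma> n b] mult.commute)
qed

lemma sum_compat_pairs:
  assumes P: "\<And>\<sigma> b. (\<sigma>, b) \<in> compat_pairs n M \<Longrightarrow> P b \<longleftrightarrow> Q (pair_rows n (\<sigma>, b))"
  shows "(\<Sum>p | p \<in> compat_pairs n M \<and> num_fix n (fst p) = k \<and> P (snd p).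
       t ^ exc n (fst p) * (\<Prod>i\<in>{1..n}. x (snd p i))) =
    (\<Sum>f | f \<in> row_arrays n M \<and> end_loops M f = k \<and> Q f.
       array_wt x t {0..M} f)"
proof -
  let ?C = "{p. p \<in> compat_pairs n M \<and> num_fix n (fst p) = k \<and> P (snd p)}"
  let ?g = "\<lambda>f. if end_loops M f = k \<and> Q f then array_wt x t {0..M} f else 0"
  have "(\<Sum>p\<in>?C.
       t ^ exc n (fst p) * (\<Prod>i\<in>{1..n}. x (snd p i))) =
     (\<Sum>p\<in>?C. ?g (pair_rows n p))"
  proof (intro sum.cong refl)
    fix p assume "p \<in> ?C"
    then have p: "(fst p, snd p) \<in> compat_pairs n M" "num_fix n (fst p) = k" "P (snd p)" by simp_all
    show "t ^ exc n (fst p) * (\<Prod>i\<in>{1..n}. x (snd p i)) = ?g (pair_rows n p)"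
      using P[OF p(1)] num_fix_pair_rows[OF p(1)] array_wt_pair_rows[OF p(1), of x t] p(2,3) by simp
  qed
  also have "\<dots> = (\<Sum>p\<in>compat_pairs n M. ?g (pair_rows n p))"
  proof (rule sum.mono_neutral_left[OF finite_compat_pairs])
    show "\<forall>p\<in>compat_pairs n M - ?C.
        ?g (pair_rows n p) = 0"
    proof
      fix p assume p: "p \<in> compat_pairs n M - ?C"
      then have p': "(fst p, snd p) \<in> compat_pairs n M" by simp
      show "?g (pair_rows n p) = 0"
        using P[OF p'] num_fix_pair_rows[OF p'] p by auto
    qed
  qed auto
  also have "\<dots> = (\<Sum>f\<in>row_arrays n M. ?g f)"
    by (rule sum.reindex_bij_betw[OF pair_rows_bij])
  also have "\<dots> = (\<Sum>f | f \<in> row_arrays n M \<and> end_loops M f = k \<and> Q f.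
      array_wt x t {0..M} f)"
    by (subst sum.inter_filter[symmetric]) (simp_all add: finite_row_arrays)
  finally show ?thesis .
qed

lemma sum_row_arrays:
  assumes "k \<le> n"
  shows "(\<Sum>f | f \<in> row_arrays n M \<and> end_loops M f = k \<and> True.
      array_wt x t {0..M} f) = complete_hom x {0..M} k * reduced_coeff x t M (n - k)"
proof -
  have "{0..M} - {1..M} = {0}" by auto
  then have "{f. f \<in> row_arrays n M \<and> end_loops M f = k \<and> True} =
      {f. f \<in> balanced {0..M} n \<and> (\<forall>v\<in>{0..M}. f v \<noteq> [] \<longrightarrow> hd (f v) \<noteq> (v, False)) \<and>
      (\<forall>v\<in>{0..M} - {1..M}. set (f v) \<subseteq> {(v, True)}) \<and> end_loops M f = k}"
    by (auto simp: row_arrays_def)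
  then show ?thesis using sum_fixed_loops[of "{0..M}" "{1..M}" k n x t] assms by simp
qed

text \<open>A balanced array on \<open>{0..M}\<close> whose row \<open>0\<close> is empty contains no letter \<open>0\<close> and is therefore a balanced
array on \<open>{1..M}\<close>.\<close>

lemma sum_row_arrays_positive:
  assumes "k \<le> n"
  shows "(\<Sum>f | f \<in> row_arrays n M \<and> end_loops M f = k \<and> f 0 = [].
      array_wt x t {0..M} f) = complete_hom x {1..M} k * reduced_coeff x t M (n - k)"
proof -
  have V: "{0..M} - {0} = {1..M}" by auto
  have bal: "f \<in> balanced {0..M} n \<and> f 0 = [] \<longleftrightarrow> f \<in> balanced {1..M} n" for f
    using trails_stuck[of "{0..M}" 0 0 n] by (auto simp: trails_closed V)
  have zero: "end_loops M f = (\<Sum>v\<in>{1..M}. trailing (v, True) (f v))"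
    if "f 0 = []" for f :: array
    using that by (subst sum.remove[of _ 0]) (simp_all add: V trailing_def)
  have "{f. f \<in> row_arrays n M \<and> end_loops M f = k \<and> f 0 = []} =
      {f. f \<in> balanced {1..M} n \<and> (\<forall>v\<in>{1..M}. f v \<noteq> [] \<longrightarrow> hd (f v) \<noteq> (v, False)) \<and>
      (\<forall>v\<in>{1..M} - {1..M}. set (f v) \<subseteq> {(v, True)}) \<and> (\<Sum>v\<in>{1..M}. trailing (v, True) (f v)) = k}"
    (is "?L = ?R")
  proof (intro equalityI subsetI)
    fix f assume "f \<in> ?L"
    then show "f \<in> ?R" using bal[of f] zero[of f] by (auto simp: row_arrays_def)
  next
    fix f assume f: "f \<in> ?R"
    then have "f \<in> balanced {0..M} n" "f 0 = []" using bal[of f] by auto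
    moreover have "f v \<noteq> [] \<longrightarrow> hd (f v) \<noteq> (v, False)" if "v \<in> {0..M}" for v
      using f that \<open>f 0 = []\<close> by (cases "v = 0") auto
    ultimately show "f \<in> ?L" using f zero[of f] by (simp add: row_arrays_def)
  qed
  moreover have "array_wt x t {0..M} f = array_wt x t {1..M} f" if "f 0 = []" for f
    using array_wt_remove[of "{0..M}" 0 f x t] that by (simp add: V)
  ultimately have "(\<Sum>f | f \<in> row_arrays n M \<and> end_loops M f = k \<and> f 0 = [].
      array_wt x t {0..M} f) = (\<Sum>f\<in>?R. array_wt x t {1..M} f)"
    using bal by (intro sum.cong) auto
  then show ?thesis using sum_fixed_loops[of "{1..M}" "{1..M}" k n x t] assms by simp
qed

lemma pparts_insert_0:
  "b \<in> pparts n (insert 0 S) M \<longleftrightarrow> b \<in> pparts n S M \<and> (0 < n \<longrightarrow> 0 < b 1)"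
proof -
  have "(\<forall>i<n. b i + of_bool (i \<in> insert 0 S) \<le> b (Suc i)) \<longleftrightarrow>
      (\<forall>i<n. b i + of_bool (i \<in> S) \<le> b (Suc i)) \<and> (0 < n \<longrightarrow> 0 < b 1)" if "b 0 = 0"
  proof (intro iffI conjI allI impI)
    fix i assume *: "\<forall>i<n. b i + of_bool (i \<in> insert 0 S) \<le> b (Suc i)" "i < n"
    then have "b i + of_bool (i \<in> insert 0 S) \<le> b (Suc i)" by simp
    then show "b i + of_bool (i \<in> S) \<le> b (Suc i)" by (simp split: if_splits)
  next
    assume "\<forall>i<n. b i + of_bool (i \<in> insert 0 S) \<le> b (Suc i)" "0 < n"
    then have "b 0 + of_bool (0 \<in> insert 0 S) \<le> b (Suc 0)" by blast
    then show "0 < b 1" by simp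
  next
    fix i assume "(\<forall>i<n. b i + of_bool (i \<in> S) \<le> b (Suc i)) \<and> (0 < n \<longrightarrow> 0 < b 1)" "i < n"
    then show "b i + of_bool (i \<in> insert 0 S) \<le> b (Suc i)"
      using that by (cases "i = 0") auto
  qed
  then show ?thesis by (auto simp: pparts_def)
qed

abbreviation perms_fix :: "nat \<Rightarrow> nat \<Rightarrow> (nat \<Rightarrow> nat) set" where
  "perms_fix n k \<equiv> {\<sigma>. \<sigma> permutes {1..n} \<and> num_fix n \<sigma> = k}"

text \<open>The two formulas differ in the alphabet of the fixed points. With the descent at position \<open>0\<close> taken as
it is, the value \<open>0\<close> is available, but only to fixed points; forcing a strict increase at position \<open>0\<close>
excludes it.\<close>

lemma sum_compat:
  assumes "k \<le> n"
  shows "(\<Sum>\<sigma>\<in>perms_fix n k. t ^ exc n \<sigma> * compat_sum x n (exc_descents n \<sigma>) M) =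
      complete_hom x {0..M} k * reduced_coeff x t M (n - k)" (is ?th1)
    and "(\<Sum>\<sigma>\<in>perms_fix n k. t ^ exc n \<sigma> * compat_sum x n (insert 0 (exc_descents n \<sigma>)) M) =
      complete_hom x {1..M} k * reduced_coeff x t M (n - k)" (is ?th2)
proof -
  let ?G = "(perms_fix n k)"
  have fin: "finite ?G" by (rule finite_subset[OF _ finite_permutations[of "{1..n}"]]) auto
  have split: "(\<Sum>\<sigma>\<in>?G. t ^ exc n \<sigma> * compat_sum x n (T \<sigma>) M) =
      (\<Sum>p | p \<in> compat_pairs n M \<and> num_fix n (fst p) = k \<and> P (snd p).
       t ^ exc n (fst p) * (\<Prod>i\<in>{1..n}. x (snd p i)))"
    if T: "\<And>\<sigma> b. b \<in> pparts n (T \<sigma>) M \<longleftrightarrow> b \<in> pparts n (exc_descents n \<sigma>) M \<and> P b" for T P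
  proof -
    have "(\<Sum>\<sigma>\<in>?G. t ^ exc n \<sigma> * compat_sum x n (T \<sigma>) M) =
        (\<Sum>p\<in>(SIGMA \<sigma>:?G. pparts n (T \<sigma>) M). t ^ exc n (fst p) * (\<Prod>i\<in>{1..n}. x (snd p i)))"
      unfolding compat_sum_def sum_distrib_left
      using fin by (subst sum.Sigma) (auto simp: finite_pparts case_prod_unfold)
    also have "(SIGMA \<sigma>:?G. pparts n (T \<sigma>) M) =
        {p. p \<in> compat_pairs n M \<and> num_fix n (fst p) = k \<and> P (snd p)}"
      using T by (auto simp: compat_pairs_def)
    finally show ?thesis .
  qed
  show ?th1
    using split[of "exc_descents n" "\<lambda>_. True"] sum_compat_pairs[where n = n and M = M and P = "\<lambda>_. True" and Q = "\<lambda>_. True" and k = k and t = t and x = x] sum_row_arrays[OF assms, where M = M and x = x and t = t]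
    by simp
  have pos: "(0 < n \<longrightarrow> 0 < b 1) \<longleftrightarrow> pair_rows n (\<sigma>, b) 0 = []" if "(\<sigma>, b) \<in> compat_pairs n M" for \<sigma> b
  proof -
    have b: "b \<in> pparts n (exc_descents n \<sigma>) M" using that by (simp add: compat_pairs_def)
    have "pair_rows n (\<sigma>, b) 0 = [] \<longleftrightarrow> set (rows n (label \<sigma> b) b 0) = {}"
      by (simp add: pair_rows_def)
    also have "\<dots> \<longleftrightarrow> (\<forall>i\<in>{1..n}. b i \<noteq> 0)"
      by (auto simp: set_rows)
    also have "\<dots> \<longleftrightarrow> (0 < n \<longrightarrow> 0 < b 1)"
    proof
      assume "\<forall>i\<in>{1..n}. b i \<noteq> 0"
      then show "0 < n \<longrightarrow> 0 < b 1" by (simp add: Suc_le_eq)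
    next
      assume pos: "0 < n \<longrightarrow> 0 < b 1"
      show "\<forall>i\<in>{1..n}. b i \<noteq> 0"
      proof
        fix i assume i: "i \<in> {1..n}"
        then have "b 1 \<le> b i" using pparts_mono[OF b, of 1 i] by simp
        then show "b i \<noteq> 0" using pos i by simp
      qed
    qed
    finally show ?thesis by simp
  qed
  show ?th2
    unfolding split[of "\<lambda>\<sigma>. insert 0 (exc_descents n \<sigma>)" "\<lambda>b. 0 < n \<longrightarrow> 0 < b 1", OF pparts_insert_0]
    using sum_compat_pairs[where n = n and M = M and P = "\<lambda>b. 0 < n \<longrightarrow> 0 < b 1" and Q = "\<lambda>f. f 0 = []"
        and k = k and t = t and x = x, OF pos]
      sum_row_arrays_positive[OF assms, where M = M and x = x and t = t]
    by simp
qed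

section \<open>Major index, descents and principal specialization\<close>

text \<open>Descents of the barred word and ordinary descents differ only where a run of excedances begins or
ends: the position before its beginning is a descent of the barred word only, its last position an
ordinary descent only. The two positions differ by the length of the run, so summing over the runs
gives \<open>exc n \<sigma>\<close>. In the proof this is an induction along the word whose correction term records
whether the current position lies in a run.\<close>

lemma exc_descents_stats:
  assumes \<sigma>: "\<sigma> permutes {1..n}"
  shows "card (exc_descents n \<sigma>) = des n \<sigma>" "\<Sum>(exc_descents n \<sigma>) + exc n \<sigma> = maj n \<sigma>"
proof -
  let ?S = "exc_descents n \<sigma>" and ?D = "DES n \<sigma>"
  let ?e = "\<lambda>j. of_bool (j < \<sigma> j) :: nat"
  have count: "card (S \<inter> {..<j}) = (\<Sum>i<j. of_bool (i \<in> S))" for S :: "nat set" and j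
    by (simp add: of_bool_def sum.If_cases Int_commute)
  have total: "\<Sum>(S \<inter> {..<j}) = (\<Sum>i<j. if i \<in> S then i else 0)" for S :: "nat set" and j
    by (simp add: sum.If_cases Int_commute)
  have \<sigma>0: "\<sigma> 0 = 0" by (rule permutes_not_in[OF \<sigma>]) simp
  \<comment> \<open>A position where a run of excedances begins or ends belongs to exactly one of the two sets.\<close>
  have step: "of_bool (j \<in> ?S) + ?e j = of_bool (j \<in> ?D) + ?e (Suc j)" if "j < n" for j
  proof -
    have "\<sigma> j \<noteq> \<sigma> (Suc j)" using permutes_inj[OF \<sigma>] by (simp add: inj_eq)
    then show ?thesis using that \<sigma>0 
      by (cases "j = 0") (auto simp: exc_descents_def DES_def less_prod_def not_le of_bool_def split: if_splits)
  qed
  have A: "(\<Sum>i<j. of_bool (i \<in> ?S)) = (\<Sum>i<j. of_bool (i \<in> ?D)) + ?e j" if "j \<le> n" for j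
    using that
  proof (induction j)
    case (Suc j)
    then show ?case using step[of j] by simp
  qed (simp add: \<sigma>0)
  have B: "(\<Sum>i<j. if i \<in> ?S then i else 0) + (\<Sum>i\<in>{1..j}. ?e i) =
      (\<Sum>i<j. if i \<in> ?D then i else 0) + j * ?e j" if "j \<le> n" for j
    using that
  proof (induction j)
    case (Suc j)
    have "(if j \<in> ?S then j else 0) + j * ?e j = (if j \<in> ?D then j else 0) + j * ?e (Suc j)"
    proof -
      have "(if j \<in> S then j else 0) = j * of_bool (j \<in> S)" for S by simp
      then show ?thesis
        using arg_cong[OF step[of j], of "(*) j"] Suc.prems by (simp only: distrib_left Suc_le_eq)
    qed
    then show ?case using Suc by simp
  qed (simp add: \<sigma>0)
  have Sn: "?S \<inter> {..<n} = ?S" by (auto simp: exc_descents_def)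
  have Dn: "?D \<inter> {..<n} = ?D" by (auto simp: DES_def)
  have en: "?e n = 0"
    using permutes_in_image[OF \<sigma>, of n] \<sigma>0 by (cases "n = 0") auto
  show "card ?S = des n \<sigma>"
    using A[of n] count[of ?S n] count[of ?D n] en unfolding Sn Dn des_def by simp
  have "exc n \<sigma> = (\<Sum>i\<in>{1..n}. ?e i)"
  proof -
    have "{i \<in> {1..<n}. \<sigma> i > i} = {i \<in> {1..n}. i < \<sigma> i}" using en by (auto simp: le_less split: if_splits)
    then show ?thesis by (simp add: exc_def of_bool_def sum.If_cases Int_def)
  qed
  then show "\<Sum>?S + exc n \<sigma> = maj n \<sigma>"
    using B[of n] total[of ?S n] total[of ?D n] en unfolding Sn Dn maj_def by simp
qed

text \<open>The principal specialization, numbered so that the largest value has weight \<open>1\<close>.\<close>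

definition qweight :: "'a::comm_ring_1 \<Rightarrow> nat \<Rightarrow> nat \<Rightarrow> 'a" where
  "qweight q M v = q ^ (M - v)"

abbreviation partition_sum :: "'a::comm_ring_1 \<Rightarrow> nat \<Rightarrow> nat \<Rightarrow> 'a" where
  "partition_sum q n m \<equiv> compat_sum (qweight q m) n {} m"

lemma card_Int_lessThan_Suc:
  "card (S \<inter> {..<Suc i}) = card (S \<inter> {..<i}) + of_bool (i \<in> S)"
  by (simp add: lessThan_Suc Int_insert_right)

lemma pparts_lower:
  assumes "b \<in> pparts n S M" "i \<le> n"
  shows "card (S \<inter> {..<i}) \<le> b i"
  using assms(2)
proof (induction i)
  case (Suc i)
  have "b i + of_bool (i \<in> S) \<le> b (Suc i)" using assms(1) Suc.prems by (simp add: pparts_def)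
  then show ?case using Suc by (simp add: card_Int_lessThan_Suc)
qed simp

text \<open>Subtracting from \<open>b i\<close> the number of strict increases before \<open>i\<close> removes the strictness conditions.\<close>

lemma pparts_shift_bij:
  assumes S: "S \<subseteq> {..<n}"
  shows "bij_betw (\<lambda>c i. if i \<le> n then c i + card (S \<inter> {..<i}) else 0)
    (pparts n {} m) (pparts n S (m + card S))"
proof (rule bij_betw_byWitness)
  let ?s = "\<lambda>i. card (S \<inter> {..<i})"
  let ?\<phi> = "\<lambda>c i. if i \<le> n then c i + ?s i else 0"
  let ?\<psi> = "\<lambda>b i. if i \<le> n then b i - ?s i else 0"
  have sn: "?s n = card S" using S by (simp add: Int_absorb2)
  note low = pparts_lower[of _ n S "m + card S"]
  show "\<forall>c\<in>pparts n {} m. ?\<psi> (?\<phi> c) = c"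
    by (auto simp: pparts_def fun_eq_iff)
  show "\<forall>b\<in>pparts n S (m + card S). ?\<phi> (?\<psi> b) = b"
    using low by (auto simp: pparts_def fun_eq_iff)
  show "?\<phi> ` pparts n {} m \<subseteq> pparts n S (m + card S)"
  proof
    fix b assume "b \<in> ?\<phi> ` pparts n {} m"
    then obtain c where c: "c \<in> pparts n {} m" and b: "b = ?\<phi> c" by blast
    have "b i + of_bool (i \<in> S) \<le> b (Suc i)" if "i < n" for i
      using c that by (simp add: b pparts_def card_Int_lessThan_Suc)
    then show "b \<in> pparts n S (m + card S)" using c sn by (simp add: b pparts_def)
  qed
  show "?\<psi> ` pparts n S (m + card S) \<subseteq> pparts n {} m"
  proof
    fix c assume "c \<in> ?\<psi> ` pparts n S (m + card S)"
    then obtain b where b: "b \<in> pparts n S (m + card S)" and c: "c = ?\<psi> b" by blast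
    have "c i \<le> c (Suc i)" if "i < n" for i
    proof -
      have "b i + of_bool (i \<in> S) \<le> b (Suc i)" using b that by (simp add: pparts_def)
      then show ?thesis using low[OF b, of i] that by (simp add: c card_Int_lessThan_Suc)
    qed
    moreover have "c n \<le> m"
    proof -
      have "b n \<le> m + card S" using b by (simp add: pparts_def)
      then show ?thesis by (simp add: c sn)
    qed
    ultimately show "c \<in> pparts n {} m" using b by (simp add: c pparts_def)
  qed
qed

text \<open>Each \<open>s \<in> S\<close> is counted once for every \<open>i \<in> {1..s}\<close>.\<close>

lemma sum_card_above:
  assumes "S \<subseteq> {..<n::nat}"
  shows "(\<Sum>i\<in>{1..n}. card (S \<inter> {i..})) = \<Sum>S"
proof -
  have fin: "finite S" using assms finite_subset by blast
  have "(\<Sum>i\<in>{1..n}. card {s \<in> S. i \<le> s}) = (\<Sum>s\<in>S. card {i \<in> {1..n}. i \<le> s})"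
    by (rule sum_multicount_gen) (auto simp: fin)
  also have "\<dots> = \<Sum>S"
  proof (intro sum.cong refl)
    fix s assume "s \<in> S"
    then have "{i \<in> {1..n}. i \<le> s} = {1..s}" using assms by auto
    then show "card {i \<in> {1..n}. i \<le> s} = s" by simp
  qed
  also have "(\<Sum>i\<in>{1..n}. card {s \<in> S. i \<le> s}) = (\<Sum>i\<in>{1..n}. card (S \<inter> {i..}))"
    by (intro sum.cong arg_cong[of _ _ card]) auto
  finally show ?thesis .
qed

text \<open>After the shift of \<open>pparts_shift_bij\<close> the exponent of \<open>q\<close> splits into a part that depends on \<open>S\<close> only,
and \<open>card S\<close> lowers the bound on the values.\<close>

lemma compat_sum_qweight:
  assumes S: "S \<subseteq> {..<n}"
  shows "compat_sum (qweight q M) n S M =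
    (if card S \<le> M then q ^ \<Sum>S * partition_sum q n (M - card S) else 0)"
proof (cases "card S \<le> M")
  case True
  define m where "m = M - card S"
  have M: "M = m + card S" using True by (simp add: m_def)
  have fin: "finite S" using S finite_subset by blast
  have "compat_sum (qweight q M) n S M = (\<Sum>c\<in>pparts n {} m. \<Prod>i\<in>{1..n}. q ^ (M - (c i + card (S \<inter> {..<i}))))"
    unfolding compat_sum_def M sum.reindex_bij_betw[OF pparts_shift_bij[OF S], symmetric]
    by (simp add: qweight_def)
  also have "\<dots> = (\<Sum>c\<in>pparts n {} m. \<Prod>i\<in>{1..n}. q ^ card (S \<inter> {i..}) * q ^ (m - c i))"
  proof (intro sum.cong prod.cong refl)
    fix c i assume c: "c \<in> pparts n {} m"
    have "card S = card (S \<inter> {..<i}) + card (S \<inter> {i..})"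
      using fin by (subst card_Un_disjoint[symmetric]) (auto intro: arg_cong[of _ _ card])
    then have "M - (c i + card (S \<inter> {..<i})) = card (S \<inter> {i..}) + (m - c i)"
      using pparts_le[OF c, of i] by (simp add: M)
    then show "q ^ (M - (c i + card (S \<inter> {..<i}))) = q ^ card (S \<inter> {i..}) * q ^ (m - c i)"
      by (simp add: power_add)
  qed
  also have "\<dots> = q ^ \<Sum>S * partition_sum q n m"
    by (simp add: prod.distrib power_sum[symmetric] sum_card_above[OF S, unfolded One_nat_def] compat_sum_def sum_distrib_left qweight_def)
  finally show ?thesis using True by (simp add: m_def)
next
  case False
  have "pparts n S M = {}"
    using False pparts_lower[of _ n S M n] S pparts_le[of _ n S M n] by (force simp: Int_absorb2)
  then show ?thesis using False by (simp add: compat_sum_def)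
qed

lemma partition_sum_0 [simp]: "partition_sum q n 0 = 1"
proof -
  have "pparts n {} 0 = {\<lambda>_. 0}"
  proof (intro equalityI subsetI)
    fix b assume "b \<in> pparts n {} 0"
    then show "b \<in> {\<lambda>_. 0}" using pparts_le[of b n "{}" 0] by auto
  qed (simp add: pparts_def)
  then show ?thesis by (simp add: compat_sum_def qweight_def)
qed

text \<open>A sequence with initial term \<open>1\<close> is invertible for the convolution product.\<close>

lemma convolution_cancel:
  fixes G :: "nat \<Rightarrow> 'a::comm_ring_1"
  assumes "G 0 = 1" and eq: "\<And>M. (\<Sum>d\<le>M. u d * G (M - d)) = (\<Sum>d\<le>M. v d * G (M - d))"
  shows "u d = v d"
proof (induction d rule: less_induct)
  case (less d)
  have split: "(\<Sum>i\<le>d. w i * G (d - i)) = (\<Sum>i<d. w i * G (d - i)) + w d" for w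
    using assms(1) by (simp flip: lessThan_Suc_atMost)
  show ?case using eq[of d] less by (simp add: split)
qed

text \<open>The coefficient of \<open>p ^ d\<close> in a sum of monomials \<open>\<alpha> i * q ^ \<Sum>(S i) * p ^ card (S i)\<close>.\<close>

definition level_sum :: "'a::comm_ring_1 \<Rightarrow> 'i set \<Rightarrow> ('i \<Rightarrow> 'a) \<Rightarrow> ('i \<Rightarrow> nat set) \<Rightarrow> nat \<Rightarrow> 'a" where
  "level_sum q I \<alpha> S d = (\<Sum>i | i \<in> I \<and> card (S i) = d. \<alpha> i * q ^ \<Sum>(S i))"

lemma sum_compat_sum:
  assumes "finite I" "\<And>i. i \<in> I \<Longrightarrow> S i \<subseteq> {..<n}"
  shows "(\<Sum>i\<in>I. \<alpha> i * compat_sum (qweight q M) n (S i) M) =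
    (\<Sum>d\<le>M. level_sum q I \<alpha> S d * partition_sum q n (M - d))"
proof -
  have "(\<Sum>i\<in>I. \<alpha> i * compat_sum (qweight q M) n (S i) M) =
      (\<Sum>i\<in>I. if card (S i) \<le> M then \<alpha> i * q ^ \<Sum>(S i) * partition_sum q n (M - card (S i)) else 0)"
    by (intro sum.cong refl) (simp add: compat_sum_qweight[OF assms(2)] mult.assoc)
  also have "\<dots> = (\<Sum>i | i \<in> I \<and> card (S i) \<le> M. \<alpha> i * q ^ \<Sum>(S i) * partition_sum q n (M - card (S i)))"
    using assms(1) by (simp add: sum.inter_filter)
  also have "\<dots> = (\<Sum>d\<le>M. \<Sum>i | i \<in> {i. i \<in> I \<and> card (S i) \<le> M} \<and> card (S i) = d.
      \<alpha> i * q ^ \<Sum>(S i) * partition_sum q n (M - card (S i)))"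
    using assms(1) by (intro sum.group[symmetric]) auto
  also have "\<dots> = (\<Sum>d\<le>M. level_sum q I \<alpha> S d * partition_sum q n (M - d))"
    unfolding level_sum_def sum_distrib_right by (intro sum.cong) auto
  finally show ?thesis .
qed

lemma sum_level_sum:
  assumes "finite I" "\<And>i. i \<in> I \<Longrightarrow> S i \<subseteq> {..<n}"
  shows "(\<Sum>i\<in>I. \<alpha> i * q ^ \<Sum>(S i) * p ^ card (S i)) = (\<Sum>d\<le>n. level_sum q I \<alpha> S d * p ^ d)"
proof -
  have "card (S i) \<le> n" if "i \<in> I" for i
    using card_mono[OF _ assms(2)[OF that]] by simp
  then have "(\<Sum>i\<in>I. \<alpha> i * q ^ \<Sum>(S i) * p ^ card (S i)) =
      (\<Sum>d\<le>n. \<Sum>i | i \<in> I \<and> card (S i) = d. \<alpha> i * q ^ \<Sum>(S i) * p ^ card (S i))"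
    using assms(1) by (intro sum.group[symmetric]) auto
  also have "\<dots> = (\<Sum>d\<le>n. level_sum q I \<alpha> S d * p ^ d)"
    unfolding level_sum_def sum_distrib_right by (intro sum.cong) auto
  finally show ?thesis .
qed

text \<open>As \<open>M\<close> varies, the sums over compatible sequences are the convolution of the coefficients \<open>level_sum\<close>
with a sequence that is the same on both sides, and that sequence can be cancelled.\<close>

lemma weighted_major_index_eqI:
  fixes q p :: "'a::comm_ring_1"
  assumes "finite I" "\<And>i. i \<in> I \<Longrightarrow> S i \<subseteq> {..<n}"
    and "finite J" "\<And>j. j \<in> J \<Longrightarrow> T j \<subseteq> {..<n}"
    and eq: "\<And>M. (\<Sum>i\<in>I. \<alpha> i * compat_sum (qweight q M) n (S i) M) =
      (\<Sum>j\<in>J. \<beta> j * compat_sum (qweight q M) n (T j) M)"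
  shows "(\<Sum>i\<in>I. \<alpha> i * q ^ \<Sum>(S i) * p ^ card (S i)) = (\<Sum>j\<in>J. \<beta> j * q ^ \<Sum>(T j) * p ^ card (T j))"
proof -
  have "level_sum q I \<alpha> S d = level_sum q J \<beta> T d" for d
  proof (rule convolution_cancel)
    show "partition_sum q n 0 = 1" by simp
    show "(\<Sum>d\<le>M. level_sum q I \<alpha> S d * partition_sum q n (M - d)) =
        (\<Sum>d\<le>M. level_sum q J \<beta> T d * partition_sum q n (M - d))" for M
      using eq[of M] sum_compat_sum[OF assms(1,2), where M = M and q = q and \<alpha> = \<alpha>]
        sum_compat_sum[OF assms(3,4), where M = M and q = q and \<alpha> = \<beta>] by simp
  qed
  then show ?thesis
    using sum_level_sum[OF assms(1,2), where \<alpha> = \<alpha>] sum_level_sum[OF assms(3,4), where \<alpha> = \<beta>] by simp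
qed

section \<open>Products of complete homogeneous functions as sums over words\<close>

text \<open>The predecessor is truncated, so that the values at \<open>0\<close> and \<open>1\<close> vanish.\<close>

definition block_coeff :: "'a::comm_ring_1 \<Rightarrow> nat \<Rightarrow> 'a" where
  "block_coeff t a = t * qint t (a - 1)"

lemma block_coeff_0 [simp]: "block_coeff t 0 = 0"
  by (simp add: block_coeff_def)

text \<open>The equation \<open>reduced_gf_eq\<close> read off coefficientwise, with \<open>[a] - 1 = t [a - 1]\<close>.\<close>

lemma reduced_gf_rec:
  "reduced_coeff x t M n =
    (if n = 0 then 1 else \<Sum>a\<le>n. block_coeff t a * complete_hom x {1..M} a * reduced_coeff x t M (n - a))"
proof -
  let ?h = "complete_hom x {1..M}" and ?Y = "reduced_gf x t {1..M}"
  have coeff: "fps_nth (hom_gf x {1..M} - weighted_hom_gf x t {1..M}) a =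
      (if a = 0 then 1 else 0) - block_coeff t a * ?h a" for a
    by (cases a) (simp_all add: hom_gf_def weighted_hom_gf_def complete_hom_0 block_coeff_def qint_Suc algebra_simps)
  have "fps_nth ((hom_gf x {1..M} - weighted_hom_gf x t {1..M}) * ?Y) n = fps_nth ?Y n -
      (\<Sum>a\<le>n. block_coeff t a * ?h a * fps_nth ?Y (n - a))"
    unfolding fps_mult_nth coeff atMost_atLeast0
    by (simp add: left_diff_distrib sum_subtractf if_distrib[of "\<lambda>z. z * _"] cong: if_cong)
  then show ?thesis
    unfolding reduced_gf_eq by (cases "n = 0") simp_all
qed

text \<open>Multisets of pairs of a value and a letter. Collecting the values of each letter turns them into
sequences of multisets, and sorting them turns them into words with compatible sequences.\<close>

definition biletters :: "nat \<Rightarrow> nat \<Rightarrow> nat \<Rightarrow> (nat \<times> nat) multiset set" where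
  "biletters M L n = {\<Omega>. size \<Omega> = n \<and> set_mset \<Omega> \<subseteq> {1..M} \<times> {..<L}}"

text \<open>Inserts a new smallest letter \<open>0\<close>, with \<open>fst p\<close> as its multiset of values, and shifts the other letters.\<close>

definition join :: "nat multiset \<times> (nat \<times> nat) multiset \<Rightarrow> (nat \<times> nat) multiset" where
  "join p = image_mset (\<lambda>v. (v, 0)) (fst p) + image_mset (\<lambda>w. (fst w, Suc (snd w))) (snd p)"

lemma finite_biletters: "finite (biletters M L n)"
  by (simp add: biletters_def finite_msets_of_size)

lemma join_bij:
  "bij_betw join (\<Union>a\<le>n. {N. size N = a \<and> set_mset N \<subseteq> {1..M}} \<times> biletters M L (n - a)) (biletters M (Suc L) n)"
proof (rule bij_betw_byWitness)
  let ?split = "\<lambda>\<Omega>. (image_mset fst (filter_mset (\<lambda>w. snd w = 0) \<Omega>),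
     image_mset (\<lambda>w. (fst w, snd w - 1)) (filter_mset (\<lambda>w. snd w \<noteq> 0) \<Omega>))"
  let ?P = "\<Union>a\<le>n. {N. size N = a \<and> set_mset N \<subseteq> {1..M}} \<times> biletters M L (n - a)"
  show "\<forall>p\<in>?P. ?split (join p) = p"
    by (auto simp: join_def filter_mset_image_mset multiset.map_comp o_def)
  show "\<forall>\<Omega>\<in>biletters M (Suc L) n. join (?split \<Omega>) = \<Omega>"
  proof
    fix \<Omega> :: "(nat \<times> nat) multiset"
    have "image_mset (\<lambda>v. (v, 0)) (image_mset fst (filter_mset (\<lambda>w. snd w = 0) \<Omega>)) = filter_mset (\<lambda>w. snd w = 0) \<Omega>"
      unfolding multiset.map_comp by (rule trans[OF image_mset_cong multiset.map_ident]) auto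
    moreover have "image_mset (\<lambda>w. (fst w, Suc (snd w)))
        (image_mset (\<lambda>w. (fst w, snd w - 1)) (filter_mset (\<lambda>w. snd w \<noteq> 0) \<Omega>)) = filter_mset (\<lambda>w. snd w \<noteq> 0) \<Omega>"
      unfolding multiset.map_comp by (rule trans[OF image_mset_cong multiset.map_ident]) auto
    ultimately show "join (?split \<Omega>) = \<Omega>"
      by (simp only: join_def fst_conv snd_conv multiset_partition[symmetric])
  qed
  show "join ` ?P \<subseteq> biletters M (Suc L) n"
    by (auto simp: join_def biletters_def subset_iff)
  show "?split ` biletters M (Suc L) n \<subseteq> ?P"
  proof
    fix p assume "p \<in> ?split ` biletters M (Suc L) n"
    then obtain \<Omega> where \<Omega>: "\<Omega> \<in> biletters M (Suc L) n" and p: "p = ?split \<Omega>" by blast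
    have "size (filter_mset (\<lambda>w. snd w = 0) \<Omega>) + size (filter_mset (\<lambda>w. snd w \<noteq> 0) \<Omega>) = n"
      using arg_cong[OF multiset_partition[of \<Omega> "\<lambda>w. snd w = 0"], of size] \<Omega>
      by (simp only: size_union biletters_def mem_Collect_eq)
    moreover have "set_mset (fst p) \<subseteq> {1..M}" "set_mset (snd p) \<subseteq> {1..M} \<times> {..<L}"
      using \<Omega> by (auto simp: p biletters_def)
    ultimately show "p \<in> ?P"
      by (intro UN_I[of "size (fst p)"]) (auto simp: p biletters_def)
  qed
qed

definition biletter_wt :: "(nat \<Rightarrow> 'a::comm_ring_1) \<Rightarrow> (nat \<times> nat) multiset \<Rightarrow> 'a" where
  "biletter_wt x \<Omega> = (\<Prod>w\<in>#\<Omega>. x (fst w))"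

abbreviation content :: "(nat \<times> nat) multiset \<Rightarrow> nat \<Rightarrow> nat" where
  "content \<Omega> \<equiv> count (image_mset snd \<Omega>)"

lemma count_image_Suc: "count (image_mset Suc Z) 0 = 0" "count (image_mset Suc Z) (Suc i) = count Z i"
  by (induction Z) auto

lemma content_join:
  "content (join (N, \<Omega>)) 0 = size N" "content (join (N, \<Omega>)) (Suc i) = content \<Omega> i"
proof -
  have "image_mset snd (join (N, \<Omega>)) = replicate_mset (size N) 0 + image_mset Suc (image_mset snd \<Omega>)"
    by (simp add: join_def multiset.map_comp o_def image_mset_const_eq)
  then show "content (join (N, \<Omega>)) 0 = size N" "content (join (N, \<Omega>)) (Suc i) = content \<Omega> i"
    by (simp_all add: count_image_Suc)
qed

lemma sum_biletters_Suc:
  "(\<Sum>\<Omega>\<in>biletters M (Suc L) n. \<phi> (content \<Omega> 0) * \<psi> (\<lambda>i. content \<Omega> (Suc i)) * biletter_wt x \<Omega>) =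
    (\<Sum>a\<le>n. \<phi> a * complete_hom x {1..M} a * (\<Sum>\<Omega>\<in>biletters M L (n - a). \<psi> (content \<Omega>) * biletter_wt x \<Omega>))"
proof -
  let ?E = "\<lambda>a. \<Sum>\<Omega>\<in>biletters M L (n - a). \<psi> (content \<Omega>) * biletter_wt x \<Omega>"
  let ?g = "\<lambda>p. \<phi> (size (fst p)) * (\<Prod>v\<in>#fst p. x v) * (\<psi> (content (snd p)) * biletter_wt x (snd p))"
  let ?N = "\<lambda>a. {N. size N = a \<and> set_mset N \<subseteq> {1..M}}"
  have "(\<Sum>\<Omega>\<in>biletters M (Suc L) n. \<phi> (content \<Omega> 0) * \<psi> (\<lambda>i. content \<Omega> (Suc i)) * biletter_wt x \<Omega>) =
      (\<Sum>p\<in>(\<Union>a\<le>n. ?N a \<times> biletters M L (n - a)). ?g p)"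
    unfolding sum.reindex_bij_betw[OF join_bij, symmetric]
  proof (intro sum.cong refl)
    fix p
    have "biletter_wt x (join p) = (\<Prod>v\<in>#fst p. x v) * biletter_wt x (snd p)"
      by (simp add: biletter_wt_def join_def multiset.map_comp o_def)
    then show "\<phi> (content (join p) 0) * \<psi> (\<lambda>i. content (join p) (Suc i)) * biletter_wt x (join p) = ?g p"
      using content_join[of "fst p" "snd p"] by (simp add: mult_ac)
  qed
  also have "\<dots> = (\<Sum>a\<le>n. \<Sum>p\<in>?N a \<times> biletters M L (n - a). ?g p)"
    by (rule sum.UNION_disjoint) (auto simp: finite_biletters finite_msets_of_size)
  also have "\<dots> = (\<Sum>a\<le>n. \<phi> a * complete_hom x {1..M} a * ?E a)"
  proof (intro sum.cong refl)
    fix a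
    have "(\<Sum>p\<in>?N a \<times> biletters M L (n - a). ?g p) =
        (\<Sum>N\<in>?N a. \<Sum>\<Omega>\<in>biletters M L (n - a). (\<phi> a * (\<Prod>v\<in>#N. x v)) * (\<psi> (content \<Omega>) * biletter_wt x \<Omega>))"
      unfolding sum.cartesian_product by (intro sum.cong) auto
    also have "\<dots> = (\<Sum>N\<in>?N a. \<phi> a * (\<Prod>v\<in>#N. x v)) * ?E a"
      by (rule sum_product[symmetric])
    finally show "(\<Sum>p\<in>?N a \<times> biletters M L (n - a). ?g p) =
       \<phi> a * complete_hom x {1..M} a * ?E a"
      by (simp only: complete_hom_def sum_distrib_left)
  qed
  finally show ?thesis .
qed

text \<open>The product of the \<open>c (m i)\<close> up to the largest letter in use. As \<open>c 0 = 0\<close> in the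
applications, multiplicities with a gap have weight \<open>0\<close>, and the remaining ones correspond to
compositions.\<close>

fun content_wt :: "(nat \<Rightarrow> 'a::comm_ring_1) \<Rightarrow> nat \<Rightarrow> (nat \<Rightarrow> nat) \<Rightarrow> 'a" where
  "content_wt c 0 m = 1"
| "content_wt c (Suc L) m =
    (if \<forall>i\<le>L. m i = 0 then 1 else c (m 0) * content_wt c L (\<lambda>i. m (Suc i)))"

text \<open>The smallest letter contributes the first part of a composition, so the sum satisfies the recurrence
of \<open>reduced_gf_rec\<close>. That part is at least \<open>1\<close>, because \<open>block_coeff t 0 = 0\<close>; hence \<open>n\<close> decreases with
the number of letters, and \<open>L \<ge> n\<close> letters are enough.\<close>

lemma sum_content_wt:
  assumes "n \<le> L"
  shows "(\<Sum>\<Omega>\<in>biletters M L n. content_wt (block_coeff t) L (content \<Omega>) * biletter_wt x \<Omega>) =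
    reduced_coeff x t M n"
  using assms
proof (induction L arbitrary: n)
  case 0
  then have "biletters M 0 n = {{#}}" by (auto simp: biletters_def)
  then show ?case using 0 reduced_gf_rec[of x t M 0] by (simp add: biletter_wt_def)
next
  case (Suc L)
  show ?case
  proof (cases "n = 0")
    case True
    then have "biletters M (Suc L) n = {{#}}" by (auto simp: biletters_def)
    then show ?thesis using True reduced_gf_rec[of x t M 0] by (simp add: biletter_wt_def)
  next
    case False
    let ?E = "\<lambda>a. \<Sum>\<Omega>\<in>biletters M L (n - a). content_wt (block_coeff t) L (content \<Omega>) * biletter_wt x \<Omega>"
    have "content_wt (block_coeff t) (Suc L) (content \<Omega>) =
        block_coeff t (content \<Omega> 0) * content_wt (block_coeff t) L (\<lambda>i. content \<Omega> (Suc i))"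
      if \<Omega>: "\<Omega> \<in> biletters M (Suc L) n" for \<Omega>
    proof -
      have "\<Omega> \<noteq> {#}" using \<Omega> False by (auto simp: biletters_def)
      then obtain w where w: "w \<in># \<Omega>" by blast
      then have "content \<Omega> (snd w) \<noteq> 0" "snd w \<le> L"
        using \<Omega> by (auto simp: biletters_def)
      then show ?thesis by auto
    qed
    then have "(\<Sum>\<Omega>\<in>biletters M (Suc L) n. content_wt (block_coeff t) (Suc L) (content \<Omega>) * biletter_wt x \<Omega>) =
        (\<Sum>\<Omega>\<in>biletters M (Suc L) n. block_coeff t (content \<Omega> 0) *
          content_wt (block_coeff t) L (\<lambda>i. content \<Omega> (Suc i)) * biletter_wt x \<Omega>)"
      by (intro sum.cong refl) (simp del: content_wt.simps)
    also have "\<dots> = (\<Sum>a\<le>n. block_coeff t a * complete_hom x {1..M} a *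
        ?E a)"
      by (rule sum_biletters_Suc)
    also have "\<dots> = (\<Sum>a\<le>n. block_coeff t a * complete_hom x {1..M} a * reduced_coeff x t M (n - a))"
    proof (intro sum.cong refl)
      fix a
      show "block_coeff t a * complete_hom x {1..M} a *
          ?E a =
        block_coeff t a * complete_hom x {1..M} a * reduced_coeff x t M (n - a)"
        using Suc.IH[of "n - a"] Suc.prems by (cases "a = 0") simp_all
    qed
    finally show ?thesis using False reduced_gf_rec[of x t M n] by simp
  qed
qed

text \<open>The descents in the usual numbering, where letters are counted from \<open>1\<close>, together with \<open>0\<close>, which
makes the values of a compatible sequence positive.\<close>

definition word_descents :: "nat list \<Rightarrow> nat set" where
  "word_descents u = {i. i < length u \<and> (i = 0 \<or> u ! i < u ! (i - 1))}"

definition word_pairs :: "nat \<Rightarrow> nat \<Rightarrow> nat \<Rightarrow> (nat list \<times> (nat \<Rightarrow> nat)) set" where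
  "word_pairs M L n = (SIGMA u:{u. set u \<subseteq> {..<L} \<and> length u = n}. pparts n (word_descents u) M)"

definition biword :: "nat list \<times> (nat \<Rightarrow> nat) \<Rightarrow> (nat \<times> nat) list" where
  "biword p = map (\<lambda>i. (snd p (Suc i), fst p ! i)) [0..<length (fst p)]"

lemma sorted_biword:
  assumes "p \<in> word_pairs M L n"
  shows "sorted (biword p)"
proof -
  obtain u b where p: "p = (u, b)" by (cases p)
  have b: "b \<in> pparts n (word_descents u) M" and len: "length u = n"
    using assms by (auto simp: word_pairs_def p)
  have "(b (Suc i), u ! i) \<le> (b (Suc (Suc i)), u ! Suc i)" if "Suc i < n" for i
  proof -
    have "b (Suc i) + of_bool (Suc i \<in> word_descents u) \<le> b (Suc (Suc i))"
      using b that by (simp add: pparts_def)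
    then show ?thesis using that len by (auto simp: word_descents_def less_eq_prod_def not_less)
  qed
  then show ?thesis by (simp add: biword_def p len sorted_iff_nth_Suc)
qed

text \<open>Compatibility of \<open>b\<close> with \<open>u\<close> says that the pairs of a value and a letter are sorted lexicographically,
and a sorted list is determined by its multiset.\<close>

lemma biword_bij:
  "bij_betw (\<lambda>p. mset (biword p)) (word_pairs M L n) (biletters M L n)"
proof (rule bij_betw_byWitness)
  let ?\<psi> = "\<lambda>\<Omega>. (map snd (sorted_list_of_multiset \<Omega>),
    \<lambda>i. if i \<in> {1..n} then fst (sorted_list_of_multiset \<Omega> ! (i - 1)) else 0)"
  show "\<forall>p\<in>word_pairs M L n. ?\<psi> (mset (biword p)) = p"
  proof
    fix p assume p: "p \<in> word_pairs M L n"
    obtain u b where ub: "p = (u, b)" by (cases p)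
    have b: "b \<in> pparts n (word_descents u) M" and len: "length u = n"
      using p by (auto simp: word_pairs_def ub)
    have "sorted_list_of_multiset (mset (biword p)) = biword p"
      by (simp add: sorted_sort_id sorted_biword[OF p])
    moreover have "map snd (biword p) = u"
      by (rule nth_equalityI) (simp_all add: biword_def ub)
    moreover have "(if i \<in> {1..n} then fst (biword p ! (i - 1)) else 0) = b i" for i
      using b len by (cases "i = 0") (auto simp: biword_def ub pparts_def)
    ultimately show "?\<psi> (mset (biword p)) = p" by (simp only: ub)
  qed
  have len: "length (sorted_list_of_multiset \<Omega>) = n" if "\<Omega> \<in> biletters M L n" for \<Omega>
    using that by (metis (mono_tags, lifting) biletters_def mem_Collect_eq mset_sorted_list_of_multiset size_mset)
  show "\<forall>\<Omega>\<in>biletters M L n. mset (biword (?\<psi> \<Omega>)) = \<Omega>"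
  proof
    fix \<Omega> assume "\<Omega> \<in> biletters M L n"
    note l = len[OF this]
    have "biword (?\<psi> \<Omega>) = sorted_list_of_multiset \<Omega>"
      by (rule nth_equalityI) (simp_all add: biword_def l)
    then show "mset (biword (?\<psi> \<Omega>)) = \<Omega>" by (simp only: mset_sorted_list_of_multiset)
  qed
  show "(\<lambda>p. mset (biword p)) ` word_pairs M L n \<subseteq> biletters M L n"
  proof
    fix \<Omega> assume "\<Omega> \<in> (\<lambda>p. mset (biword p)) ` word_pairs M L n"
    then obtain u b where p: "(u, b) \<in> word_pairs M L n" and \<Omega>: "\<Omega> = mset (biword (u, b))" by auto
    have b: "b \<in> pparts n (word_descents u) M" and len: "length u = n" and u: "set u \<subseteq> {..<L}"
      using p by (auto simp: word_pairs_def)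
    have "b (Suc i) \<in> {1..M}" if "i < n" for i
    proof -
      have "b 0 + of_bool (0 \<in> word_descents u) \<le> b (Suc 0)" using b that unfolding pparts_def by blast
      then have "1 \<le> b (Suc 0)" using that len by (simp add: word_descents_def)
      also have "\<dots> \<le> b (Suc i)" using pparts_mono[OF b, of "Suc 0" "Suc i"] that by simp
      finally show ?thesis using pparts_le[OF b, of "Suc i"] by simp
    qed
    moreover have "u ! i \<in> {..<L}" if "i < n" for i using u that len nth_mem by blast
    ultimately show "\<Omega> \<in> biletters M L n" by (auto simp: \<Omega> biword_def biletters_def len)
  qed
  show "?\<psi> ` biletters M L n \<subseteq> word_pairs M L n"
  proof
    fix p assume "p \<in> ?\<psi> ` biletters M L n"
    then obtain \<Omega> where \<Omega>: "\<Omega> \<in> biletters M L n" and p: "p = ?\<psi> \<Omega>" by blast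
    define l where "l = sorted_list_of_multiset \<Omega>"
    have ll: "length l = n" unfolding l_def by (rule len[OF \<Omega>])
    have ls: "sorted l" by (simp add: l_def)
    have set: "l ! i \<in> {1..M} \<times> {..<L}" if "i < n" for i
      using nth_mem[of i l] that ll \<Omega> by (auto simp: l_def biletters_def)
    define u b where "u = map snd l" and "b = (\<lambda>i. if i \<in> {1..n} then fst (l ! (i - 1)) else 0)"
    have "b i + of_bool (i \<in> word_descents u) \<le> b (Suc i)" if "i < n" for i
    proof (cases "i = 0")
      case True
      then show ?thesis using set[of 0] that by (auto simp: b_def of_bool_def mem_Times_iff)
    next
      case False
      have "l ! (i - 1) \<le> l ! i" using ls ll that by (simp add: sorted_iff_nth_mono)
      then show ?thesis
        using False that ll by (auto simp: b_def u_def word_descents_def less_eq_prod_def)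
    qed
    moreover have "b n \<le> M" using set[of "n - 1"] by (auto simp: b_def mem_Times_iff)
    ultimately have "b \<in> pparts n (word_descents u) M" by (simp add: pparts_def b_def)
    moreover have "set u \<subseteq> {..<L}" "length u = n"
      using set ll by (force simp: u_def in_set_conv_nth mem_Times_iff)+
    ultimately have "(u, b) \<in> word_pairs M L n" by (simp add: word_pairs_def)
    then show "p \<in> word_pairs M L n" by (simp only: p u_def b_def l_def)
  qed
qed

text \<open>The letter \<open>0\<close> receives a weight \<open>\<phi>\<close> of its own; this is where the different claims of the theorem
enter.\<close>

lemma sum_words:
  "(\<Sum>u | set u \<subseteq> {..<Suc n} \<and> length u = n.
      \<phi> (count (mset u) 0) * content_wt (block_coeff t) n (\<lambda>i. count (mset u) (Suc i)) *
      compat_sum x n (word_descents u) M) =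
    (\<Sum>a\<le>n. \<phi> a * complete_hom x {1..M} a * reduced_coeff x t M (n - a))"
proof -
  let ?w = "\<lambda>m. \<phi> (m 0) * content_wt (block_coeff t) n (\<lambda>i. m (Suc i))"
  have "(\<Sum>u | set u \<subseteq> {..<Suc n} \<and> length u = n. ?w (count (mset u)) * compat_sum x n (word_descents u) M) =
      (\<Sum>p\<in>word_pairs M (Suc n) n. ?w (count (mset (fst p))) * (\<Prod>i\<in>{1..n}. x (snd p i)))"
    unfolding word_pairs_def compat_sum_def sum_distrib_left
    by (subst sum.Sigma) (auto simp: finite_pparts finite_lists_length_eq case_prod_unfold)
  also have "\<dots> = (\<Sum>p\<in>word_pairs M (Suc n) n. ?w (content (mset (biword p))) * biletter_wt x (mset (biword p)))"
  proof (intro sum.cong refl)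
    fix p assume "p \<in> word_pairs M (Suc n) n"
    then have len: "length (fst p) = n" by (auto simp: word_pairs_def)
    have "map snd (biword p) = fst p"
      by (rule nth_equalityI) (simp_all add: biword_def)
    then have "image_mset snd (mset (biword p)) = mset (fst p)"
      by (simp flip: mset_map)
    moreover have "biletter_wt x (mset (biword p)) = (\<Prod>i\<in>{1..n}. x (snd p i))"
    proof -
      have "biletter_wt x (mset (biword p)) = (\<Prod>i\<leftarrow>[0..<n]. x (snd p (Suc i)))"
        by (simp add: biletter_wt_def biword_def len o_def flip: mset_map prod_mset_prod_list)
      also have "\<dots> = (\<Prod>i\<in>{0..<n}. x (snd p (Suc i)))"
        by (subst prod.distinct_set_conv_list[symmetric]) simp_all
      also have "\<dots> = (\<Prod>i\<in>{1..n}. x (snd p i))"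
        by (rule prod.reindex_bij_witness[of _ "\<lambda>i. i - 1" Suc]) auto
      finally show ?thesis .
    qed
    ultimately show "?w (count (mset (fst p))) * (\<Prod>i\<in>{1..n}. x (snd p i)) =
        ?w (content (mset (biword p))) * biletter_wt x (mset (biword p))" by simp
  qed
  also have "\<dots> = (\<Sum>\<Omega>\<in>biletters M (Suc n) n. ?w (content \<Omega>) * biletter_wt x \<Omega>)"
    by (rule sum.reindex_bij_betw[OF biword_bij])
  also have "\<dots> = (\<Sum>a\<le>n. \<phi> a * complete_hom x {1..M} a *
      (\<Sum>\<Omega>\<in>biletters M n (n - a). content_wt (block_coeff t) n (content \<Omega>) * biletter_wt x \<Omega>))"
    by (rule sum_biletters_Suc)
  also have "\<dots> = (\<Sum>a\<le>n. \<phi> a * complete_hom x {1..M} a * reduced_coeff x t M (n - a))"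
    by (simp add: sum_content_wt)
  finally show ?thesis .
qed

section \<open>Symmetric unimodal polynomials\<close>

abbreviation run :: "nat \<Rightarrow> nat \<Rightarrow> nat \<Rightarrow> nat \<Rightarrow> laurent_qp poly" where
  "run e d r m \<equiv> var_q ^ e * var_p ^ d * (var_t ^ r * qint var_t m)"

text \<open>Sums of monomials in \<open>q\<close> and \<open>p\<close> times \<open>t ^ r + \<dots> + t ^ (c - r)\<close>. The equation \<open>2 * r + m = c + 1\<close> says
that a run of \<open>m\<close> consecutive powers starting at \<open>t ^ r\<close> has its center at \<open>c / 2\<close>. Presenting symmetric
unimodal polynomials as such sums makes their closure under products a matter of multiplying two runs.\<close>

inductive sym_unimodal :: "nat \<Rightarrow> laurent_qp poly \<Rightarrow> bool" where
  zero: "sym_unimodal c 0"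
| add: "sym_unimodal c P \<Longrightarrow> 2 * r + m = Suc c \<Longrightarrow>
    sym_unimodal c (P + run e d r m)"

lemma sym_unimodal_run:
  "2 * r + m = Suc c \<Longrightarrow> sym_unimodal c (run e d r m)"
  using sym_unimodal.add[OF sym_unimodal.zero, of r m c e d] by simp

lemma sym_unimodal_add: "sym_unimodal c Q \<Longrightarrow> sym_unimodal c P \<Longrightarrow> sym_unimodal c (P + Q)"
proof (induction rule: sym_unimodal.induct)
  case (add c Q r m e d)
  have "sym_unimodal c ((P + Q) + run e d r m)"
    using add by (intro sym_unimodal.add) auto
  then show ?case by (simp only: add.assoc)
qed simp

lemma sym_unimodal_sum: "(\<And>i. i \<in> I \<Longrightarrow> sym_unimodal c (f i)) \<Longrightarrow> sym_unimodal c (sum f I)"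
  by (induction I rule: infinite_finite_induct) (auto intro: sym_unimodal.zero sym_unimodal_add)

lemma qint_add: "qint t (a + b) = qint t a + t ^ a * qint t b"
  by (induction a) (simp_all add: qint_Suc algebra_simps)

text \<open>The first run in the decomposition of a product of two runs into nested runs with the same center;
the other ones come from the remaining product by recursion.\<close>

lemma qint_mult_Suc: "qint t (Suc a) * qint t (Suc b) = qint t (Suc (a + b)) + t * (qint t a * qint t b)"
proof -
  have "qint t (Suc a) * qint t (Suc b) = qint t (Suc b) + t * qint t a * qint t (b + 1)"
    by (simp add: qint_Suc[of t a] algebra_simps)
  also have "qint t (b + 1) = qint t b + t ^ b"
    unfolding qint_add by (simp add: qint_Suc)
  also have "qint t (Suc b) + t * qint t a * (qint t b + t ^ b) =
      (qint t (Suc b) + t ^ Suc b * qint t a) + t * (qint t a * qint t b)"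
    by (simp add: algebra_simps)
  also have "qint t (Suc b) + t ^ Suc b * qint t a = qint t (Suc (a + b))"
    unfolding qint_add[symmetric] by (simp add: add.commute)
  finally show ?thesis .
qed

lemma sym_unimodal_run_mult:
  "2 * r + m + m' = c + 2 \<Longrightarrow>
    sym_unimodal c (var_q ^ e * var_p ^ d * (var_t ^ r * (qint var_t m * qint var_t m')))"
proof (induction m arbitrary: r m')
  case 0
  then show ?case by (simp add: sym_unimodal.zero)
next
  case (Suc m)
  show ?case
  proof (cases m')
    case 0
    then show ?thesis by (simp add: sym_unimodal.zero)
  next
    case m': (Suc k)
    have "sym_unimodal c (var_q ^ e * var_p ^ d * (var_t ^ Suc r * (qint var_t m * qint var_t k)))"
      using Suc.prems m' by (intro Suc.IH) simp
    moreover have "sym_unimodal c (var_q ^ e * var_p ^ d * (var_t ^ r * qint var_t (Suc (m + k))))"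
      using Suc.prems m' by (intro sym_unimodal_run) simp
    ultimately have "sym_unimodal c (var_q ^ e * var_p ^ d * (var_t ^ r * qint var_t (Suc (m + k))) +
        var_q ^ e * var_p ^ d * (var_t ^ Suc r * (qint var_t m * qint var_t k)))"
      by (rule sym_unimodal_add)
    then show ?thesis unfolding m' qint_mult_Suc by (simp add: algebra_simps)
  qed
qed

lemma sym_unimodal_mult:
  assumes "sym_unimodal c P" "sym_unimodal c' Q"
  shows "sym_unimodal (c + c') (P * Q)"
  using assms(2)
proof (induction rule: sym_unimodal.induct)
  case (add c' Q r' m' e' d')
  have "sym_unimodal (c + c') (P * (var_q ^ e' * var_p ^ d' * (var_t ^ r' * qint var_t m')))"
    using assms(1)
  proof (induction rule: sym_unimodal.induct)
    case (add c P r m e d)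
    have "sym_unimodal (c + c') (var_q ^ (e + e') * var_p ^ (d + d') * (var_t ^ (r + r') * (qint var_t m * qint var_t m')))"
      using add.hyps(2) \<open>2 * r' + m' = Suc c'\<close> by (intro sym_unimodal_run_mult) simp
    from sym_unimodal_add[OF this add.IH] show ?case
      by (simp add: power_add algebra_simps)
  qed (simp add: sym_unimodal.zero)
  from sym_unimodal_add[OF this add.IH] show ?case by (simp add: algebra_simps)
qed (simp add: sym_unimodal.zero)

lemma sym_unimodal_monomial: "sym_unimodal 0 (var_q ^ e * var_p ^ d)"
  using sym_unimodal_run[of 0 1 0 e d] by (simp add: qint_def)

lemma coeff_run:
  "coeff (run e d r m) i =
    (if r \<le> i \<and> i < r + m then Poly_Mapping.single (int e, d) 1 else 0)"
proof -
  have vt: "var_t ^ j = monom 1 j" for j by (simp add: var_t_def monom_altdef)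
  have mono: "var_q ^ e * var_p ^ d = monom (Poly_Mapping.single (int e, d) 1) 0"
    using monomial_subst[of e d 0] by simp
  have "coeff (run e d r m) i =
      (\<Sum>j<m. if r + j = i then Poly_Mapping.single (int e, d) 1 else 0)"
    unfolding mono qint_def vt sum_distrib_left coeff_sum by (simp add: mult_monom)
  also have "\<dots> = (\<Sum>j<m. if j = i - r then (if r \<le> i then Poly_Mapping.single (int e, d) 1 else 0) else 0)"
    by (intro sum.cong) auto
  also have "\<dots> = (if r \<le> i \<and> i < r + m then Poly_Mapping.single (int e, d) 1 else 0)"
    by (auto simp: sum.delta)
  finally show ?thesis .
qed

text \<open>Symmetry about \<open>c / 2\<close>, stated without reference to the lowest and highest exponents and hence
closed under sums and differences.\<close>

definition centered :: "nat \<Rightarrow> laurent_qp poly \<Rightarrow> bool" where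
  "centered c P \<longleftrightarrow> (\<forall>i\<le>c. coeff P i = coeff P (c - i)) \<and> (\<forall>i>c. coeff P i = 0)"

lemma centeredI:
  "(\<And>i. i \<le> c \<Longrightarrow> coeff P i = coeff P (c - i)) \<Longrightarrow> (\<And>i. c < i \<Longrightarrow> coeff P i = 0) \<Longrightarrow> centered c P"
  unfolding centered_def by blast

lemma centered_flip: "centered c P \<Longrightarrow> i \<le> c \<Longrightarrow> coeff P i = coeff P (c - i)"
  unfolding centered_def by blast

lemma centered_above: "centered c P \<Longrightarrow> c < i \<Longrightarrow> coeff P i = 0"
  unfolding centered_def by blast

lemma centered_0: "centered c 0"
  by (simp add: centeredI)

lemma centered_add:
  assumes "centered c P" "centered c Q"
  shows "centered c (P + Q)"
proof (rule centeredI)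
  fix i assume "i \<le> c"
  then show "coeff (P + Q) i = coeff (P + Q) (c - i)"
    using centered_flip[OF assms(1), of i] centered_flip[OF assms(2), of i] by simp
qed (use assms in \<open>simp add: centered_above\<close>)

lemma centered_const_mult:
  assumes "centered c P"
  shows "centered c ([:a:] * P)"
proof (rule centeredI)
  fix i assume "i \<le> c"
  then show "coeff ([:a:] * P) i = coeff ([:a:] * P) (c - i)"
    using centered_flip[OF assms, of i] by simp
qed (use assms in \<open>simp add: centered_above\<close>)

lemma centered_diff:
  assumes "centered c P" "centered c Q"
  shows "centered c (P - Q)"
  using centered_add[OF assms(1) centered_const_mult[OF assms(2), of "- 1"]] by simp

lemma centered_sum: "(\<And>i. i \<in> I \<Longrightarrow> centered c (f i)) \<Longrightarrow> centered c (sum f I)"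
  by (induction I rule: infinite_finite_induct) (auto intro: centered_0 centered_add)

lemma run_cases:
  assumes "2 * r + m = Suc c"
  shows "i \<le> c \<Longrightarrow> (r \<le> c - i \<and> c - i < r + m) \<longleftrightarrow> (r \<le> i \<and> i < r + m)"
    "c < i \<Longrightarrow> \<not> (r \<le> i \<and> i < r + m)"
proof -
  show "(r \<le> c - i \<and> c - i < r + m) \<longleftrightarrow> (r \<le> i \<and> i < r + m)" if "i \<le> c"
  proof -
    from that obtain j where j: "c = i + j" using le_Suc_ex by blast
    have "r \<le> j \<longleftrightarrow> i < r + m" "j < r + m \<longleftrightarrow> r \<le> i" using assms j by linarith+
    then show ?thesis unfolding j by simp blast
  qed
qed (use assms in linarith)

lemma sym_unimodal_centered: "sym_unimodal c P \<Longrightarrow> centered c P"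
proof (induction rule: sym_unimodal.induct)
  case (add c P r m e d)
  have "centered c (run e d r m)"
  proof (rule centeredI)
    fix i assume "i \<le> c"
    then show "coeff (run e d r m) i =
        coeff (run e d r m) (c - i)"
      by (simp only: coeff_run run_cases(1)[OF add.hyps(2)])
  next
    fix i assume "c < i"
    then show "coeff (run e d r m) i = 0"
      by (simp only: coeff_run run_cases(2)[OF add.hyps(2)] if_False)
  qed
  with add show ?case by (intro centered_add)
qed (rule centered_0)

lemma sym_unimodal_increasing:
  assumes "sym_unimodal c P" "2 * i < c"
  shows "coeff_le (coeff P i) (coeff P (Suc i))"
proof -
  have "0 \<le> Poly_Mapping.lookup (coeff P (Suc i) - coeff P i) w" for w
    using assms
  proof (induction rule: sym_unimodal.induct)
    case (add c P r m e d)
    let ?R = "run e d r m"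
    have "(r \<le> i \<and> i < r + m) \<longrightarrow> (r \<le> Suc i \<and> Suc i < r + m)" using add by auto
    then have "0 \<le> Poly_Mapping.lookup (coeff ?R (Suc i)) w - Poly_Mapping.lookup (coeff ?R i) w"
      by (auto simp: coeff_run lookup_single when_def)
    moreover have "0 \<le> Poly_Mapping.lookup (coeff P (Suc i)) w - Poly_Mapping.lookup (coeff P i) w"
      using add by (simp add: lookup_minus)
    ultimately show ?case by (simp add: lookup_minus lookup_add)
  qed simp
  then show ?thesis by (simp add: coeff_le_def)
qed

text \<open>The reflection \<open>i \<mapsto> c - i\<close> exchanges the lowest and the highest exponent of a nonzero coefficient.\<close>

lemma low_degree_centered:
  assumes P: "centered c P" "P \<noteq> 0"
  shows "degree P + low_degree P = c" "low_degree P \<le> degree P"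
proof -
  let ?r = "low_degree P" and ?s = "degree P"
  have s: "coeff P ?s \<noteq> 0" using P by simp
  have r: "coeff P ?r \<noteq> 0" unfolding low_degree_def using s by (rule LeastI)
  have rle: "?r \<le> i" if "coeff P i \<noteq> 0" for i unfolding low_degree_def using that by (rule Least_le)
  show le: "?r \<le> ?s" by (rule rle[OF s])
  have "?s \<le> c" using s centered_above[OF P(1), of ?s] by (cases "?s \<le> c") auto
  moreover have "coeff P (c - ?s) \<noteq> 0" using centered_flip[OF P(1) \<open>?s \<le> c\<close>] s by simp
  then have "?r \<le> c - ?s" by (rule rle)
  moreover have "coeff P (c - ?r) \<noteq> 0" using centered_flip[OF P(1), of ?r] r le \<open>?s \<le> c\<close> by simp
  then have "c - ?r \<le> ?s" by (rule le_degree)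
  ultimately show "?s + ?r = c" using le by linarith
qed

lemma centered_t_symmetric:
  assumes P: "centered c P" "P \<noteq> 0"
  shows "t_symmetric P (of_nat c / 2)"
proof -
  note d = low_degree_centered[OF P]
  have "coeff P (low_degree P + i) = coeff P (degree P - i)" if "i \<in> {0..degree P - low_degree P}" for i
  proof -
    have "coeff P (low_degree P + i) = coeff P (c - (low_degree P + i))"
      using d that by (intro centered_flip[OF P(1)]) auto
    also have "c - (low_degree P + i) = degree P - i" using d by linarith
    finally show ?thesis .
  qed
  moreover have "(of_nat c :: rat) = of_nat (degree P) + of_nat (low_degree P)"
    using d by (metis of_nat_add)
  ultimately show ?thesis using P(2) by (simp add: t_symmetric_def Let_def)
qed

lemma sym_unimodal_t_unimodal:
  assumes P: "sym_unimodal c P" "P \<noteq> 0"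
  shows "t_unimodal coeff_le P"
proof -
  have cen: "centered c P" by (rule sym_unimodal_centered[OF P(1)])
  note d = low_degree_centered[OF cen P(2)]
  have "coeff_le (coeff P i) (coeff P (i + 1))" if "i < c div 2" for i
    using sym_unimodal_increasing[OF P(1), of i] that by simp
  moreover have "coeff P (c div 2) = coeff P ((c + 1) div 2)"
  proof -
    have "coeff P (c div 2) = coeff P (c - c div 2)" by (rule centered_flip[OF cen]) simp
    also have "c - c div 2 = (c + 1) div 2" by linarith
    finally show ?thesis .
  qed
  moreover have "coeff_le (coeff P (i + 1)) (coeff P i)" if "(c + 1) div 2 \<le> i" "i < degree P" for i
  proof -
    have ic: "Suc i \<le> c" using that d by simp
    have "coeff_le (coeff P (c - Suc i)) (coeff P (Suc (c - Suc i)))"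
      using that ic by (intro sym_unimodal_increasing[OF P(1)]) linarith
    also have "coeff P (c - Suc i) = coeff P (i + 1)" using centered_flip[OF cen, of "i + 1"] ic by simp
    also have "coeff P (Suc (c - Suc i)) = coeff P i" using centered_flip[OF cen, of i] ic by (simp add: Suc_diff_Suc)
    finally show ?thesis .
  qed
  ultimately show ?thesis using P(2) unfolding t_unimodal_def Let_def d by simp
qed

lemma block_coeff_sym_unimodal: "sym_unimodal a (block_coeff var_t a)"
proof (cases "a = 0")
  case False
  then show ?thesis using sym_unimodal_run[of 1 "a - 1" a 0 0] by (simp add: block_coeff_def)
qed (simp add: sym_unimodal.zero)

text \<open>The factor of a letter with multiplicity \<open>a\<close> has center \<open>a / 2\<close>, so the centers add up to half the
number of positions.\<close>

lemma content_wt_sym_unimodal: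
  "sym_unimodal (\<Sum>i<L. m i) (content_wt (block_coeff var_t) L m)"
proof (induction L arbitrary: m)
  case 0
  then show ?case using sym_unimodal_monomial[of 0 0] by simp
next
  case (Suc L)
  show ?case
  proof (cases "\<forall>i\<le>L. m i = 0")
    case True
    then show ?thesis using sym_unimodal_monomial[of 0 0] by (simp add: less_Suc_eq_le)
  next
    case False
    have "sym_unimodal (m 0 + (\<Sum>i<L. m (Suc i)))
        (block_coeff var_t (m 0) * content_wt (block_coeff var_t) L (\<lambda>i. m (Suc i)))"
      by (intro sym_unimodal_mult block_coeff_sym_unimodal Suc.IH)
    then show ?thesis using False by (simp only: sum.lessThan_Suc_shift content_wt.simps if_False)
  qed
qed

section \<open>Word expansions of the Eulerian polynomials\<close>

text \<open>Adds the position \<open>0\<close>, so that compatible sequences have positive values.\<close>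

definition anchored :: "nat \<Rightarrow> nat set \<Rightarrow> nat set" where
  "anchored n S = {i. i < n \<and> (i = 0 \<or> i \<in> S)}"

lemma compat_sum_anchored: "compat_sum x n (anchored n S) M = compat_sum x n (insert 0 S) M"
proof -
  have "pparts n (anchored n S) M = pparts n (insert 0 S) M"
    by (simp add: pparts_def anchored_def cong: conj_cong)
  then show ?thesis by (simp add: compat_sum_def)
qed

lemma sum_anchored:
  assumes "S \<subseteq> {..<n::nat}"
  shows "\<Sum>(anchored n S) = \<Sum>S"
proof -
  have "anchored n S - {0} = S - {0}" using assms by (auto simp: anchored_def)
  moreover have "finite (anchored n S)" "finite S"
    using assms finite_subset by (auto simp: anchored_def)
  ultimately show ?thesis by (metis add_0 insert_Diff_single sum.insert_remove sum_diff1_nat diff_zero)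
qed

definition words :: "nat \<Rightarrow> nat list set" where
  "words n = {u. set u \<subseteq> {..<Suc n} \<and> length u = n}"

definition word_wt :: "'a::comm_ring_1 \<Rightarrow> (nat \<Rightarrow> 'a) \<Rightarrow> nat list \<Rightarrow> 'a" where
  "word_wt t \<phi> u = \<phi> (count (mset u) 0) *
     content_wt (block_coeff t) (length u) (\<lambda>i. count (mset u) (Suc i))"

lemma finite_words: "finite (words n)"
  by (simp add: words_def finite_lists_length_eq)

lemma sum_words_wt:
  "(\<Sum>u\<in>words n. word_wt t \<phi> u * compat_sum x n (word_descents u) M) =
    (\<Sum>a\<le>n. \<phi> a * complete_hom x {1..M} a * reduced_coeff x t M (n - a))"
  unfolding sum_words[symmetric] words_def by (intro sum.cong) (auto simp: word_wt_def)

lemma finite_perms_fix: "finite (perms_fix n k)"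
  by (rule finite_subset[OF _ finite_permutations[of "{1..n}"]]) auto

lemma num_fix_le: "num_fix n \<sigma> \<le> n"
proof -
  have "card {i \<in> {1..n}. \<sigma> i = i} \<le> card {1..n}" by (rule card_mono) auto
  then show ?thesis by (simp add: num_fix_def)
qed

text \<open>The letter \<open>0\<close> takes the place of the fixed points: it occurs \<open>k\<close> times, with weight \<open>1\<close>.\<close>

lemma expansion_fixed:
  fixes t q p :: "'a::comm_ring_1"
  assumes "k \<le> n"
  shows "(\<Sum>\<sigma>\<in>perms_fix n k.
      t ^ exc n \<sigma> * q ^ \<Sum>(anchored n (exc_descents n \<sigma>)) * p ^ card (anchored n (exc_descents n \<sigma>))) =
    (\<Sum>u\<in>words n. word_wt t (\<lambda>a. of_bool (a = k)) u * q ^ \<Sum>(word_descents u) * p ^ card (word_descents u))"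
proof (rule weighted_major_index_eqI[where n = n])
  fix M
  have "(\<Sum>\<sigma>\<in>perms_fix n k.
      t ^ exc n \<sigma> * compat_sum (qweight q M) n (anchored n (exc_descents n \<sigma>)) M) =
      complete_hom (qweight q M) {1..M} k * fps_nth (reduced_gf (qweight q M) t {1..M}) (n - k)"
    (is "?L = _")
    unfolding compat_sum_anchored by (rule sum_compat(2)[OF assms])
  also have "\<dots> = (\<Sum>u\<in>words n. word_wt t (\<lambda>a. of_bool (a = k)) u * compat_sum (qweight q M) n (word_descents u) M)"
    (is "_ = ?R")
    unfolding sum_words_wt using assms by (simp add: of_bool_def if_distrib[of "\<lambda>z. z * _"] cong: if_cong)
  finally show "?L = ?R" .
qed (use finite_perms_fix[of n k] finite_words[of n] in \<open>auto simp: anchored_def words_def word_descents_def\<close>)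

text \<open>Summing \<open>h\<^sub>k Y\<close> over \<open>k\<close> gives the coefficients of \<open>H Y\<close>, and \<open>(H - T) Y = 1\<close> rewrites it as \<open>1 + T Y\<close>,
where \<open>T\<close> has the coefficients \<open>[a] h\<^sub>a\<close>. The first factor now has center \<open>(a - 1) / 2\<close>, which accounts
for the center \<open>(n - 1) / 2\<close>.\<close>

lemma expansion_all:
  fixes t q p :: "'a::comm_ring_1"
  assumes "0 < n"
  shows "(\<Sum>\<sigma> | \<sigma> permutes {1..n}.
      t ^ exc n \<sigma> * q ^ \<Sum>(anchored n (exc_descents n \<sigma>)) * p ^ card (anchored n (exc_descents n \<sigma>))) =
    (\<Sum>u\<in>words n. word_wt t (qint t) u * q ^ \<Sum>(word_descents u) * p ^ card (word_descents u))"
proof (rule weighted_major_index_eqI[where n = n])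
  fix M
  let ?x = "qweight q M" and ?S = "\<lambda>\<sigma>. anchored n (exc_descents n \<sigma>)"
  let ?h = "complete_hom ?x {1..M}" and ?Y = "reduced_gf ?x t {1..M}"
  have "(\<Sum>\<sigma> | \<sigma> permutes {1..n}. t ^ exc n \<sigma> * compat_sum ?x n (?S \<sigma>) M) =
      (\<Sum>k\<le>n. \<Sum>\<sigma> | \<sigma> \<in> {\<sigma>. \<sigma> permutes {1..n}} \<and> num_fix n \<sigma> = k. t ^ exc n \<sigma> * compat_sum ?x n (?S \<sigma>) M)"
    (is "?L = _")
    by (intro sum.group[symmetric]) (auto simp: finite_permutations num_fix_le)
  also have "\<dots> = (\<Sum>k\<le>n. ?h k * fps_nth ?Y (n - k))"
    using sum_compat(2)[of _ n t ?x M] by (simp add: compat_sum_anchored)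
  also have "\<dots> = fps_nth (hom_gf ?x {1..M} * ?Y) n"
    by (simp add: fps_mult_nth hom_gf_def atMost_atLeast0)
  also have "hom_gf ?x {1..M} * ?Y = 1 + weighted_hom_gf ?x t {1..M} * ?Y"
    using reduced_gf_eq[of ?x M t] by (simp add: left_diff_distrib diff_eq_eq)
  also have "fps_nth (1 + weighted_hom_gf ?x t {1..M} * ?Y) n = (\<Sum>a\<le>n. qint t a * ?h a * fps_nth ?Y (n - a))"
    using assms by (simp add: fps_mult_nth weighted_hom_gf_def atMost_atLeast0)
  also have "\<dots> = (\<Sum>u\<in>words n. word_wt t (qint t) u * compat_sum ?x n (word_descents u) M)"
    (is "_ = ?R")
    by (rule sum_words_wt[symmetric])
  finally show "?L = ?R" .
qed (use finite_words[of n] in \<open>auto simp: finite_permutations anchored_def words_def word_descents_def\<close>)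

lemma sum_count_word:
  assumes "u \<in> words n"
  shows "count (mset u) 0 + (\<Sum>i<n. count (mset u) (Suc i)) = n"
proof -
  have "(\<Sum>i<Suc n. count (mset u) i) = n"
    using assms by (subst sum_count) (auto simp: words_def)
  then show ?thesis by (simp only: sum.lessThan_Suc_shift)
qed

lemma word_wt_fixed_sym_unimodal:
  assumes "u \<in> words n"
  shows "sym_unimodal (n - k) (word_wt var_t (\<lambda>a. of_bool (a = k)) u)"
proof (cases "count (mset u) 0 = k")
  case True
  have "(\<Sum>i<n. count (mset u) (Suc i)) = n - k" using sum_count_word[OF assms] True by simp
  then show ?thesis
    using content_wt_sym_unimodal[of "\<lambda>i. count (mset u) (Suc i)" n] assms True
    by (simp add: word_wt_def words_def)
qed (simp add: word_wt_def sym_unimodal.zero)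

lemma word_wt_qint_sym_unimodal:
  assumes "u \<in> words n"
  shows "sym_unimodal (n - 1) (word_wt var_t (qint var_t) u)"
proof (cases "count (mset u) 0")
  case (Suc a)
  have "(\<Sum>i<n. count (mset u) (Suc i)) + a = n - 1" using sum_count_word[OF assms] Suc by simp
  moreover have "sym_unimodal a (qint var_t (Suc a))"
    using sym_unimodal_run[of 0 "Suc a" a 0 0] by simp
  then have "sym_unimodal (a + (\<Sum>i<n. count (mset u) (Suc i)))
      (qint var_t (Suc a) * content_wt (block_coeff var_t) n (\<lambda>i. count (mset u) (Suc i)))"
    by (intro sym_unimodal_mult content_wt_sym_unimodal)
  ultimately show ?thesis
    using assms Suc by (simp add: word_wt_def words_def add.commute)
next
  case 0
  then show ?thesis by (simp only: word_wt_def qint_0 mult_zero_left sym_unimodal.zero)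
qed

text \<open>The powers of \<open>q\<inverse>\<close> cancel against the excess of \<open>maj\<close> over the sum of the barred descents.\<close>

lemma summand_eq:
  assumes "\<sigma> permutes {1..n}"
  shows "var_q ^ maj n \<sigma> * P * (inv_q * var_t) ^ exc n \<sigma> = var_t ^ exc n \<sigma> * var_q ^ \<Sum>(exc_descents n \<sigma>) * P"
proof -
  have "var_q ^ maj n \<sigma> * P * (inv_q * var_t) ^ exc n \<sigma> =
      var_t ^ exc n \<sigma> * var_q ^ \<Sum>(exc_descents n \<sigma>) * P * (var_q * inv_q) ^ exc n \<sigma>"
    unfolding exc_descents_stats(2)[OF assms, symmetric] power_add power_mult_distrib by (simp only: mult_ac)
  then show ?thesis by (simp add: var_q_mult_inv_q)
qed

lemma exc_descents_less: "exc_descents n \<sigma> \<subseteq> {..<n}"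
  by (auto simp: exc_descents_def)

text \<open>If \<open>1\<close> is not fixed, then it is an excedance, and position \<open>0\<close> is a descent of the barred word.\<close>

lemma anchored_derangement:
  assumes \<sigma>: "\<sigma> permutes {1..n}" and "num_fix n \<sigma> = 0"
  shows "anchored n (exc_descents n \<sigma>) = exc_descents n \<sigma>"
proof -
  have "0 \<in> exc_descents n \<sigma>" if "0 < n"
  proof -
    have "\<sigma> 1 \<noteq> 1" using assms(2) that by (auto simp: num_fix_def)
    moreover have "\<sigma> 1 \<in> {1..n}" using permutes_in_image[OF \<sigma>, of 1] that by simp
    moreover have "\<sigma> 0 = 0" by (rule permutes_not_in[OF \<sigma>]) simp
    ultimately show ?thesis using that by (auto simp: exc_descents_def less_prod_def)
  qed
  then show ?thesis using exc_descents_less[of n \<sigma>] by (auto simp: anchored_def)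
qed

lemma sym_unimodal_words:
  assumes "\<And>u. u \<in> words n \<Longrightarrow> sym_unimodal c (word_wt var_t \<phi> u)"
    and P: "\<And>e d. sym_unimodal 0 (var_q ^ e * P ^ d)"
  shows "sym_unimodal c (\<Sum>u\<in>words n. word_wt var_t \<phi> u * var_q ^ \<Sum>(word_descents u) * P ^ card (word_descents u))"
proof (rule sym_unimodal_sum)
  fix u assume "u \<in> words n"
  from sym_unimodal_mult[OF assms(1)[OF this] P]
  show "sym_unimodal c (word_wt var_t \<phi> u * var_q ^ \<Sum>(word_descents u) * P ^ card (word_descents u))"
    by (simp add: mult.assoc)
qed

lemma sym_unimodal_A_fix_0: "sym_unimodal n (A_fix n 0 var_q var_p (inv_q * var_t))"
proof -
  have "A_fix n 0 var_q var_p (inv_q * var_t) = (\<Sum>\<sigma> | \<sigma> permutes {1..n} \<and> num_fix n \<sigma> = 0.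
      var_t ^ exc n \<sigma> * var_q ^ \<Sum>(anchored n (exc_descents n \<sigma>)) * var_p ^ card (anchored n (exc_descents n \<sigma>)))"
    unfolding A_fix_def
    by (intro sum.cong refl) (simp add: summand_eq anchored_derangement exc_descents_stats(1))
  also have "sym_unimodal n \<dots>"
    unfolding expansion_fixed[OF le0]
    using word_wt_fixed_sym_unimodal[of _ n 0] by (intro sym_unimodal_words sym_unimodal_monomial) simp
  finally show ?thesis .
qed

lemma sym_unimodal_q: "sym_unimodal 0 (var_q ^ e * 1 ^ d)"
  using sym_unimodal_monomial[of e 0] by simp

text \<open>At \<open>p = 1\<close> only the sum of the descents matters, and adding the position \<open>0\<close> does not change it.\<close>

lemma sym_unimodal_A_fix_1:
  assumes "k \<le> n"
  shows "sym_unimodal (n - k) (A_fix n k var_q 1 (inv_q * var_t))"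
proof -
  have "A_fix n k var_q 1 (inv_q * var_t) = (\<Sum>\<sigma>\<in>perms_fix n k.
      var_t ^ exc n \<sigma> * var_q ^ \<Sum>(anchored n (exc_descents n \<sigma>)) * 1 ^ card (anchored n (exc_descents n \<sigma>)))"
    unfolding A_fix_def
    by (intro sum.cong refl) (simp add: summand_eq[where P = 1, simplified] sum_anchored[OF exc_descents_less])
  also have "sym_unimodal (n - k) \<dots>"
    unfolding expansion_fixed[OF assms]
    by (intro sym_unimodal_words sym_unimodal_q word_wt_fixed_sym_unimodal)
  finally show ?thesis .
qed

lemma sym_unimodal_A_1:
  assumes "0 < n"
  shows "sym_unimodal (n - 1) (A n var_q 1 (inv_q * var_t))"
proof -
  have "A n var_q 1 (inv_q * var_t) = (\<Sum>\<sigma> | \<sigma> permutes {1..n}.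
      var_t ^ exc n \<sigma> * var_q ^ \<Sum>(anchored n (exc_descents n \<sigma>)) * 1 ^ card (anchored n (exc_descents n \<sigma>)))"
    unfolding A_def
    by (intro sum.cong refl) (simp add: summand_eq[where P = 1, simplified] sum_anchored[OF exc_descents_less])
  also have "sym_unimodal (n - 1) \<dots>"
    unfolding expansion_all[OF assms]
    by (intro sym_unimodal_words sym_unimodal_q word_wt_qint_sym_unimodal)
  finally show ?thesis .
qed

section \<open>Symmetry with both variables, and the theorem\<close>

text \<open>Constants of the polynomial ring in \<open>t\<close>: multiplication by them preserves symmetry in \<open>t\<close>.\<close>

definition t_free :: "laurent_qp poly \<Rightarrow> bool" where
  "t_free P \<longleftrightarrow> (\<exists>a. P = [:a:])"

lemma t_free_mult: "t_free P \<Longrightarrow> t_free Q \<Longrightarrow> t_free (P * Q)"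
  by (auto simp: t_free_def)

lemma t_free_1: "t_free 1"
  by (auto simp: t_free_def one_pCons)

lemma t_free_power: "t_free P \<Longrightarrow> t_free (P ^ n)"
  by (induction n) (auto intro: t_free_1 t_free_mult)

lemma t_free_0: "t_free 0"
  unfolding t_free_def by (rule exI[of _ 0]) simp

lemma t_free_add: "t_free P \<Longrightarrow> t_free Q \<Longrightarrow> t_free (P + Q)"
  by (auto simp: t_free_def)

lemma t_free_sum: "(\<And>i. i \<in> I \<Longrightarrow> t_free (f i)) \<Longrightarrow> t_free (sum f I)"
  by (induction I rule: infinite_finite_induct) (auto intro: t_free_0 t_free_add)

lemma t_free_prod: "(\<And>i. i \<in> I \<Longrightarrow> t_free (f i)) \<Longrightarrow> t_free (prod f I)"
  by (induction I rule: infinite_finite_induct) (auto intro: t_free_1 t_free_mult)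

lemma t_free_var_q: "t_free var_q"
  by (simp add: t_free_def var_q_def)

lemma t_free_var_p: "t_free var_p"
  by (simp add: t_free_def var_p_def)

lemma t_free_compat_sum: "t_free (compat_sum (qweight var_q M) n S M')"
  unfolding compat_sum_def qweight_def
  by (intro t_free_sum t_free_prod t_free_power t_free_var_q)

lemma t_free_complete_hom: "t_free (complete_hom (qweight var_q M) V k)"
proof -
  have "t_free (\<Prod>v\<in>#N. qweight var_q M v)" for N
    by (induction N) (auto simp: qweight_def intro: t_free_1 t_free_mult t_free_power t_free_var_q)
  then show ?thesis unfolding complete_hom_def by (intro t_free_sum)
qed

lemma centered_t_free: "centered c P \<Longrightarrow> t_free Q \<Longrightarrow> centered c (P * Q)"
  using centered_const_mult[of c P] by (auto simp: t_free_def mult.commute)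

lemma centered_reduced: "centered n (fps_nth (reduced_gf (qweight var_q M) var_t {1..M}) n)"
proof -
  have "(\<Sum>u\<in>words n. word_wt var_t (\<lambda>a. of_bool (a = 0)) u * compat_sum (qweight var_q M) n (word_descents u) M) =
      fps_nth (reduced_gf (qweight var_q M) var_t {1..M}) n" (is "?L = _")
    unfolding sum_words_wt
    by (simp add: of_bool_def if_distrib[of "\<lambda>z. z * _"] complete_hom_0 cong: if_cong)
  moreover have "centered n ?L"
    using word_wt_fixed_sym_unimodal[of _ n 0]
    by (intro centered_sum centered_t_free t_free_compat_sum sym_unimodal_centered) simp
  ultimately show ?thesis by simp
qed

text \<open>The coefficients \<open>U d\<close> of \<open>p ^ d\<close> solve a triangular system whose matrix is free of \<open>t\<close> and whose right
hand sides are symmetric in \<open>t\<close> with center \<open>(n - k) / 2\<close>.\<close>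

lemma centered_A_fix:
  assumes "k \<le> n"
  shows "centered (n - k) (A_fix n k var_q var_p (inv_q * var_t))"
proof -
  let ?G = "(perms_fix n k)"
  define U where "U = level_sum var_q ?G (\<lambda>\<sigma>. var_t ^ exc n \<sigma>) (exc_descents n)"
  let ?g = "\<lambda>m. partition_sum var_q n m"
  have conv: "(\<Sum>d\<le>M. U d * ?g (M - d)) =
      complete_hom (qweight var_q M) {0..M} k * fps_nth (reduced_gf (qweight var_q M) var_t {1..M}) (n - k)" for M
    unfolding U_def sum_compat(1)[OF assms, symmetric]
    by (rule sum_compat_sum[symmetric]) (use finite_perms_fix exc_descents_less in auto)
  have U: "centered (n - k) (U d)" for d
  proof (induction d rule: less_induct)
    case (less d)
    have "(\<Sum>i\<le>d. U i * ?g (d - i)) = (\<Sum>i<d. U i * ?g (d - i)) + U d"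
      by (simp flip: lessThan_Suc_atMost)
    then have "U d = fps_nth (reduced_gf (qweight var_q d) var_t {1..d}) (n - k) *
        complete_hom (qweight var_q d) {0..d} k - (\<Sum>i<d. U i * ?g (d - i))"
      unfolding conv by (simp add: algebra_simps)
    also have "centered (n - k) \<dots>"
      using less.IH
      by (intro centered_diff centered_sum centered_t_free centered_reduced t_free_complete_hom t_free_compat_sum) auto
    finally show ?case .
  qed
  have "A_fix n k var_q var_p (inv_q * var_t) = (\<Sum>\<sigma>\<in>?G.
      var_t ^ exc n \<sigma> * var_q ^ \<Sum>(exc_descents n \<sigma>) * var_p ^ card (exc_descents n \<sigma>))"
    unfolding A_fix_def by (intro sum.cong refl) (simp add: summand_eq exc_descents_stats(1))
  also have "\<dots> = (\<Sum>d\<le>n. U d * var_p ^ d)"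
    unfolding U_def by (rule sum_level_sum) (use finite_perms_fix exc_descents_less in auto)
  also have "centered (n - k) \<dots>"
    by (intro centered_sum centered_t_free U t_free_power t_free_var_p)
  finally show ?thesis .
qed

lemma A_fix_eq_0:
  fixes q p t :: "'a::comm_semiring_1"
  assumes "n < k"
  shows "A_fix n k q p t = 0"
proof -
  have "num_fix n \<sigma> \<noteq> k" for \<sigma> using num_fix_le[of n \<sigma>] assms by simp
  then show ?thesis by (simp add: A_fix_def)
qed

theorem theorem5p3:
  fixes n k :: nat
  shows
    "(A_fix n k var_q var_p (inv_q * var_t) \<noteq> 0 \<longrightarrow>
        t_symmetric (A_fix n k var_q var_p (inv_q * var_t)) ((of_nat n - of_nat k) / 2)) \<and>
     (A_fix n 0 var_q var_p (inv_q * var_t) \<noteq> 0 \<longrightarrow>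
        t_symmetric (A_fix n 0 var_q var_p (inv_q * var_t)) (of_nat n / 2) \<and>
        t_unimodal coeff_le (A_fix n 0 var_q var_p (inv_q * var_t))) \<and>
     (A_fix n k var_q 1 (inv_q * var_t) \<noteq> 0 \<longrightarrow>
        t_symmetric (A_fix n k var_q 1 (inv_q * var_t)) ((of_nat n - of_nat k) / 2) \<and>
        t_unimodal coeff_le (A_fix n k var_q 1 (inv_q * var_t))) \<and>
     (n \<ge> 1 \<and> A n var_q 1 (inv_q * var_t) \<noteq> 0 \<longrightarrow>
        t_symmetric (A n var_q 1 (inv_q * var_t)) ((of_nat n - 1) / 2) \<and>
        t_unimodal coeff_le (A n var_q 1 (inv_q * var_t)))"
proof (intro conjI impI; (elim conjE)?)
  assume nz: "A_fix n k var_q var_p (inv_q * var_t) \<noteq> 0"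
  then have "k \<le> n" using A_fix_eq_0[of n k] not_le by blast
  then show "t_symmetric (A_fix n k var_q var_p (inv_q * var_t)) ((of_nat n - of_nat k) / 2)"
    using centered_t_symmetric[OF centered_A_fix nz] by (simp add: of_nat_diff)
next
  assume nz: "A_fix n 0 var_q var_p (inv_q * var_t) \<noteq> 0"
  show "t_symmetric (A_fix n 0 var_q var_p (inv_q * var_t)) (of_nat n / 2)"
    by (rule centered_t_symmetric[OF sym_unimodal_centered[OF sym_unimodal_A_fix_0] nz])
  show "t_unimodal coeff_le (A_fix n 0 var_q var_p (inv_q * var_t))"
    by (rule sym_unimodal_t_unimodal[OF sym_unimodal_A_fix_0 nz])
next
  assume nz: "A_fix n k var_q 1 (inv_q * var_t) \<noteq> 0"
  then have "k \<le> n" using A_fix_eq_0[of n k] not_le by blast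
  note su = sym_unimodal_A_fix_1[OF this]
  show "t_symmetric (A_fix n k var_q 1 (inv_q * var_t)) ((of_nat n - of_nat k) / 2)"
    using centered_t_symmetric[OF sym_unimodal_centered[OF su] nz] \<open>k \<le> n\<close> by (simp add: of_nat_diff)
  show "t_unimodal coeff_le (A_fix n k var_q 1 (inv_q * var_t))"
    by (rule sym_unimodal_t_unimodal[OF su nz])
next
  assume n: "n \<ge> 1" and nz: "A n var_q 1 (inv_q * var_t) \<noteq> 0"
  then have su: "sym_unimodal (n - 1) (A n var_q 1 (inv_q * var_t))"
    by (intro sym_unimodal_A_1) simp
  show "t_symmetric (A n var_q 1 (inv_q * var_t)) ((of_nat n - 1) / 2)"
    using centered_t_symmetric[OF sym_unimodal_centered[OF su] nz] n by (simp add: of_nat_diff)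
  show "t_unimodal coeff_le (A n var_q 1 (inv_q * var_t))"
    by (rule sym_unimodal_t_unimodal[OF su nz])
qed

end
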